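(* Let $d\ge1$ and let $\widetilde{\mu}$ be an infinitely divisible distribution on $\mathbb{R}^{d}$ with Lévy–Khintchine triplet $(\widetilde{\Sigma},\widetilde{\nu},\widetilde{\gamma})$, so that $\widetilde\nu$ is its Lévy measure. Then the following three conditions are equivalent. (a) $\widetilde{\mu}\in G(\mathbb{R}^{d})$. (b) $\widetilde{\nu}=\mathcal{A}_{1}(\nu)$ with some $\nu\in\mathfrak{M}_{L}^{B}(\mathbb{R}^{d})\cap\mathfrak{M}_{L}^{1}(\mathbb{R}^{d})$. (c) $\widetilde{\nu}=\mathcal{A}_{1}(\Upsilon^{0}(\rho))$ with some $\rho\in\mathfrak{M}_{L}^{1}(\mathbb{R}^{d})$. In condition (b) or (c), the representation of $\widetilde{\nu}$ by $\nu$ or $\rho$ is unique.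
   Context: $\mathfrak{M}_L(\mathbb{R}^d)$ is the class of Lévy measures on $\mathbb{R}^d$: measures $\nu$ with $\nu(\{0\})=0$ and $\int_{\mathbb{R}^d}(1\wedge|x|^2)\,\nu(\mathrm{d}x)<\infty$. $\mathfrak{M}_L^1(\mathbb{R}^d)$ is the class of $\nu\in\mathfrak{M}_L(\mathbb{R}^d)$ with $\int_{\mathbb{R}^d}(1\wedge|x|)\,\nu(\mathrm{d}x)<\infty$. In the Lévy–Khintchine triplet $(\Sigma,\nu,\gamma)$ of an infinitely divisible distribution, $\Sigma$ is the Gaussian covariance matrix, $\nu$ the Lévy measure, and $\gamma\in\mathbb{R}^d$ the location parameter. For $s>0$ let $a_1(r;s)=2\pi^{-1}(s-r^2)^{-1/2}1_{(0,s^{1/2})}(r)$. For a measure $\nu$ on $\mathbb{R}^d$ define $$\mathcal{A}_1(\nu)(B)=\int_{\mathbb{R}^d\setminus\{0\}}\nu(\mathrm{d}x)\int_0^\infty a_1(r;|x|)\,1_B\!\left(r\frac{x}{|x|}\right)\mathrm{d}r,\qquad B\in\mathcal{B}(\mathbb{R}^d);$$ its domain is the class of measures $\nu$ with $\nu(\{0\})=0$ for which the right-hand side is a measure in $\mathfrak{M}_L(\mathbb{R}^d)$ (this domain equals $\mathfrak{M}_L^1(\mathbb{R}^d)$). $\Upsilon^0(\rho)(B)=\int_0^\infty\rho(u^{-1}B)\,\mathrm{e}^{-u}\,\mathrm{d}u$, $B\in\mathcal{B}(\mathbb{R}^d)$, for $\rho\in\mathfrak{M}_L(\mathbb{R}^d)$.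 Polar (radial) decomposition: a Lévy measure $\nu$ on $\mathbb{R}^d$ has polar decomposition $(\lambda,\nu_\xi)$ if $\lambda$ is a measure on the unit sphere $\mathbb{S}=\{\xi\in\mathbb{R}^d:|\xi|=1\}$ with $0\le\lambda(\mathbb{S})\le\infty$, and $\nu_\xi$, $\xi\in\mathbb{S}$, are measures on $(0,\infty)$ such that $\nu_\xi(E)$ is measurable in $\xi$ for each $E\in\mathcal{B}((0,\infty))$, $0<\nu_\xi((0,\infty))\le\infty$, and $\nu(B)=\int_{\mathbb{S}}\lambda(\mathrm{d}\xi)\int_{(0,\infty)}1_B(u\xi)\,\nu_\xi(\mathrm{d}u)$ for $B\in\mathcal{B}(\mathbb{R}^d)$. The $\nu_\xi$ are the radial component of $\nu$. $G(\mathbb{R}^d)$ (generalized type $G$ distributions) is the class of infinitely divisible $\mu$ on $\mathbb{R}^d$ whose Lévy measure has radial component $\nu_\xi(\mathrm{d}r)=g_\xi(r^2)\,\mathrm{d}r$, where $g_\xi(u)$ is measurable in $(\xi,u)$ and completely monotone in $u>0$. $\mathfrak{M}_L^B(\mathbb{R}^d)$ is the class of Lévy measures of the Goldie–Steutel–Bondesson class $B(\mathbb{R}^d)$: those $\nu\in\mathfrak{M}_L(\mathbb{R}^d)$ with radial component $\nu_\xi(\mathrm{d}r)=\ell_\xi(r)\,\mathrm{d}r$, where $\ell_\xi(r)$ is measurable in $(\xi,r)$ and completely monotone in $r>0$. It is known that $\mathfrak{M}_L^B(\mathbb{R}^d)=\Upsilon^0(\mathfrak{M}_L(\mathbb{R}^d))$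 and that $\Upsilon^0$ is one-to-one. *)

theory Defs
  imports "HOL-Probability.Probability"
begin

primrec conv_power :: "(real ^ 'n) measure \<Rightarrow> nat \<Rightarrow> (real ^ 'n) measure" where
  "conv_power \<rho> 0 = return borel 0"
| "conv_power \<rho> (Suc k) = convolution \<rho> (conv_power \<rho> k)"

definition infinitely_divisible :: "(real ^ 'n) measure \<Rightarrow> bool" where
  "infinitely_divisible \<mu> \<longleftrightarrow>
     prob_space \<mu> \<and> sets \<mu> = sets borel \<and>
     (\<forall>k\<ge>1. \<exists>\<rho>. prob_space \<rho> \<and> sets \<rho> = sets borel \<and> conv_power \<rho> k = \<mu>)"

definition levy_measures :: "(real ^ 'n) measure set" where
  "levy_measures =
     {\<nu>. sets \<nu> = sets borel \<and> emeasure \<nu> {0} = 0 \<and>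
          (\<integral>\<^sup>+x. ennreal (min 1 ((norm x)\<^sup>2)) \<partial>\<nu>) < \<infinity>}"

definition levy_measures1 :: "(real ^ 'n) measure set" where
  "levy_measures1 =
     {\<nu> \<in> levy_measures. (\<integral>\<^sup>+x. ennreal (min 1 (norm x)) \<partial>\<nu>) < \<infinity>}"

text \<open>The centering function is \<open>x / (1 + |x|\<^sup>2)\<close>. Another choice, such as \<open>x\<close> cut off
  at \<open>|x| \<le> 1\<close>, changes \<open>\<gamma>\<close> but neither \<open>\<Sigma>\<close> nor \<open>\<nu>\<close>.\<close>

definition has_levy_khintchine_triplet ::
    "(real ^ 'n) measure \<Rightarrow> real ^ 'n ^ 'n \<Rightarrow> (real ^ 'n) measure \<Rightarrow> real ^ 'n \<Rightarrow> bool" where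
  "has_levy_khintchine_triplet \<mu> \<Sigma> \<nu> \<gamma> \<longleftrightarrow>
     transpose \<Sigma> = \<Sigma> \<and> (\<forall>z. 0 \<le> z \<bullet> (\<Sigma> *v z)) \<and> \<nu> \<in> levy_measures \<and>
     (\<forall>z. (CLINT x|\<mu>. iexp (z \<bullet> x)) =
        exp (- complex_of_real (z \<bullet> (\<Sigma> *v z)) / 2
             + (CLINT x|\<nu>. iexp (z \<bullet> x) - 1
                  - \<i> * complex_of_real ((z \<bullet> x) / (1 + (norm x)\<^sup>2)))
             + \<i> * complex_of_real (\<gamma> \<bullet> z)))"

definition a1 :: "real \<Rightarrow> real \<Rightarrow> real" where
  "a1 r s = (if 0 < r \<and> r < sqrt s then 2 / pi * (s - r\<^sup>2) powr (- 1 / 2) else 0)"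

text \<open>The set function below is a measure for every Borel measure \<open>\<nu>\<close>, so \<open>measure_of\<close> does not
  fall back to the null measure; for \<open>Upsilon0\<close> the same holds when \<open>\<rho>\<close> is sigma-finite, in
  particular for a Levy measure. \<open>A1\<close> is total here. Its domain consists of the \<open>\<nu>\<close> with
  \<open>\<nu> {0} = 0\<close> and \<open>A1 \<nu> \<in> levy_measures\<close>, so an equation \<open>\<nu>' = A1 \<nu>\<close> with Levy measures
  \<open>\<nu>'\<close> and \<open>\<nu>\<close> already puts \<open>\<nu>\<close> in the domain.\<close>

definition A1 :: "(real ^ 'n) measure \<Rightarrow> (real ^ 'n) measure" where
  "A1 \<nu> = measure_of UNIV (sets borel)
     (\<lambda>B. \<integral>\<^sup>+x\<in>UNIV - {0}. (\<integral>\<^sup>+r\<in>{0<..}.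
            ennreal (a1 r (norm x)) * indicator B (r *\<^sub>R (x /\<^sub>R norm x)) \<partial>lborel) \<partial>\<nu>)"

definition Upsilon0 :: "(real ^ 'n) measure \<Rightarrow> (real ^ 'n) measure" where
  "Upsilon0 \<rho> = measure_of UNIV (sets borel)
     (\<lambda>B. \<integral>\<^sup>+u\<in>{0<..}. emeasure \<rho> ((\<lambda>x. inverse u *\<^sub>R x) ` B) * ennreal (exp (- u)) \<partial>lborel)"

definition completely_monotone :: "(real \<Rightarrow> real) \<Rightarrow> bool" where
  "completely_monotone f \<longleftrightarrow>
     (\<forall>k. \<forall>u>0. (deriv ^^ k) f field_differentiable (at u) \<and> 0 \<le> (- 1) ^ k * (deriv ^^ k) f u)"

definition polar_decomposition ::
    "(real ^ 'n) measure \<Rightarrow> (real ^ 'n) measure \<Rightarrow> (real ^ 'n \<Rightarrow> real measure) \<Rightarrow> bool" where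
  "polar_decomposition \<nu> \<Lambda> \<kappa> \<longleftrightarrow>
     space \<Lambda> = sphere 0 1 \<and> sets \<Lambda> = sets (restrict_space borel (sphere 0 1)) \<and>
     (\<forall>\<xi>\<in>sphere 0 1. space (\<kappa> \<xi>) = {0<..} \<and>
        sets (\<kappa> \<xi>) = sets (restrict_space borel {0<..}) \<and> 0 < emeasure (\<kappa> \<xi>) {0<..}) \<and>
     (\<forall>E\<in>sets (restrict_space borel {0<..}). (\<lambda>\<xi>. emeasure (\<kappa> \<xi>) E) \<in> borel_measurable \<Lambda>) \<and>
     (\<forall>B\<in>sets borel.
        emeasure \<nu> B = (\<integral>\<^sup>+\<xi>. (\<integral>\<^sup>+u. indicator B (u *\<^sub>R \<xi>) \<partial>(\<kappa> \<xi>)) \<partial>\<Lambda>))"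

definition has_radial_density :: "(real ^ 'n) measure \<Rightarrow> (real ^ 'n \<Rightarrow> real \<Rightarrow> real) \<Rightarrow> bool" where
  "has_radial_density \<nu> h \<longleftrightarrow>
     (\<exists>\<Lambda> \<kappa>. polar_decomposition \<nu> \<Lambda> \<kappa> \<and>
        (\<forall>\<xi>\<in>sphere 0 1. \<kappa> \<xi> = density (restrict_space lborel {0<..}) (\<lambda>r. ennreal (h \<xi> r))))"

definition completely_monotone_family :: "(real ^ 'n \<Rightarrow> real \<Rightarrow> real) \<Rightarrow> bool" where
  "completely_monotone_family g \<longleftrightarrow>
     (\<lambda>(\<xi>, u). g \<xi> u) \<in> borel_measurable
        (restrict_space borel (sphere 0 1) \<Otimes>\<^sub>M restrict_space borel {0<..}) \<and>
     (\<forall>\<xi>\<in>sphere 0 1. completely_monotone (g \<xi>))"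

definition levy_measures_B :: "(real ^ 'n) measure set" where
  "levy_measures_B =
     {\<nu> \<in> levy_measures. \<exists>l. completely_monotone_family l \<and> has_radial_density \<nu> l}"

definition type_G :: "(real ^ 'n) measure set" where
  "type_G =
     {\<mu>. infinitely_divisible \<mu> \<and>
          (\<exists>\<Sigma> \<nu> \<gamma> g. has_levy_khintchine_triplet \<mu> \<Sigma> \<nu> \<gamma> \<and>
             completely_monotone_family g \<and> has_radial_density \<nu> (\<lambda>\<xi> r. g \<xi> (r\<^sup>2)))}"

end

theory Submission
  imports Defs
begin

text \<open>Applied to a point mass at \<open>x\<close>, the composition of \<open>A1\<close> with \<open>Upsilon0\<close> gives the half-normal
  law \<open>2 (\<pi> |x|) powr (- 1/2) exp (- r\<^sup>2 / |x|) dr\<close> on the ray through \<open>x\<close>, and \<open>Upsilon0\<close> alone gives the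
  exponential law with mean \<open>|x|\<close>. As a function of \<open>r\<^sup>2\<close>, respectively \<open>r\<close>, both densities are multiples
  of \<open>exp (- t u)\<close> with \<open>t = 1 / |x|\<close>. Disintegrating \<open>\<rho>\<close> over directions therefore turns the images of
  \<open>\<rho>\<close> into measures whose radial densities are Laplace transforms, and Bernstein's theorem, with
  measurable dependence on the direction, goes back. The integrability conditions match because the
  law on the ray through \<open>x\<close> integrates \<open>min 1 (r\<^sup>2)\<close>, respectively \<open>min 1 r\<close>, to a quantity comparable
  with \<open>min 1 |x|\<close>.

  Bernstein's theorem and the disintegration are both reduced to the Hausdorff moment problem on
  \<open>[0, 1]\<close>, because the moments of a measure on \<open>[0, 1]\<close> determine it by explicit limits, which makes
  measurability in a parameter automatic. The representing measure \<open>\<rho>\<close> is unique since the integrals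
  of \<open>r ^ (2 j + 3) exp (- r\<^sup>2)\<close> over a cone are the moments of \<open>s / (1 + s)\<close> under \<open>\<rho>\<close>. Since the class \<open>type_G\<close> does
  not fix the Levy--Khintchine triplet, the uniqueness of the Levy measure is needed as well.\<close>

section \<open>The Hausdorff moment problem\<close>

text \<open>With y = exp (- t), a Laplace transform f u of a measure in t reads f u = f 1 *
  (integral of y powr (u - 1)) for a probability on (0, 1] whose moments are the samples f (1 + k) /
  f 1. This is how Bernstein's theorem turns into a moment problem. The ends of the interval need
  separate care: mass at y = 0 (t infinite) is excluded by the continuity of f, mass at y = 1 (t =
  0, a point at infinite distance on the ray) by the integrability of the Levy measure. The measures
  involved are infinite. \<rho> becomes finite under the weight min 1 |x|, which is divided out
  again later. The spherical part of a given polar decomposition need not even be sigma-finite; the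
  integral over it always stays outermost, and orders of integration are exchanged only inside,
  along a single ray. The exponential and the half-normal law are two instances of
  \<open>laplace_kernel\<close>, so each direction of the correspondence between mixtures and radial
  densities is proved once and used for both (b) and (c). Uniqueness in (b) is then inherited from
  (c).\<close>

definition ndiff :: "(nat \<Rightarrow> real) \<Rightarrow> nat \<Rightarrow> real" where
  "ndiff m k = m k - m (Suc k)"

lemma ndiff_funpow_Suc: "(ndiff ^^ Suc l) m k = (ndiff ^^ l) m k - (ndiff ^^ l) m (Suc k)"
  by (simp add: ndiff_def)

text \<open>On sequences the identity is shift plus \<open>ndiff\<close>, two commuting operators;
  this is the binomial expansion of its N-th power. For moments of a measure it integrates y^j * (y
  + (1 - y))^N.\<close>

lemma sum_binomial_ndiff:
  "(\<Sum>i\<le>N. real (N choose i) * (ndiff ^^ (N - i)) m (j + i)) = m j"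
proof (induction N arbitrary: m j)
  case 0
  show ?case by simp
next
  case (Suc N)
  define f where "f i = (ndiff ^^ (Suc N - i)) m (j + i)" for i
  have f0: "f i = (ndiff ^^ (N - i)) (ndiff m) (j + i)" if "i \<le> N" for i
    using that by (simp add: f_def Suc_diff_le funpow_Suc_right del: funpow.simps)
  have f1: "f (Suc i) = (ndiff ^^ (N - i)) m (Suc j + i)" for i
    by (simp add: f_def)
  \<comment> \<open>Pascal's rule: \<open>f 0\<close> and the last sum form the sum of level
    \<open>N\<close> for \<open>ndiff m\<close>, the middle sum is the one of level \<open>N\<close>
    started at \<open>Suc j\<close>. The induction hypothesis gives m j - m (Suc j) and m (Suc
    j).\<close>
  have "(\<Sum>i\<le>Suc N. real (Suc N choose i) * f i)
      = f 0 + (\<Sum>i\<le>N. real (N choose i) * f (Suc i)) + (\<Sum>i\<le>N. real (N choose Suc i) * f (Suc i))"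
    by (subst sum.atMost_Suc_shift) (simp add: distrib_right sum.distrib)
  moreover have "(\<Sum>i\<le>Suc N. real (N choose i) * f i) = f 0 + (\<Sum>i\<le>N. real (N choose Suc i) * f (Suc i))"
    by (subst sum.atMost_Suc_shift) simp
  moreover have "(\<Sum>i\<le>Suc N. real (N choose i) * f i) = (\<Sum>i\<le>N. real (N choose i) * f i)"
    by simp
  moreover have "\<dots> = ndiff m j"
    using Suc.IH[of "ndiff m" j] by (simp add: f0)
  moreover have "(\<Sum>i\<le>N. real (N choose i) * f (Suc i)) = m (Suc j)"
    using Suc.IH[of m "Suc j"] by (simp only: f1)
  ultimately have "(\<Sum>i\<le>Suc N. real (Suc N choose i) * f i) = m j"
    by (simp add: ndiff_def)
  then show ?case by (simp only: f_def)
qed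

text \<open>The binomial ratio is the falling factorial substitute for (k / n)^j. With it the
  discrete approximation of level n has the moment m j exactly, since (n choose k) (k choose j) = (n
  choose j) (n - j choose k - j) reduces the sum to \<open>sum_binomial_ndiff\<close>.\<close>

lemma sum_binomial_ndiff_falling:
  assumes "j \<le> n"
  shows "(\<Sum>k\<le>n. real (n choose k) * (ndiff ^^ (n - k)) m k * (real (k choose j) / real (n choose j))) = m j"
proof -
  let ?g = "\<lambda>k. real (n choose k) * (ndiff ^^ (n - k)) m k * (real (k choose j) / real (n choose j))"
  have pos: "0 < real (n choose j)" using assms by simp
  have "(\<Sum>k\<le>n. ?g k) = (\<Sum>k\<in>{j..n}. ?g k)"
    by (rule sum.mono_neutral_right) (auto simp: not_le)
  also have "\<dots> = (\<Sum>i\<le>n - j. ?g (j + i))"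
    using sum.shift_bounds_cl_nat_ivl[of ?g 0 j "n - j"] assms
    by (simp add: add.commute atMost_atLeast0)
  also have "\<dots> = (\<Sum>i\<le>n - j. real ((n - j) choose i) * (ndiff ^^ (n - j - i)) m (j + i))"
  proof (rule sum.cong[OF refl])
    fix i assume "i \<in> {..n - j}"
    then have "(n choose (j + i)) * ((j + i) choose j) = (n choose j) * ((n - j) choose i)"
      using choose_mult[of j "j + i" n] assms by auto
    then have "real (n choose (j + i)) * real ((j + i) choose j) = real (n choose j) * real ((n - j) choose i)"
      by (metis of_nat_mult)
    with pos show "?g (j + i) = real ((n - j) choose i) * (ndiff ^^ (n - j - i)) m (j + i)"
      by (simp add: field_simps)
  qed
  finally show ?thesis using sum_binomial_ndiff[of "n - j" m j] by (simp only:)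
qed

text \<open>The ratio is the product of (k - i) / (n - i) over i < j. Products of factors of norm at
  most 1 differ by at most the sum of the differences of their factors.\<close>

lemma binomial_ratio_approx:
  assumes "2 * j < n" "k \<le> n"
  shows "\<bar>real (k choose j) / real (n choose j) - (real k / real n) ^ j\<bar> \<le> real j * (real j / (real n - real j))"
proof -
  define z where "z i = (real k - real i) / (real n - real i)" for i
  have e1: "real (k choose j) / real (n choose j) = (\<Prod>i<j. z i)"
    unfolding z_def by (simp add: binomial_gbinomial[where 'a=real] gbinomial_prod_rev prod_dividef atLeast0LessThan)
  have e2: "(real k / real n) ^ j = (\<Prod>i<j. real k / real n)" by simp
  have "norm ((\<Prod>i<j. z i) - (\<Prod>i<j. real k / real n)) \<le> (\<Sum>i<j. norm (z i - real k / real n))"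
  proof (intro norm_prod_diff)
    fix i assume "i \<in> {..<j}"
    then have "real i < real j" "2 * real j < real n" "real k \<le> real n" using assms by auto
    \<comment> \<open>For k < i the numerator is negative; \<open>2 * j < n\<close> still keeps the
      factor in the unit ball.\<close>
    then have "\<bar>real k - real i\<bar> \<le> real n - real i" "0 < real n - real i" by auto
    then show "norm (z i) \<le> 1" by (simp add: z_def)
    show "norm (real k / real n) \<le> 1" using assms by simp
  qed
  moreover have "norm (z i - real k / real n) \<le> real j / (real n - real j)" if "i < j" for i
  proof -
    have "z i - real k / real n = - (real i * ((real n - real k) / real n)) / (real n - real i)"
    proof -
      have "real n - real i \<noteq> 0" "real n \<noteq> 0" using assms that by auto
      then show ?thesis unfolding z_def by (simp add: divide_simps) (simp add: algebra_simps)
    qed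
    also have "norm \<dots> = real i * ((real n - real k) / real n) / (real n - real i)"
      using assms that by (simp add: abs_mult)
    also have "\<dots> \<le> real j * 1 / (real n - real j)"
    proof (intro frac_le mult_mono)
      show "(real n - real k) / real n \<le> 1" by (cases "n = 0") auto
    qed (use assms that in auto)
    finally show ?thesis by simp
  qed
  then have "(\<Sum>i<j. norm (z i - real k / real n)) \<le> (\<Sum>i<j. real j / (real n - real j))"
    by (intro sum_mono) auto
  ultimately show ?thesis unfolding e1 e2 by (simp del: prod_constant)
qed

definition unit_supported :: "real measure \<Rightarrow> bool" where
  "unit_supported M \<longleftrightarrow> finite_measure M \<and> sets M = sets borel \<and> (AE y in M. y \<in> {0..1})"

text \<open>Hausdorff's construction: the binomially weighted differences are the masses of a
  probability on the grid k / n. All of these live on [0, 1], so a subsequence converges weakly, and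
  the limit has the right moments because the grid measures have them up to an error of order 1 /
  n.\<close>

lemma hausdorff_moment_existence:
  assumes nonneg: "\<And>l k. 0 \<le> (ndiff ^^ l) m k" and m0: "m 0 = 1"
  obtains M where "prob_space M" "unit_supported M" "\<And>k. (\<integral>y. y ^ k \<partial>M) = m k"
proof -
  define b where "b n k = real (n choose k) * (ndiff ^^ (n - k)) m k" for n k
  have b0: "0 \<le> b n k" for n k using nonneg by (simp add: b_def)
  have bsum: "(\<Sum>k\<le>n. b n k) = 1" for n
    using sum_binomial_ndiff_falling[of 0 n m] m0 by (simp add: b_def)
  \<comment> \<open>Level \<open>Suc n\<close> instead of \<open>n\<close> keeps the nodes
    \<open>real k / real (Suc n)\<close> free of division by zero.\<close>
  define D where "D n = density (count_space {..Suc n}) (\<lambda>k. ennreal (b (Suc n) k))" for n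
  define \<mu> where "\<mu> n = distr (D n) borel (\<lambda>k. real k / real (Suc n))" for n
  have [measurable_cong]: "sets (D n) = sets (count_space {..Suc n})" for n by (simp add: D_def)
  have pD: "prob_space (D n)" for n
  proof
    have "emeasure (D n) (space (D n)) = (\<Sum>k\<le>Suc n. ennreal (b (Suc n) k))"
      by (simp add: D_def emeasure_density nn_integral_count_space_finite cong: nn_integral_cong)
    then show "emeasure (D n) (space (D n)) = 1"
      using b0 bsum[of "Suc n"] by (simp add: sum_ennreal del: sum.atMost_Suc)
  qed
  have rd: "real_distribution (\<mu> n)" for n
    unfolding \<mu>_def real_distribution_def real_distribution_axioms_def
    by (auto intro!: prob_space.prob_space_distr pD)
  have int: "(\<integral>y. f y \<partial>\<mu> n) = (\<Sum>k\<le>Suc n. b (Suc n) k * f (real k / real (Suc n)))"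
    if [measurable]: "f \<in> borel_measurable borel" for f :: "real \<Rightarrow> real" and n
  proof -
    have "(\<integral>y. f y \<partial>\<mu> n) = (\<integral>k. f (real k / real (Suc n)) \<partial>D n)"
      unfolding \<mu>_def by (rule integral_distr) auto
    also have "\<dots> = (\<integral>k. b (Suc n) k *\<^sub>R f (real k / real (Suc n)) \<partial>count_space {..Suc n})"
      unfolding D_def by (rule integral_density) (use b0 in auto)
    finally show ?thesis by (simp add: lebesgue_integral_count_space_finite del: sum.atMost_Suc)
  qed
  have supp: "AE y in \<mu> n. y \<in> {0..1}" for n
    unfolding \<mu>_def by (subst AE_distr_iff) (auto simp: D_def AE_density AE_count_space)
  have "tight \<mu>"
    unfolding tight_def
  proof (intro conjI allI impI rd)
    fix e :: real assume "0 < e"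
    have "measure (\<mu> n) {-1<..1} = 1" for n
    proof -
      interpret real_distribution "\<mu> n" by (rule rd)
      show ?thesis using supp[of n] by (subst prob_eq_1) (auto elim!: eventually_mono)
    qed
    then show "\<exists>a b. a < b \<and> (\<forall>n. 1 - e < measure (\<mu> n) {a<..b})"
      using \<open>0 < e\<close> by (intro exI[of _ "-1"] exI[of _ 1]) auto
  qed
  from tight_imp_convergent_subsubsequence[OF this strict_mono_id]
  obtain r M where r: "strict_mono (r :: nat \<Rightarrow> nat)" and M: "real_distribution M"
    and w: "weak_conv_m (\<mu> \<circ> r) M" by auto
  interpret M: real_distribution M by (rule M)
  have conv: "(\<lambda>n. \<integral>y. f y \<partial>\<mu> (r n)) \<longlonglongrightarrow> (\<integral>y. f y \<partial>M)"
    if "\<And>x. isCont f x" "\<And>x. norm (f x) \<le> B" for f :: "real \<Rightarrow> real" and B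
    using weak_conv_imp_integral_bdd_continuous_conv[of "\<mu> \<circ> r" M f B] rd M w that by simp
  have msupp: "AE y in M. y \<in> {0..1}"
  proof -
    \<comment> \<open>The distance to [0, 1], cut off at 1: bounded, continuous and zero exactly on
      [0, 1], so that weak convergence carries the support to the limit.\<close>
    define f :: "real \<Rightarrow> real" where "f y = min 1 (max 0 (max (-y) (y - 1)))" for y
    have f: "isCont f x" "norm (f x) \<le> 1" "0 \<le> f x" for x
    proof -
      show "isCont f x" unfolding f_def by (intro continuous_intros)
    qed (auto simp: f_def)
    have [measurable]: "f \<in> borel_measurable borel" unfolding f_def by measurable
    have "(\<integral>y. f y \<partial>\<mu> (r n)) = 0" for n
      by (rule integral_eq_zero_AE, use supp[of "r n"] in eventually_elim) (simp add: f_def)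
    with conv[OF f(1,2)] have "(\<integral>y. f y \<partial>M) = 0"
      using LIMSEQ_unique[OF _ tendsto_const[of 0]] by simp
    moreover have "integrable M f" by (rule M.integrable_const_bound[of _ 1]) (use f in auto)
    ultimately have "AE y in M. f y = 0"
      using integral_nonneg_eq_0_iff_AE[of M f] f by auto
    then show ?thesis
      by (rule eventually_mono) (auto simp: f_def min_def max_def split: if_splits)
  qed
  have "(\<integral>y. y ^ j \<partial>M) = m j" for j
  proof -
    \<comment> \<open>Clamping makes the power bounded and continuous on the whole line and leaves
      it alone on [0, 1].\<close>
    define f :: "real \<Rightarrow> real" where "f y = (max 0 (min 1 y)) ^ j" for y
    have f: "isCont f x" "norm (f x) \<le> 1" for x
    proof -
      show "isCont f x" unfolding f_def by (intro continuous_intros)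
    qed (auto simp: f_def intro!: power_le_one)
    have [measurable]: "f \<in> borel_measurable borel" unfolding f_def by measurable
    have eq: "(\<integral>y. f y \<partial>M) = (\<integral>y. y ^ j \<partial>M)"
    proof (rule integral_cong_AE)
      show "AE y in M. f y = y ^ j" using msupp by eventually_elim (simp add: f_def)
    qed auto
    \<comment> \<open>Replacing the powers at the nodes by binomial ratios gives \<open>m j\<close>
      exactly; since the weights sum to 1, the pointwise error of the ratios bounds the error of the
      integral.\<close>
    have bound: "\<bar>(\<integral>y. f y \<partial>\<mu> n) - m j\<bar> \<le> real j * (real j / (real (Suc n) - real j))" if n: "2 * j < Suc n" for n
    proof -
      have fk: "f (real k / real (Suc n)) = (real k / real (Suc n)) ^ j" if "k \<le> Suc n" for k
      proof -
        have "0 \<le> real k / real (Suc n)" "real k / real (Suc n) \<le> 1" using that by (auto simp: field_simps)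
        then show ?thesis unfolding f_def by simp
      qed
      have "(\<integral>y. f y \<partial>\<mu> n) - m j = (\<Sum>k\<le>Suc n. b (Suc n) k * ((real k / real (Suc n)) ^ j)) - m j"
        by (subst int) (auto intro!: sum.cong simp: fk simp del: sum.atMost_Suc of_nat_Suc)
      also have mj: "m j = (\<Sum>k\<le>Suc n. b (Suc n) k * (real (k choose j) / real (Suc n choose j)))"
        using sum_binomial_ndiff_falling[of j "Suc n" m] n unfolding b_def by simp
      also have "(\<Sum>k\<le>Suc n. b (Suc n) k * ((real k / real (Suc n)) ^ j)) - \<dots>
          = (\<Sum>k\<le>Suc n. b (Suc n) k * ((real k / real (Suc n)) ^ j - real (k choose j) / real (Suc n choose j)))"
        by (subst sum_subtractf[symmetric]) (simp add: algebra_simps del: sum.atMost_Suc of_nat_Suc)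
      also have "\<bar>\<dots>\<bar> \<le> (\<Sum>k\<le>Suc n. b (Suc n) k * (real j * (real j / (real (Suc n) - real j))))"
      proof (rule order.trans[OF sum_abs sum_mono])
        fix k assume "k \<in> {..Suc n}"
        then have "\<bar>(real k / real (Suc n)) ^ j - real (k choose j) / real (Suc n choose j)\<bar>
            \<le> real j * (real j / (real (Suc n) - real j))"
          using binomial_ratio_approx[of j "Suc n" k] n by (subst abs_minus_commute) simp
        then show "\<bar>b (Suc n) k * ((real k / real (Suc n)) ^ j - real (k choose j) / real (Suc n choose j))\<bar>
            \<le> b (Suc n) k * (real j * (real j / (real (Suc n) - real j)))"
          using b0[of "Suc n" k] unfolding abs_mult by (simp only: abs_of_nonneg mult_left_mono)
      qed
      also have "\<dots> = real j * (real j / (real (Suc n) - real j))"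
        by (subst sum_distrib_right[symmetric]) (simp only: bsum mult_1)
      finally show ?thesis unfolding mj .
    qed
    have "(\<lambda>n. real j * (real j / (real (Suc n) - real j))) \<longlonglongrightarrow> 0"
    proof (intro tendsto_mult_right_zero tendsto_divide_0[OF tendsto_const] filterlim_at_top_imp_at_infinity)
      show "filterlim (\<lambda>n. real (Suc n) - real j) at_top sequentially"
        using filterlim_tendsto_add_at_top[OF tendsto_const[of "- real j"]
            filterlim_compose[OF filterlim_real_sequentially filterlim_Suc]]
        by (simp add: algebra_simps)
    qed
    moreover have "\<forall>\<^sub>F n in sequentially. norm ((\<integral>y. f y \<partial>\<mu> n) - m j) \<le> real j * (real j / (real (Suc n) - real j))"
      using eventually_gt_at_top[of "2 * j"] 
    proof eventually_elim
      fix n assume "2 * j < n"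
      then have "2 * j < Suc n" by (rule less_SucI)
      from bound[OF this] show "norm ((\<integral>y. f y \<partial>\<mu> n) - m j) \<le> real j * (real j / (real (Suc n) - real j))"
        by (simp only: real_norm_def)
    qed
    ultimately have "(\<lambda>n. (\<integral>y. f y \<partial>\<mu> n) - m j) \<longlonglongrightarrow> 0"
      by (rule Lim_null_comparison[rotated])
    then have "(\<lambda>n. \<integral>y. f y \<partial>\<mu> n) \<longlonglongrightarrow> m j"
      by (rule LIM_zero_cancel)
    then have "(\<lambda>n. \<integral>y. f y \<partial>\<mu> (r n)) \<longlonglongrightarrow> m j"
      using LIMSEQ_subseq_LIMSEQ[OF _ r] by (auto simp: o_def)
    with conv[OF f] eq show ?thesis by (auto dest: LIMSEQ_unique)
  qed
  with M.prob_space_axioms msupp show thesis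
    by (intro that[of M]) (auto simp: unit_supported_def M.finite_measure_axioms)
qed

text \<open>Under the integral each \<open>ndiff\<close> contributes a factor 1 - y, because y^k -
  y^(k+1) = y^k * (1 - y). The sign in \<open>ndiff\<close> is chosen so that this factor is
  nonnegative on [0, 1].\<close>

lemma ndiff_moments:
  assumes "unit_supported M"
  shows "(ndiff ^^ l) (\<lambda>j. \<integral>y. y ^ j \<partial>M) k = (\<integral>y. y ^ k * (1 - y) ^ l \<partial>M)"
proof -
  interpret finite_measure M using assms by (simp add: unit_supported_def)
  have [measurable_cong]: "sets M = sets borel" using assms by (simp add: unit_supported_def)
  have ae: "AE y in M. 0 \<le> y \<and> y \<le> 1" using assms by (simp add: unit_supported_def)
  have int: "integrable M (\<lambda>y. y ^ k * (1 - y) ^ l)" for k l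
  proof (rule integrable_const_bound[of _ 1])
    show "AE y in M. norm (y ^ k * (1 - y) ^ l) \<le> 1"
      using ae by eventually_elim (auto simp: abs_mult power_abs intro!: mult_le_one power_le_one)
  qed measurable
  show ?thesis
  proof (induction l arbitrary: k)
    case (Suc l)
    have "(ndiff ^^ Suc l) (\<lambda>j. \<integral>y. y ^ j \<partial>M) k
        = (\<integral>y. y ^ k * (1 - y) ^ l - y ^ Suc k * (1 - y) ^ l \<partial>M)"
      unfolding ndiff_funpow_Suc Suc.IH using int by (subst Bochner_Integration.integral_diff) blast+
    also have "\<dots> = (\<integral>y. y ^ k * (1 - y) ^ Suc l \<partial>M)"
      by (rule Bochner_Integration.integral_cong) (auto simp: algebra_simps)
    finally show ?case .
  qed simp
qed

text \<open>The integral of the n-th Bernstein polynomial of \<open>f\<close>, written in terms of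
  the moments alone, so that it still makes sense when only the moments are known to depend
  measurably on a parameter.\<close>

definition bernstein_moment_sum :: "(real \<Rightarrow> real) \<Rightarrow> (nat \<Rightarrow> real) \<Rightarrow> nat \<Rightarrow> real" where
  "bernstein_moment_sum f m n = (\<Sum>k\<le>n. f (k / n) * (real (n choose k) * (ndiff ^^ (n - k)) m k))"

text \<open>Bernstein polynomials converge to \<open>f\<close> on [0, 1], and as the basis is
  nonnegative there and sums to 1, they are dominated by the maximum of |f| on [0, 1].\<close>

lemma integral_eq_lim_bernstein_moment_sum:
  assumes M: "unit_supported M" and f: "continuous_on UNIV f"
  shows "(\<lambda>n. bernstein_moment_sum f (\<lambda>j. \<integral>y. y ^ j \<partial>M) n) \<longlonglongrightarrow> (\<integral>y. f y \<partial>M)"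
proof -
  interpret finite_measure M using M by (simp add: unit_supported_def)
  have [measurable_cong]: "sets M = sets borel" using M by (simp add: unit_supported_def)
  have [measurable]: "f \<in> borel_measurable borel" using f by (rule borel_measurable_continuous_onI)
  have ae: "AE y in M. 0 \<le> y \<and> y \<le> 1" using M by (simp add: unit_supported_def)
  have int: "integrable M (\<lambda>y. y ^ k * (1 - y) ^ l)" for k l
  proof (rule integrable_const_bound[of _ 1])
    show "AE y in M. norm (y ^ k * (1 - y) ^ l) \<le> 1"
      using ae by eventually_elim (auto simp: abs_mult power_abs intro!: mult_le_one power_le_one)
  qed measurable
  have "compact (f ` {0..1})"
    by (intro compact_continuous_image continuous_on_subset[OF f]) auto
  then obtain B where B: "\<And>y. y \<in> {0..1} \<Longrightarrow> norm (f y) \<le> B"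
    by (meson bounded_iff compact_imp_bounded imageI)
  have B0: "0 \<le> B" using B[of 0] by (auto intro: order.trans[OF norm_ge_zero])
  have Bern: "(\<Sum>k\<le>n. f (k / n) * Bernstein n k y) = (\<Sum>k\<le>n. f (k / n) * (real (n choose k) * (y ^ k * (1 - y) ^ (n - k))))" for n y
    by (simp add: Bernstein_def mult_ac)
  have eq: "bernstein_moment_sum f (\<lambda>j. \<integral>y. y ^ j \<partial>M) n = (\<integral>y. (\<Sum>k\<le>n. f (k / n) * Bernstein n k y) \<partial>M)" for n
    unfolding bernstein_moment_sum_def Bern ndiff_moments[OF M]
    using int by (subst Bochner_Integration.integral_sum) auto
  show ?thesis
    unfolding eq
  proof (rule integral_dominated_convergence[where w = "\<lambda>_. B"])
    show "(\<lambda>y. \<Sum>k\<le>n. f (k / n) * Bernstein n k y) \<in> borel_measurable M" for n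
      unfolding Bernstein_def by measurable
    show "AE y in M. (\<lambda>n. \<Sum>k\<le>n. f (k / n) * Bernstein n k y) \<longlonglongrightarrow> f y" (is "AE y in _. ?P y")
      using ae
    proof eventually_elim
      fix y :: real assume y: "0 \<le> y \<and> y \<le> 1"
      show "?P y"
      proof (rule LIMSEQ_I)
        fix e :: real assume "0 < e"
        from Bernstein_Weierstrass[OF continuous_on_subset[OF f] this]
        obtain N where "\<And>n x. N \<le> n \<Longrightarrow> x \<in> {0..1} \<Longrightarrow> \<bar>f x - (\<Sum>k\<le>n. f (k / n) * Bernstein n k x)\<bar> < e"
          by auto
        then show "\<exists>N. \<forall>n\<ge>N. norm ((\<Sum>k\<le>n. f (k / n) * Bernstein n k y) - f y) < e"
          using y by (intro exI[of _ N]) (auto simp: abs_minus_commute)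
      qed
    qed
    show "AE y in M. norm (\<Sum>k\<le>n. f (k / n) * Bernstein n k y) \<le> B" (is "AE y in _. ?P y") for n
      using ae
    proof eventually_elim
      fix y :: real assume y: "0 \<le> y \<and> y \<le> 1"
      have "norm (\<Sum>k\<le>n. f (k / n) * Bernstein n k y) \<le> (\<Sum>k\<le>n. B * Bernstein n k y)"
      proof (intro sum_norm_le)
        fix k assume "k \<in> {..n}"
        then have "norm (f (k / n)) \<le> B" by (intro B) (auto simp: divide_le_eq_1)
        moreover have "0 \<le> Bernstein n k y" using y by (intro Bernstein_nonneg) auto
        ultimately show "norm (f (k / n) * Bernstein n k y) \<le> B * Bernstein n k y"
          by (simp add: abs_mult mult_right_mono)
      qed
      also have "\<dots> = B" by (simp add: sum_distrib_left[symmetric])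
      finally show "?P y" .
    qed
  qed auto
qed

text \<open>For j > 0 this is 1 up to \<open>a\<close>, 0 from a + 1 / j on and linear between: the
  continuous functions through which moments reach the distribution function.\<close>

definition ramp :: "real \<Rightarrow> nat \<Rightarrow> real \<Rightarrow> real" where
  "ramp a j y = max 0 (min 1 (1 - real j * (y - a)))"

lemma continuous_on_ramp: "continuous_on A (ramp a j)"
  unfolding ramp_def by (intro continuous_intros)

lemma measure_atMost_eq_lim_ramp:
  assumes "finite_measure M" and [measurable_cong]: "sets M = sets borel"
  shows "(\<lambda>j. \<integral>y. ramp a j y \<partial>M) \<longlonglongrightarrow> measure M {..a}"
proof -
  interpret finite_measure M by fact
  have "(\<lambda>j. \<integral>y. ramp a j y \<partial>M) \<longlonglongrightarrow> (\<integral>y. indicator {..a} y \<partial>M)"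
  proof (rule integral_dominated_convergence[where w = "\<lambda>_. 1"])
    show "(\<lambda>y. ramp a j y) \<in> borel_measurable M" for j unfolding ramp_def by measurable
    show "AE y in M. (\<lambda>j. ramp a j y) \<longlonglongrightarrow> indicator {..a} y" (is "AE y in _. ?P y")
    proof (rule AE_I2)
      fix y
      show "?P y"
      proof (cases "y \<le> a")
        case True
        then have "ramp a j y = 1" for j by (simp add: ramp_def mult_nonneg_nonpos)
        then show ?thesis using True by simp
      next
        case False
        obtain N where N: "1 < real N * (y - a)"
          using False ex_less_of_nat_mult[of "y - a" 1] by auto
        have "\<forall>\<^sub>F j in sequentially. ramp a j y = indicator {..a} y"
          using eventually_ge_at_top[of N]
        proof eventually_elim
          fix j assume "N \<le> j"
          then have "real N * (y - a) \<le> real j * (y - a)" using False by (intro mult_right_mono) auto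
          with N have "1 - real j * (y - a) \<le> 0" by simp
          then show "ramp a j y = indicator {..a} y" using False by (simp add: ramp_def)
        qed
        then show ?thesis by (rule tendsto_eventually)
      qed
    qed
  qed (auto simp: ramp_def)
  then show ?thesis using sets_eq_imp_space_eq[OF assms(2)] by simp
qed

text \<open>Moments determine the integrals of ramps through Bernstein sums, and these determine the
  distribution function.\<close>

lemma unit_supported_eqI:
  assumes M: "unit_supported M" and N: "unit_supported N"
    and eq: "\<And>k. (\<integral>y. y ^ k \<partial>M) = (\<integral>y. y ^ k \<partial>N)"
  shows "M = N"
proof (rule cdf_unique')
  show fin: "finite_borel_measure M" "finite_borel_measure N"
    using M N by (auto simp: unit_supported_def finite_borel_measure_def finite_borel_measure_axioms_def)
  have "(\<integral>y. ramp a j y \<partial>M) = (\<integral>y. ramp a j y \<partial>N)" for a j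
    using integral_eq_lim_bernstein_moment_sum[OF M continuous_on_ramp]
      integral_eq_lim_bernstein_moment_sum[OF N continuous_on_ramp] unfolding eq
    by (rule LIMSEQ_unique)
  then have "measure M {..a} = measure N {..a}" for a
    using measure_atMost_eq_lim_ramp[of M a] measure_atMost_eq_lim_ramp[of N a] M N
    by (intro LIMSEQ_unique[of "\<lambda>j. \<integral>y. ramp a j y \<partial>N"]) (auto simp: unit_supported_def)
  then show "cdf M = cdf N" by (simp add: cdf_def fun_eq_iff)
qed

text \<open>Half-lines generate the Borel sets and are stable under intersection. The mass of a
  half-line is an iterated limit of finite linear combinations of moments, and pointwise limits
  preserve measurability.\<close>

lemma unit_supported_kernel:
  assumes K: "\<And>x. x \<in> space N \<Longrightarrow> unit_supported (K x)" "\<And>x. x \<in> space N \<Longrightarrow> prob_space (K x)"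
    and m: "\<And>k. (\<lambda>x. \<integral>y. y ^ k \<partial>K x) \<in> borel_measurable N"
  shows "K \<in> N \<rightarrow>\<^sub>M prob_algebra borel"
proof (rule measurable_prob_algebra_generated)
  show "sets (borel :: real measure) = sigma_sets UNIV (range (\<lambda>a. {..a}))"
    by (simp add: borel_eq_atMost)
  show "Int_stable (range (\<lambda>a::real. {..a}))"
    by (auto simp: Int_stable_def)
  fix A assume "A \<in> range (\<lambda>a::real. {..a})"
  then obtain a where A: "A = {..a}" by auto
  have nd: "(\<lambda>x. (ndiff ^^ l) (\<lambda>j. \<integral>y. y ^ j \<partial>K x) k) \<in> borel_measurable N" for l k
    by (induction l arbitrary: k) (auto simp: ndiff_def m)
  have ramp: "(\<lambda>x. \<integral>y. ramp a j y \<partial>K x) \<in> borel_measurable N" for j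
  proof (rule borel_measurable_LIMSEQ_real)
    show "(\<lambda>n. bernstein_moment_sum (ramp a j) (\<lambda>j. \<integral>y. y ^ j \<partial>K x) n) \<longlonglongrightarrow> (\<integral>y. ramp a j y \<partial>K x)"
      if "x \<in> space N" for x
      using that K continuous_on_ramp by (intro integral_eq_lim_bernstein_moment_sum)
    show "(\<lambda>x. bernstein_moment_sum (ramp a j) (\<lambda>j. \<integral>y. y ^ j \<partial>K x) n) \<in> borel_measurable N" for n
      unfolding bernstein_moment_sum_def
      by (intro borel_measurable_sum borel_measurable_times borel_measurable_const nd)
  qed
  have "(\<lambda>x. measure (K x) A) \<in> borel_measurable N"
  proof (rule borel_measurable_LIMSEQ_real[OF _ ramp])
    show "(\<lambda>j. \<integral>y. ramp a j y \<partial>K x) \<longlonglongrightarrow> measure (K x) A" if "x \<in> space N" for x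
      using K(1)[OF that] unfolding A unit_supported_def by (intro measure_atMost_eq_lim_ramp) auto
  qed
  then have "(\<lambda>x. ennreal (measure (K x) A)) \<in> borel_measurable N" by measurable
  then show "(\<lambda>x. emeasure (K x) A) \<in> borel_measurable N"
    by (rule measurable_cong[THEN iffD1, rotated])
       (use K in \<open>auto simp: unit_supported_def finite_measure.emeasure_eq_measure\<close>)
qed (use K in \<open>auto simp: unit_supported_def\<close>)

section \<open>Completely monotone functions and Bernstein's theorem\<close>

text \<open>The iterates of \<open>deriv\<close> are functions on the whole line with unknown values
  at nonpositive points. A chain \<open>F\<close> of derivatives on the open half-line is enough
  because differentiation is local.\<close>

lemma completely_monotoneI:
  assumes F: "\<And>k u. 0 < u \<Longrightarrow> (F k has_real_derivative F (Suc k) u) (at u)"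
    and f: "\<And>u. 0 < u \<Longrightarrow> f u = F 0 u"
    and pos: "\<And>k u. 0 < u \<Longrightarrow> 0 \<le> (- 1) ^ k * F k u"
  shows "completely_monotone f"
proof -
  have der: "(deriv ^^ k) f u = F k u" if "0 < u" for k u
    using that
  proof (induction k arbitrary: u)
    case (Suc k)
    have "((deriv ^^ k) f has_real_derivative F (Suc k) u) (at u)"
      by (rule has_field_derivative_transform_within_open[OF F, where S = "{0<..}"]) (use Suc in auto)
    then show ?case by (simp add: DERIV_imp_deriv)
  qed (simp add: f)
  have "((deriv ^^ k) f has_real_derivative F (Suc k) u) (at u)" if "0 < u" for k u
    by (rule has_field_derivative_transform_within_open[OF F, where S = "{0<..}"]) (use der that in auto)
  then show ?thesis
    unfolding completely_monotone_def using der pos by (auto simp: field_differentiable_def)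
qed

lemma completely_monotone_has_derivative:
  assumes "completely_monotone f" "0 < u"
  shows "((deriv ^^ k) f has_real_derivative (deriv ^^ Suc k) f u) (at u)"
  using assms unfolding completely_monotone_def by (auto simp: field_differentiable_derivI)

lemma completely_monotone_nonneg: "completely_monotone f \<Longrightarrow> 0 < u \<Longrightarrow> 0 \<le> f u"
  unfolding completely_monotone_def by (metis funpow_0 mult_1 power_0)

lemma completely_monotone_isCont: "completely_monotone f \<Longrightarrow> 0 < u \<Longrightarrow> isCont f u"
  using completely_monotone_has_derivative[of f u 0] by (auto intro: DERIV_isCont)

lemma completely_monotone_antimono_deriv:
  assumes cm: "completely_monotone f" and "0 < x" "x \<le> y"
  shows "(- 1) ^ k * (deriv ^^ k) f y \<le> (- 1) ^ k * (deriv ^^ k) f x"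
proof (rule DERIV_nonpos_imp_nonincreasing[OF \<open>x \<le> y\<close>])
  fix u assume "x \<le> u" "u \<le> y"
  then have u: "0 < u" using assms by simp
  have "((\<lambda>u. (- 1) ^ k * (deriv ^^ k) f u) has_real_derivative (- 1) ^ k * (deriv ^^ Suc k) f u) (at u)"
    by (intro DERIV_cmult completely_monotone_has_derivative cm u)
  moreover have "0 \<le> (- 1) ^ Suc k * (deriv ^^ Suc k) f u"
    using cm u unfolding completely_monotone_def by blast
  ultimately show "\<exists>d. ((\<lambda>u. (- 1) ^ k * (deriv ^^ k) f u) has_real_derivative d) (at u) \<and> d \<le> 0"
    by (intro exI[of _ "(- 1) ^ k * (deriv ^^ Suc k) f u"]) simp
qed

lemma completely_monotone_antimono:
  "completely_monotone f \<Longrightarrow> 0 < x \<Longrightarrow> x \<le> y \<Longrightarrow> f y \<le> f x"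
  using completely_monotone_antimono_deriv[of f x y 0] by simp

text \<open>Each derivative with its alternating sign is nonincreasing, so subtracting its value at
  a later point leaves something nonnegative.\<close>

lemma completely_monotone_shift_diff:
  assumes cm: "completely_monotone f" and h: "0 < h"
  shows "completely_monotone (\<lambda>x. f x - f (x + h))"
proof (rule completely_monotoneI)
  let ?F = "\<lambda>k x. (deriv ^^ k) f x - (deriv ^^ k) f (x + h)"
  fix k and u :: real assume u: "0 < u"
  have "((\<lambda>x. (deriv ^^ k) f (x + h)) has_real_derivative (deriv ^^ Suc k) f (u + h)) (at u)"
    using completely_monotone_has_derivative[OF cm, of "u + h" k] u h
    by (subst DERIV_shift[symmetric]) simp
  then show "(?F k has_real_derivative ?F (Suc k) u) (at u)"
    using completely_monotone_has_derivative[OF cm u] by (rule DERIV_diff[rotated])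
  show "0 \<le> (- 1) ^ k * ?F k u"
    using completely_monotone_antimono_deriv[OF cm u, of "u + h" k] h by (simp add: algebra_simps)
qed simp

text \<open>One difference of the samples of \<open>f\<close> samples the function f x - f (x + h),
  which is completely monotone again; hence the induction with \<open>f\<close> generalized.\<close>

lemma completely_monotone_ndiff_nonneg:
  assumes "completely_monotone f" and x: "0 < x" and h: "0 < h"
  shows "0 \<le> (ndiff ^^ l) (\<lambda>k. f (x + real k * h)) k"
  using assms(1)
proof (induction l arbitrary: f)
  case 0
  have "0 < x + real k * h" using x h by (intro add_pos_nonneg) auto
  then show ?case using 0 by (simp add: completely_monotone_nonneg)
next
  case (Suc l)
  have "(ndiff ^^ Suc l) (\<lambda>k. f (x + real k * h)) k
      = (ndiff ^^ l) (ndiff (\<lambda>k. f (x + real k * h))) k"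
    by (simp add: funpow_Suc_right del: funpow.simps)
  also have "ndiff (\<lambda>k. f (x + real k * h)) = (\<lambda>k. (\<lambda>x. f x - f (x + h)) (x + real k * h))"
    by (simp add: ndiff_def fun_eq_iff algebra_simps)
  also have "0 \<le> (ndiff ^^ l) \<dots> k"
    by (rule Suc.IH[OF completely_monotone_shift_diff[OF Suc.prems h]])
  finally show ?case .
qed

lemma ndiff_cmult: "(ndiff ^^ l) (\<lambda>k. c * m k) k = c * (ndiff ^^ l) m k"
  by (induction l arbitrary: k) (simp_all add: ndiff_def algebra_simps)

lemma completely_monotone_moment_measure:
  assumes cm: "completely_monotone f" and x: "0 < x" and fx: "0 < f x" and h: "0 < h"
  obtains M where "prob_space M" "unit_supported M" "\<And>k. (\<integral>y. y ^ k \<partial>M) = f (x + real k * h) / f x"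
proof (rule hausdorff_moment_existence[of "\<lambda>k. f (x + real k * h) / f x"])
  show "0 \<le> (ndiff ^^ l) (\<lambda>k. f (x + real k * h) / f x) k" for l k
    using completely_monotone_ndiff_nonneg[OF cm x h, of l k] fx
      ndiff_cmult[of l "1 / f x" "\<lambda>k. f (x + real k * h)" k] by simp
qed (use fx that in auto)

lemma unit_supported_distr_power:
  assumes M: "unit_supported M"
  shows "unit_supported (distr M borel (\<lambda>y. y ^ N))"
proof -
  interpret finite_measure M using M by (simp add: unit_supported_def)
  have [measurable_cong]: "sets M = sets borel" using M by (simp add: unit_supported_def)
  have "AE y in M. y ^ N \<in> {0..1}"
    using M unfolding unit_supported_def by (elim conjE eventually_mono) (auto intro!: power_le_one)
  then show ?thesis
    unfolding unit_supported_def by (subst AE_distr_iff) (auto intro!: finite_measure_distr)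
qed

text \<open>The measure at step 1 represents \<open>f\<close> also between the integers: at step \<open>1/N\<close> there is
  another one, and its image under \<open>y \<mapsto> y\<^sup>N\<close> has the same moments, hence is the same measure.\<close>

lemma completely_monotone_powr_integral:
  assumes cm: "completely_monotone f" and x: "0 < x" and fx: "0 < f x"
    and M: "unit_supported M" and mom: "\<And>k. (\<integral>y. y ^ k \<partial>M) = f (x + real k) / f x" and v: "0 < v"
  shows "(\<integral>y. y powr v \<partial>M) = f (x + v) / f x"
proof -
  interpret finite_measure M using M by (simp add: unit_supported_def)
  have [measurable_cong]: "sets M = sets borel" using M by (simp add: unit_supported_def)
  have ae: "AE y in M. 0 \<le> y \<and> y \<le> 1" using M by (simp add: unit_supported_def)
  have frac: "(\<integral>y. y powr (real k / real N) \<partial>M) = f (x + real k / real N) / f x"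
    if N: "0 < N" and k: "0 < k" for N k
  proof -
    obtain M' where M': "unit_supported M'" and mom': "\<And>k. (\<integral>y. y ^ k \<partial>M') = f (x + real k * (1 / N)) / f x"
      using completely_monotone_moment_measure[OF cm x fx, of "1 / N"] N by auto
    have [measurable_cong]: "sets M' = sets borel" using M' by (simp add: unit_supported_def)
    have eq: "distr M' borel (\<lambda>y. y ^ N) = M"
    proof (rule unit_supported_eqI[OF unit_supported_distr_power[OF M'] M])
      fix j
      have "(\<integral>y. y ^ j \<partial>distr M' borel (\<lambda>y. y ^ N)) = (\<integral>y. y ^ (N * j) \<partial>M')"
        by (subst integral_distr) (auto simp: power_mult)
      then show "(\<integral>y. y ^ j \<partial>distr M' borel (\<lambda>y. y ^ N)) = (\<integral>y. y ^ j \<partial>M)"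
        using N by (simp add: mom mom')
    qed
    have "(\<integral>y. y powr (real k / real N) \<partial>M) = (\<integral>y. (y ^ N) powr (real k / real N) \<partial>M')"
      by (subst eq[symmetric], subst integral_distr) auto
    also have "\<dots> = (\<integral>y. y ^ k \<partial>M')"
    proof (rule integral_cong_AE)
      have "AE y in M'. 0 \<le> y" using M' by (simp add: unit_supported_def)
      then show "AE y in M'. (y ^ N) powr (real k / real N) = y ^ k"
      proof eventually_elim
        fix y :: real assume "0 \<le> y"
        \<comment> \<open>At y = 0 the equation needs k > 0: \<open>0 powr a\<close> is 0 for every
          a, even for a = 0.\<close>
        then show "(y ^ N) powr (real k / real N) = y ^ k"
          using N k by (cases "y = 0") (auto simp: powr_realpow[symmetric] powr_powr zero_power)
      qed
    qed auto
    finally show ?thesis by (simp add: mom')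
  qed
  \<comment> \<open>Rounding up gives rational exponents \<open>a N\<close> that are at least v,
    hence positive as \<open>frac\<close> demands, and that converge to v.\<close>
  define k where "k N = nat \<lceil>v * real (Suc N)\<rceil>" for N
  define a where "a N = real (k N) / real (Suc N)" for N
  have k0: "0 < k N" for N using v by (simp add: k_def del: of_nat_Suc)
  have kr: "v * real (Suc N) \<le> real (k N)" "real (k N) \<le> v * real (Suc N) + 1" for N
  proof -
    have "0 \<le> v * real (Suc N)" using v by simp
    then have "real (k N) = of_int \<lceil>v * real (Suc N)\<rceil>"
      unfolding k_def by (intro of_nat_nat) (simp del: of_nat_Suc)
    then show "v * real (Suc N) \<le> real (k N)" "real (k N) \<le> v * real (Suc N) + 1"
      by linarith+
  qed
  have a_bounds: "v \<le> a N" "a N \<le> v + inverse (real (Suc N))" for N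
  proof -
    show "v \<le> a N" using kr(1)[of N] by (simp add: a_def pos_le_divide_eq del: of_nat_Suc)
    have "a N \<le> (v * real (Suc N) + 1) / real (Suc N)"
      unfolding a_def using kr(2)[of N] by (intro divide_right_mono) auto
    also have "\<dots> = v + inverse (real (Suc N))"
      by (simp add: add_divide_distrib inverse_eq_divide del: of_nat_Suc)
    finally show "a N \<le> v + inverse (real (Suc N))" .
  qed
  have a: "a \<longlonglongrightarrow> v"
  proof (rule real_tendsto_sandwich)
    show "\<forall>\<^sub>F N in sequentially. v \<le> a N" by (intro always_eventually allI a_bounds)
    show "\<forall>\<^sub>F N in sequentially. a N \<le> v + inverse (real (Suc N))" by (intro always_eventually allI a_bounds)
  qed (rule tendsto_const LIMSEQ_inverse_real_of_nat_add)+
  have "(\<lambda>N. \<integral>y. y powr a N \<partial>M) \<longlonglongrightarrow> (\<integral>y. y powr v \<partial>M)"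
  proof (rule integral_dominated_convergence[where w = "\<lambda>_. 1"])
    show "AE y in M. (\<lambda>N. y powr a N) \<longlonglongrightarrow> y powr v" (is "AE y in _. ?P y")
    proof (rule AE_I2)
      fix y show "?P y"
        using a by (cases "y = 0") (auto intro!: tendsto_powr)
    qed
    show "AE y in M. norm (y powr a N) \<le> 1" for N
      using ae by eventually_elim (use a_bounds(1)[of N] v in \<open>auto intro!: powr_le1\<close>)
  qed auto
  moreover have "(\<lambda>N. f (x + a N) / f x) \<longlonglongrightarrow> f (x + v) / f x"
  proof (intro tendsto_divide tendsto_const)
    show "(\<lambda>N. f (x + a N)) \<longlonglongrightarrow> f (x + v)"
      using a x v by (intro isCont_tendsto_compose[OF completely_monotone_isCont[OF cm]] tendsto_intros) auto
  qed (use fx in auto)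
  moreover have "(\<integral>y. y powr a N \<partial>M) = f (x + a N) / f x" for N
    unfolding a_def using k0 by (intro frac) auto
  ultimately show ?thesis by (auto dest: LIMSEQ_unique)
qed

text \<open>As \<open>0 powr a\<close> is 0, the integrals of y powr (1 / n) tend to the mass of the
  open half-line y > 0. They are also f (x + 1 / n) / f x, which tends to 1 since f is continuous at
  x. No mass is left for y = 0.\<close>

lemma completely_monotone_measure_pos:
  assumes cm: "completely_monotone f" and x: "0 < x" and fx: "0 < f x"
    and M: "unit_supported M" and mom: "\<And>k. (\<integral>y. y ^ k \<partial>M) = f (x + real k) / f x"
  shows "AE y in M. 0 < y"
proof -
  interpret finite_measure M using M by (simp add: unit_supported_def)
  have [measurable_cong]: "sets M = sets borel" using M by (simp add: unit_supported_def)
  have ae: "AE y in M. 0 \<le> y \<and> y \<le> 1" using M by (simp add: unit_supported_def)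
  have "(\<lambda>n. \<integral>y. y powr (1 / real (Suc n)) \<partial>M) \<longlonglongrightarrow> (\<integral>y. indicator {0<..} y \<partial>M)"
  proof (rule integral_dominated_convergence[where w = "\<lambda>_. 1"])
    show "AE y in M. (\<lambda>n. y powr (1 / real (Suc n))) \<longlonglongrightarrow> indicator {0<..} y" (is "AE y in _. ?P y")
      using ae
    proof eventually_elim
      fix y :: real assume "0 \<le> y \<and> y \<le> 1"
      moreover have "(\<lambda>n. y powr (1 / real (Suc n))) \<longlonglongrightarrow> y powr 0" if "0 < y"
        using that LIMSEQ_inverse_real_of_nat by (intro tendsto_powr tendsto_const) (auto simp: inverse_eq_divide)
      ultimately show "?P y"
        by (cases "y = 0") auto
    qed
    show "AE y in M. norm (y powr (1 / real (Suc n))) \<le> 1" for n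
      using ae by eventually_elim (auto intro!: powr_le1)
  qed auto
  moreover have "(\<lambda>n. f (x + 1 / real (Suc n)) / f x) \<longlonglongrightarrow> f x / f x"
  proof (intro tendsto_divide tendsto_const)
    have "(\<lambda>n. x + 1 / real (Suc n)) \<longlonglongrightarrow> x + 0"
      using LIMSEQ_inverse_real_of_nat by (intro tendsto_intros) (auto simp: inverse_eq_divide)
    then show "(\<lambda>n. f (x + 1 / real (Suc n))) \<longlonglongrightarrow> f x"
      using x by (intro isCont_tendsto_compose[OF completely_monotone_isCont[OF cm]]) auto
  qed (use fx in auto)
  moreover have "(\<integral>y. y powr (1 / real (Suc n)) \<partial>M) = f (x + 1 / real (Suc n)) / f x" for n
    by (rule completely_monotone_powr_integral[OF cm x fx M mom]) simp
  ultimately have "measure M {0<..} = 1"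
    using fx LIMSEQ_unique sets_eq_imp_space_eq[of M borel] by (fastforce simp: unit_supported_def)
  moreover have "measure M (space M) = 1" using mom[of 0] fx by simp
  ultimately have "prob_space M" "measure M {0<..} = 1"
    by (auto intro!: prob_spaceI simp: emeasure_eq_measure)
  then show ?thesis
    using prob_space.prob_eq_1[of M "{0<..}"] by (auto elim!: eventually_mono)
qed

text \<open>Bernstein's theorem in the variable y = exp (- t), normalized at u = 1. For u < 1 the
  exponent is negative and the moments of \<open>M\<close> say nothing directly, so the formula is
  proved for a base point below u and transported to the base point 1.\<close>

theorem bernstein_representation:
  assumes cm: "completely_monotone f" and f1: "0 < f 1"
    and M: "unit_supported M" and mom: "\<And>k. (\<integral>y. y ^ k \<partial>M) = f (1 + real k) / f 1" and u: "0 < u"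
  shows "(\<integral>\<^sup>+y. ennreal (f 1 * y powr (u - 1)) \<partial>M) = ennreal (f u)"
proof -
  interpret finite_measure M using M by (simp add: unit_supported_def)
  have [measurable_cong]: "sets M = sets borel" using M by (simp add: unit_supported_def)
  have ae: "AE y in M. 0 \<le> y \<and> y \<le> 1" using M by (simp add: unit_supported_def)
  have pos: "AE y in M. 0 < y" using completely_monotone_measure_pos[OF cm _ f1 M mom] by simp
  \<comment> \<open>A base point below both 1 and u: all exponents counted from x are then
    nonnegative.\<close>
  define x where "x = min 1 u"
  have x: "0 < x" "x \<le> 1" "x \<le> u" using u by (auto simp: x_def)
  have fx: "0 < f x" using completely_monotone_antimono[OF cm, of x 1] x f1 by simp
  obtain M' where M': "prob_space M'" "unit_supported M'"
    and mom': "\<And>k. (\<integral>y. y ^ k \<partial>M') = f (x + real k) / f x"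
    using completely_monotone_moment_measure[OF cm x(1) fx, of 1] by auto
  interpret M': prob_space M' by (rule M')
  have [measurable_cong]: "sets M' = sets borel" using M' by (simp add: unit_supported_def)
  have ae': "AE y in M'. 0 \<le> y \<and> y \<le> 1" using M' by (simp add: unit_supported_def)
  have pos': "AE y in M'. 0 < y" by (rule completely_monotone_measure_pos[OF cm x(1) fx M'(2) mom'])
  have powr': "(\<integral>\<^sup>+y. ennreal (y powr v) \<partial>M') = ennreal (f (x + v) / f x)" if "0 \<le> v" for v
  \<comment> \<open>The exponent 0 is treated apart, since
    \<open>completely_monotone_powr_integral\<close> needs v > 0; here y powr 0 = 1 because y > 0
    almost everywhere.\<close>
  proof (cases "v = 0")
    case True
    have "(\<integral>\<^sup>+y. ennreal (y powr v) \<partial>M') = (\<integral>\<^sup>+y. 1 \<partial>M')"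
      by (rule nn_integral_cong_AE) (use pos' True in auto)
    then show ?thesis using True fx by (simp add: M'.emeasure_space_1)
  next
    case False
    have "integrable M' (\<lambda>y. y powr v)"
      by (rule M'.integrable_const_bound[of _ 1]) (use ae' in eventually_elim, use that in \<open>auto intro!: powr_le1\<close>)
    then have "(\<integral>\<^sup>+y. ennreal (y powr v) \<partial>M') = ennreal (\<integral>y. y powr v \<partial>M')"
      by (rule nn_integral_eq_integral) auto
    then show ?thesis
      using completely_monotone_powr_integral[OF cm x(1) fx M'(2) mom'] False that by simp
  qed
  \<comment> \<open>Change of base point: in the Laplace picture the measures for x and 1 are exp (-
    x t) and exp (- t) times a common measure, up to the factors f x and f 1. The reweighted
    \<open>M'\<close> has the moments of \<open>M\<close> and therefore equals it.\<close>
  define w where "w y = f x / f 1 * y powr (1 - x)" for y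
  have w0: "0 \<le> w y" for y using fx f1 by (simp add: w_def)
  have [measurable]: "w \<in> borel_measurable borel" unfolding w_def by measurable
  define D where "D = density M' (\<lambda>y. ennreal (w y))"
  have nnD: "(\<integral>\<^sup>+y. ennreal (y powr v) \<partial>D) = ennreal (f (1 + v) / f 1)" if "0 \<le> 1 - x + v" for v
  proof -
    have "(\<integral>\<^sup>+y. ennreal (y powr v) \<partial>D) = (\<integral>\<^sup>+y. ennreal (f x / f 1) * ennreal (y powr (1 - x + v)) \<partial>M')"
      unfolding D_def w_def using fx f1
      by (subst nn_integral_density) (auto simp: ennreal_mult'[symmetric] powr_add mult_ac intro!: nn_integral_cong)
    also have "\<dots> = ennreal (f (1 + v) / f 1)"
      using fx f1 that by (subst nn_integral_cmult) (auto simp: powr' ennreal_mult'[symmetric])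
    finally show ?thesis .
  qed
  have posD: "AE y in D. 0 < y" unfolding D_def using pos' by (subst AE_density) auto
  have DM: "D = M"
  proof (rule unit_supported_eqI[OF _ M])
    have "emeasure D (space D) = (\<integral>\<^sup>+y. ennreal (y powr 0) \<partial>D)"
      by (subst nn_integral_cong_AE[of _ "\<lambda>_. 1"]) (use posD in auto)
    also have "\<dots> < \<infinity>" by (subst nnD) (use x in auto)
    finally have "finite_measure D" by (intro finite_measureI) auto
    moreover have "AE y in D. y \<in> {0..1}" unfolding D_def using ae' by (subst AE_density) auto
    moreover have "sets D = sets borel" using M'(2) by (simp add: D_def unit_supported_def)
    ultimately show D: "unit_supported D" unfolding unit_supported_def by blast
    fix k
    have "(\<integral>y. y ^ k \<partial>D) = enn2real (\<integral>\<^sup>+y. ennreal (y ^ k) \<partial>D)"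
      by (rule integral_eq_nn_integral) (use posD in \<open>auto simp: D_def\<close>)
    also have "(\<integral>\<^sup>+y. ennreal (y ^ k) \<partial>D) = (\<integral>\<^sup>+y. ennreal (y powr real k) \<partial>D)"
      by (rule nn_integral_cong_AE) (use posD in \<open>auto simp: powr_realpow\<close>)
    also have "\<dots> = ennreal (f (1 + real k) / f 1)" by (rule nnD) (use x in auto)
    finally show "(\<integral>y. y ^ k \<partial>D) = (\<integral>y. y ^ k \<partial>M)"
      using mom f1 completely_monotone_nonneg[OF cm, of "1 + real k"] by (simp add: enn2real_ennreal)
  qed
  have "(\<integral>\<^sup>+y. ennreal (f 1 * y powr (u - 1)) \<partial>M) = ennreal (f 1) * (\<integral>\<^sup>+y. ennreal (y powr (u - 1)) \<partial>M)"
    using f1 by (subst nn_integral_cmult[symmetric]) (auto simp: ennreal_mult'[symmetric])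
  also have "\<dots> = ennreal (f u)"
    using nnD[of "u - 1"] x f1 unfolding DM by (simp add: ennreal_mult'[symmetric])
  finally show ?thesis .
qed

text \<open>The case in which normalization at 1 is impossible. If f u were positive for some u < 1,
  the measure with base point u would integrate y powr (1 - u) to f 1 / f u = 0, although it is
  concentrated on y > 0.\<close>

lemma completely_monotone_zero:
  assumes cm: "completely_monotone f" and f1: "f 1 = 0" and u: "0 < u"
  shows "f u = 0"
proof (rule ccontr)
  assume "f u \<noteq> 0"
  then have fu: "0 < f u" using completely_monotone_nonneg[OF cm u] by simp
  then have u1: "u < 1" using completely_monotone_antimono[OF cm, of 1 u] f1 by (cases "u < 1") auto
  obtain M where M: "prob_space M" "unit_supported M"
    and mom: "\<And>k. (\<integral>y. y ^ k \<partial>M) = f (u + real k) / f u"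
    using completely_monotone_moment_measure[OF cm u fu, of 1] by auto
  interpret prob_space M by (rule M)
  have [measurable_cong]: "sets M = sets borel" using M by (simp add: unit_supported_def)
  have ae: "AE y in M. 0 \<le> y \<and> y \<le> 1" using M by (simp add: unit_supported_def)
  have pos: "AE y in M. 0 < y" by (rule completely_monotone_measure_pos[OF cm u fu M(2) mom])
  have "(\<integral>y. y powr (1 - u) \<partial>M) = 0"
    using completely_monotone_powr_integral[OF cm u fu M(2) mom, of "1 - u"] u1 f1 by simp
  moreover have "integrable M (\<lambda>y. y powr (1 - u))"
    by (rule integrable_const_bound[of _ 1]) (use ae in eventually_elim, use u1 in \<open>auto intro!: powr_le1\<close>)
  ultimately have "AE y in M. y powr (1 - u) = 0"
    by (subst (asm) integral_nonneg_eq_0_iff_AE) auto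
  with pos have "AE y in M. False" by eventually_elim auto
  then show False by simp
qed

lemma bernstein_kernel:
  fixes g :: "'a \<Rightarrow> real \<Rightarrow> real"
  assumes meas: "(\<lambda>(\<xi>, u). g \<xi> u) \<in> borel_measurable (N \<Otimes>\<^sub>M restrict_space borel {0<..})"
    and cm: "\<And>\<xi>. \<xi> \<in> space N \<Longrightarrow> completely_monotone (g \<xi>)"
  obtains K where "K \<in> N \<rightarrow>\<^sub>M prob_algebra borel"
    and "\<And>\<xi>. \<xi> \<in> space N \<Longrightarrow> AE y in K \<xi>. 0 < y \<and> y \<le> 1"
    and "\<And>\<xi> u. \<xi> \<in> space N \<Longrightarrow> 0 < u \<Longrightarrow> (\<integral>\<^sup>+y. ennreal (g \<xi> 1 * y powr (u - 1)) \<partial>K \<xi>) = ennreal (g \<xi> u)"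
proof -
  \<comment> \<open>If g vanishes at 1, and hence everywhere, the moments of the point mass at 1
    serve as default: it lies in (0, 1], and the factor \<open>g \<xi> 1\<close> removes it from the
    representation.\<close>
  define m where "m \<xi> k = (if g \<xi> 1 = 0 then 1 else g \<xi> (1 + real k) / g \<xi> 1)" for \<xi> and k :: nat
  have "\<exists>M. prob_space M \<and> unit_supported M \<and> (\<forall>k. (\<integral>y. y ^ k \<partial>M) = m \<xi> k)" if "\<xi> \<in> space N" for \<xi>
  proof (cases "g \<xi> 1 = 0")
    case True
    interpret prob_space "return borel (1::real)" by (rule prob_space_return) simp
    have "unit_supported (return borel 1)"
      by (simp add: unit_supported_def finite_measure_axioms AE_return)
    moreover have "(\<integral>y. y ^ k \<partial>return borel (1::real)) = 1" for k by (subst integral_return) auto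
    ultimately show ?thesis using True prob_space_axioms by (auto simp: m_def)
  next
    case False
    then have "0 < g \<xi> 1" using completely_monotone_nonneg[OF cm[OF that], of 1] by simp
    from completely_monotone_moment_measure[OF cm[OF that] _ this, of 1]
    obtain M where "prob_space M" "unit_supported M" "\<And>k. (\<integral>y. y ^ k \<partial>M) = g \<xi> (1 + real k) / g \<xi> 1"
      by auto
    then show ?thesis using False by (auto simp: m_def)
  qed
  then obtain K where K: "\<And>\<xi>. \<xi> \<in> space N \<Longrightarrow> prob_space (K \<xi>)" "\<And>\<xi>. \<xi> \<in> space N \<Longrightarrow> unit_supported (K \<xi>)"
    and mom: "\<And>\<xi> k. \<xi> \<in> space N \<Longrightarrow> (\<integral>y. y ^ k \<partial>K \<xi>) = m \<xi> k"
    by metis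
  have gm: "(\<lambda>\<xi>. g \<xi> u) \<in> borel_measurable N" if "0 < u" for u
    using measurable_compose[OF measurable_Pair2' meas, of u] that by (simp add: space_restrict_space)
  show thesis
  proof (rule that)
    have "(\<lambda>\<xi>. m \<xi> k) \<in> borel_measurable N" for k
      unfolding m_def using gm[of 1] gm[of "1 + real k"] by measurable
    then show "K \<in> N \<rightarrow>\<^sub>M prob_algebra borel"
      using K by (intro unit_supported_kernel) (auto simp: mom cong: measurable_cong)
    fix \<xi> assume \<xi>: "\<xi> \<in> space N"
    have ae: "AE y in K \<xi>. 0 \<le> y \<and> y \<le> 1" using K(2)[OF \<xi>] by (simp add: unit_supported_def)
    have *: "(AE y in K \<xi>. 0 < y \<and> y \<le> 1) \<and>
      (\<forall>u>0. (\<integral>\<^sup>+y. ennreal (g \<xi> 1 * y powr (u - 1)) \<partial>K \<xi>) = ennreal (g \<xi> u))"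
    proof (cases "g \<xi> 1 = 0")
      case True
      have "K \<xi> = return borel 1"
      proof (rule unit_supported_eqI[OF K(2)[OF \<xi>]])
        interpret prob_space "return borel (1::real)" by (rule prob_space_return) simp
        show "unit_supported (return borel 1)"
          by (simp add: unit_supported_def finite_measure_axioms AE_return)
        show "(\<integral>y. y ^ k \<partial>K \<xi>) = (\<integral>y. y ^ k \<partial>return borel 1)" for k
          using True \<xi> by (subst integral_return) (auto simp: mom m_def)
      qed
      moreover have "AE y in return borel (1::real). 0 < y \<and> y \<le> 1" by (subst AE_return) auto
      ultimately have "AE y in K \<xi>. 0 < y \<and> y \<le> 1" by (simp only:)
      then show ?thesis
        using True completely_monotone_zero[OF cm[OF \<xi>] True] by auto
    next
      case False
      then have g1: "0 < g \<xi> 1" using completely_monotone_nonneg[OF cm[OF \<xi>], of 1] by simp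
      have mom': "(\<integral>y. y ^ k \<partial>K \<xi>) = g \<xi> (1 + real k) / g \<xi> 1" for k
        using mom[OF \<xi>] False by (simp add: m_def)
      have "AE y in K \<xi>. 0 < y"
        by (rule completely_monotone_measure_pos[OF cm[OF \<xi>] _ g1 K(2)[OF \<xi>] mom']) simp
      with ae have "AE y in K \<xi>. 0 < y \<and> y \<le> 1" by eventually_elim auto
      then show ?thesis
        using bernstein_representation[OF cm[OF \<xi>] g1 K(2)[OF \<xi>] mom'] by blast
    qed
    then show "AE y in K \<xi>. 0 < y \<and> y \<le> 1" by simp
    show "(\<integral>\<^sup>+y. ennreal (g \<xi> 1 * y powr (u - 1)) \<partial>K \<xi>) = ennreal (g \<xi> u)" if "0 < u" for u
      using * that by blast
  qed
qed

section \<open>Characteristic functions on Euclidean space\<close>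

text \<open>The common total mass is the value at t = 0; after dividing by it, Levy's uniqueness
  theorem for probabilities applies.\<close>

lemma finite_measure_char_eqI:
  assumes M1: "finite_measure M1" "sets M1 = sets borel" and M2: "finite_measure M2" "sets M2 = sets borel"
    and eq: "\<And>t. (CLINT x|M1. iexp (t * x)) = (CLINT x|M2. iexp (t * x))"
  shows "M1 = M2"
proof -
  interpret M1: finite_measure M1 by (rule M1)
  interpret M2: finite_measure M2 by (rule M2)
  have [measurable_cong]: "sets M1 = sets borel" "sets M2 = sets borel" by fact+
  define m where "m = measure M1 (space M1)"
  have m2: "m = measure M2 (space M2)" using eq[of 0] by (simp add: m_def)
  have m0: "0 \<le> m" by (simp add: m_def)
  show ?thesis
  proof (cases "m = 0")
    case True
    then have "emeasure M1 (space M1) = 0" "emeasure M2 (space M2) = 0"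
      using m2 by (auto simp: m_def M1.emeasure_eq_measure M2.emeasure_eq_measure)
    then have "emeasure M1 A = 0" "emeasure M2 A = 0" for A
      by (metis emeasure_space le_zero_eq)+
    then show ?thesis by (intro measure_eqI) (simp_all add: M1 M2)
  next
    case False
    then have mpos: "0 < m" using m0 by simp
    define N where "N M = density M (\<lambda>_. ennreal (1 / m))" for M :: "real measure"
    have rd: "real_distribution (N M)" if "finite_measure M" "sets M = sets borel" "measure M (space M) = m" for M
    proof -
      have "emeasure (N M) (space (N M)) = ennreal (1 / m) * emeasure M (space M)"
        by (simp add: N_def emeasure_density nn_integral_cmult_indicator)
      also have "\<dots> = 1"
        using that mpos by (simp add: finite_measure.emeasure_eq_measure ennreal_mult'[symmetric])
      finally have "prob_space (N M)" by (rule prob_spaceI)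
      then show ?thesis
        using that by (simp add: real_distribution_def real_distribution_axioms_def N_def)
    qed
    have char_N: "char (N M) t = complex_of_real (1 / m) * (CLINT x|M. iexp (t * x))"
      if [measurable_cong]: "sets M = sets borel" for M t
      unfolding char_def N_def using mpos
      by (subst integral_density) (auto simp: scaleR_conv_of_real)
    have NN: "N M1 = N M2"
    proof (intro Levy_uniqueness rd)
      show "char (N M1) = char (N M2)" by (rule ext) (simp only: char_N[OF M1(2)] char_N[OF M2(2)] eq)
    qed (use M1 M2 m_def m2 in auto)
    have undo: "density (N M) (\<lambda>_. ennreal m) = M" if "sets M = sets borel" for M
      unfolding N_def using mpos
      by (subst density_density_eq) (auto simp: ennreal_mult'[symmetric] density_1)
    show ?thesis using undo[of M1] undo[of M2] NN M1 M2 by metis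
  qed
qed

definition rect_indicator :: "'n set \<Rightarrow> ('n \<Rightarrow> real set) \<Rightarrow> real ^ 'n \<Rightarrow> real" where
  "rect_indicator J A x = (\<Prod>i\<in>J. indicator (A i) (x $ i))"

lemma rect_indicator_bounds: "0 \<le> rect_indicator J A x" "rect_indicator J A x \<le> 1"
  unfolding rect_indicator_def by (auto intro!: prod_nonneg prod_le_1 split: split_indicator)

lemma measurable_rect_indicator[measurable]:
  fixes A :: "'n::finite \<Rightarrow> real set"
  assumes [measurable]: "\<And>i. A i \<in> sets borel"
  shows "rect_indicator J A \<in> borel_measurable borel"
  unfolding rect_indicator_def by measurable

text \<open>A nonnegative cosine weight times an exponential is a combination of three exponentials.
  Thus the transform of a measure weighted in this way is known as soon as the transform of the
  measure is.\<close>

lemma cexp_decompose: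
  "complex_of_real (1 + cos (a + \<theta>)) * iexp b
   = iexp b + (iexp \<theta> / 2) * iexp (a + b) + (iexp (- \<theta>) / 2) * iexp (b - a)"
proof -
  have "complex_of_real (cos (a + \<theta>)) = (exp (\<i> * of_real (a + \<theta>)) + exp (- (\<i> * of_real (a + \<theta>)))) / 2"
    unfolding cos_of_real[symmetric] cos_exp_eq ..
  then show ?thesis
    by (simp add: algebra_simps exp_add[symmetric] exp_diff exp_minus add_divide_distrib)
qed

text \<open>In each coordinate in turn, exponentials are exchanged for indicators by the one-dimensional
  uniqueness theorem. It is applied to the nonnegative weights \<open>1 + cos\<close>, from which the complex
  exponentials are recovered linearly.\<close>

lemma vec_char_rect_eq:
  fixes \<eta>1 \<eta>2 :: "(real ^ 'n) measure"
  assumes M1: "finite_measure \<eta>1" "sets \<eta>1 = sets borel" and M2: "finite_measure \<eta>2" "sets \<eta>2 = sets borel"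
    and eq: "\<And>z. (CLINT x|\<eta>1. iexp (z \<bullet> x)) = (CLINT x|\<eta>2. iexp (z \<bullet> x))"
    and J: "finite J"
    and A: "\<And>i. A i \<in> sets borel" and z: "\<And>i. i \<in> J \<Longrightarrow> z $ i = 0"
  shows "(CLINT x|\<eta>1. rect_indicator J A x * iexp (z \<bullet> x)) = (CLINT x|\<eta>2. rect_indicator J A x * iexp (z \<bullet> x))"
  using J z
proof (induction J arbitrary: z rule: finite_induct)
  case empty
  then show ?case using eq by (simp add: rect_indicator_def)
next
  case (insert j J)
  note [measurable] = A
  have [measurable_cong]: "sets \<eta>1 = sets borel" "sets \<eta>2 = sets borel" by fact+
  have int: "integrable \<eta> (\<lambda>x. complex_of_real (rect_indicator J A x) * iexp (z \<bullet> x))"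
    if "finite_measure \<eta>" and [measurable_cong]: "sets \<eta> = sets borel" for \<eta> :: "(real ^ 'n) measure" and J z
    using that(1) rect_indicator_bounds[of J A]
    by (intro finite_measure.integrable_const_bound[of _ _ 1]) (auto simp: norm_mult)
  \<comment> \<open>The indicators already gained on \<open>J\<close>, times a nonnegative
    trigonometric weight; the phase \<theta> will select cosine, sine or a constant.\<close>
  define w where "w z \<theta> x = rect_indicator J A x * (1 + cos (z \<bullet> x + \<theta>))" for z :: "real ^ 'n" and \<theta> x
  have cos1: "0 \<le> 1 + cos t" for t :: real using cos_ge_minus_one[of t] by linarith
  have w0: "0 \<le> w z \<theta> x" for z \<theta> x
    unfolding w_def using rect_indicator_bounds cos1 by (intro mult_nonneg_nonneg) auto
  have w2: "w z \<theta> x \<le> 2" for z \<theta> x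
    unfolding w_def using rect_indicator_bounds[of J A x] cos_le_one[of "z \<bullet> x + \<theta>"] cos1[of "z \<bullet> x + \<theta>"]
      mult_mono[of "rect_indicator J A x" 1 "1 + cos (z \<bullet> x + \<theta>)" 2] by simp
  have [measurable]: "w z \<theta> \<in> borel_measurable borel" for z \<theta>
    unfolding w_def by measurable
  have weq: "(\<integral>x. w z \<theta> x * indicator (A j) (x $ j) \<partial>\<eta>1) = (\<integral>x. w z \<theta> x * indicator (A j) (x $ j) \<partial>\<eta>2)"
    if z: "\<And>i. i \<in> insert j J \<Longrightarrow> z $ i = 0" for z \<theta>
  proof -
    \<comment> \<open>The law of coordinate j under the weight: a finite measure on the line, to
      which one-dimensional uniqueness applies.\<close>
    define M where "M \<eta> = distr (density \<eta> (\<lambda>x. ennreal (w z \<theta> x))) borel (\<lambda>x. x $ j)" for \<eta> :: "(real ^ 'n) measure"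
    have fin: "finite_measure (M \<eta>)" if "finite_measure \<eta>" and [measurable_cong]: "sets \<eta> = sets borel" for \<eta>
    proof -
      interpret finite_measure \<eta> by fact
      have "(\<integral>\<^sup>+x. ennreal (w z \<theta> x) \<partial>\<eta>) \<le> (\<integral>\<^sup>+x. 2 \<partial>\<eta>)"
        using w2 by (intro nn_integral_mono) (simp add: ennreal_leI ennreal_numeral[symmetric] del: ennreal_numeral)
      also have "\<dots> < \<infinity>" by (simp add: ennreal_mult_eq_top_iff less_top[symmetric])
      finally have "finite_measure (density \<eta> (\<lambda>x. ennreal (w z \<theta> x)))"
        by (intro finite_measureI) (auto simp: emeasure_density cong: nn_integral_cong)
      then show ?thesis unfolding M_def by (rule finite_measure.finite_measure_distr) auto
    qed
    have intM: "(\<integral>y. f y \<partial>M \<eta>) = (\<integral>x. w z \<theta> x *\<^sub>R f (x $ j) \<partial>\<eta>)"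
      if [measurable_cong]: "sets \<eta> = sets borel" and [measurable]: "f \<in> borel_measurable borel"
      for \<eta> and f :: "real \<Rightarrow> 'b::{banach, second_countable_topology}"
      unfolding M_def using w0 by (simp add: integral_distr integral_density)
    have decomp: "complex_of_real (w z \<theta> x) * iexp (t * x $ j)
        = rect_indicator J A x * iexp (axis j t \<bullet> x)
          + (iexp \<theta> / 2) * (rect_indicator J A x * iexp ((z + axis j t) \<bullet> x))
          + (iexp (- \<theta>) / 2) * (rect_indicator J A x * iexp ((axis j t - z) \<bullet> x))" for t x
    proof -
      have "complex_of_real (w z \<theta> x) * iexp (t * x $ j)
          = rect_indicator J A x * (complex_of_real (1 + cos (z \<bullet> x + \<theta>)) * iexp (t * x $ j))"
        by (simp add: w_def mult_ac)
      then show ?thesis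
        unfolding cexp_decompose by (simp add: inner_axis' inner_add_left inner_diff_left algebra_simps)
    qed
    have char: "(CLINT y|M \<eta>. iexp (t * y))
        = (CLINT x|\<eta>. rect_indicator J A x * iexp (axis j t \<bullet> x))
          + (iexp \<theta> / 2) * (CLINT x|\<eta>. rect_indicator J A x * iexp ((z + axis j t) \<bullet> x))
          + (iexp (- \<theta>) / 2) * (CLINT x|\<eta>. rect_indicator J A x * iexp ((axis j t - z) \<bullet> x))"
      if "finite_measure \<eta>" "sets \<eta> = sets borel" for \<eta> t
    proof -
      have "(CLINT y|M \<eta>. iexp (t * y)) = (CLINT x|\<eta>. complex_of_real (w z \<theta> x) * iexp (t * x $ j))"
        by (subst intM) (simp_all add: that scaleR_conv_of_real)
      then show ?thesis unfolding decomp using int[OF that] by simp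
    qed
    have "M \<eta>1 = M \<eta>2"
    proof (rule finite_measure_char_eqI)
      \<comment> \<open>As j is not in \<open>J\<close>, the frequencies \<open>axis j t\<close>,
        \<open>z + axis j t\<close> and \<open>axis j t - z\<close> all vanish on \<open>J\<close>,
        so the induction hypothesis covers each of the three terms.\<close>
      show "(CLINT y|M \<eta>1. iexp (t * y)) = (CLINT y|M \<eta>2. iexp (t * y))" for t
        unfolding char[OF M1] char[OF M2]
        using insert.hyps z by (subst (1 2 3) insert.IH) (auto simp: axis_def)
    qed (intro fin M1 M2, simp add: M_def, intro fin M1 M2, simp add: M_def)
    then have "(\<integral>y. indicator (A j) y \<partial>M \<eta>1) = (\<integral>y. indicator (A j) y \<partial>M \<eta>2 :: real)" by simp
    then show ?thesis by (subst (asm) (1 2) intM) (auto simp: M1 M2)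
  qed
  \<comment> \<open>Phase 0 gives 1 + cos, phase - pi / 2 gives 1 + sin, and z = 0 with phase pi / 2
    gives the constant 1. The surplus 1 + \<i> is subtracted by means of the third.\<close>
  have iexp_w: "complex_of_real (rect_indicator (insert j J) A x) * iexp (z \<bullet> x)
     = complex_of_real (w z 0 x * indicator (A j) (x $ j))
       + \<i> * complex_of_real (w z (- pi / 2) x * indicator (A j) (x $ j))
       - (1 + \<i>) * complex_of_real (w 0 (pi / 2) x * indicator (A j) (x $ j))" for x
  proof -
    have "cos (z \<bullet> x + - pi / 2) = sin (z \<bullet> x)"
      using cos_diff[of "z \<bullet> x" "pi / 2"] by simp
    moreover have "iexp (z \<bullet> x) = cos (z \<bullet> x) + \<i> * sin (z \<bullet> x)"
      by (simp add: exp_Euler cos_of_real sin_of_real mult.commute)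
    moreover have "rect_indicator (insert j J) A x = rect_indicator J A x * indicator (A j) (x $ j)"
      using insert.hyps by (simp add: rect_indicator_def)
    ultimately show ?thesis
      by (simp add: w_def algebra_simps)
  qed
  have "(CLINT x|\<eta>. rect_indicator (insert j J) A x * iexp (z \<bullet> x))
     = complex_of_real (\<integral>x. w z 0 x * indicator (A j) (x $ j) \<partial>\<eta>)
       + \<i> * complex_of_real (\<integral>x. w z (- pi / 2) x * indicator (A j) (x $ j) \<partial>\<eta>)
       - (1 + \<i>) * complex_of_real (\<integral>x. w 0 (pi / 2) x * indicator (A j) (x $ j) \<partial>\<eta>)"
    if "finite_measure \<eta>" and [measurable_cong]: "sets \<eta> = sets borel" for \<eta>
  proof -
    have "integrable \<eta> (\<lambda>x. w z \<theta> x * indicator (A j) (x $ j))" for z \<theta>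
      using w0 w2 by (intro finite_measure.integrable_const_bound[OF that(1), of _ 2])
        (auto split: split_indicator)
    then have "integrable \<eta> (\<lambda>x. complex_of_real (w z \<theta> x * indicator (A j) (x $ j)))" for z \<theta>
      by (rule integrable_of_real)
    then show ?thesis
      unfolding iexp_w integral_complex_of_real[symmetric] by simp
  qed
  then show ?case
    using weq[of z 0] weq[of z "- pi / 2"] weq[of 0 "pi / 2"] insert.prems M1 M2 by simp
qed

text \<open>With all coordinates exchanged and z = 0, the transforms give the measures of products
  of Borel sets, which are stable under intersection and generate the Borel sets.\<close>

theorem vec_char_eqI:
  fixes \<eta>1 \<eta>2 :: "(real ^ 'n) measure"
  assumes M1: "finite_measure \<eta>1" "sets \<eta>1 = sets borel" and M2: "finite_measure \<eta>2" "sets \<eta>2 = sets borel"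
    and eq: "\<And>z. (CLINT x|\<eta>1. iexp (z \<bullet> x)) = (CLINT x|\<eta>2. iexp (z \<bullet> x))"
  shows "\<eta>1 = \<eta>2"
proof -
  define G where "G = {{x :: real ^ 'n. \<forall>i. x $ i \<in> A i} | A. \<forall>i. A i \<in> sets borel}"
  show ?thesis
  proof (rule measure_eqI_generator_eq[where \<Omega> = UNIV and E = G and A = "\<lambda>_. UNIV"])
    show "Int_stable G"
    proof (rule Int_stableI)
      fix a b assume "a \<in> G" "b \<in> G"
      then obtain A B where "\<forall>i. A i \<in> sets borel" "a = {x. \<forall>i. x $ i \<in> A i}"
        "\<forall>i. B i \<in> sets borel" "b = {x. \<forall>i. x $ i \<in> B i}" by (auto simp: G_def)
      then have "a \<inter> b = {x. \<forall>i. x $ i \<in> A i \<inter> B i} \<and> (\<forall>i. A i \<inter> B i \<in> sets borel)" by auto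
      then show "a \<inter> b \<in> G" unfolding G_def by (intro CollectI exI[of _ "\<lambda>i. A i \<inter> B i"]) auto
    qed
    have "sets (borel :: (real ^ 'n) measure) = sigma_sets UNIV G"
    proof (rule antisym)
      have "range (\<lambda>(a, b). box a b :: (real ^ 'n) set) \<subseteq> G"
      proof clarify
        fix a b :: "real ^ 'n"
        have "box a b = {x. \<forall>i. x $ i \<in> {a $ i<..<b $ i}}"
          by (auto simp: mem_box_cart)
        then show "box a b \<in> G" unfolding G_def by (intro CollectI exI[of _ "\<lambda>i. {a $ i<..<b $ i}"]) auto
      qed
      then show "sets (borel :: (real ^ 'n) measure) \<subseteq> sigma_sets UNIV G"
        by (simp add: borel_eq_box sigma_sets_mono')
      show "sigma_sets UNIV G \<subseteq> sets (borel :: (real ^ 'n) measure)"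
      proof (rule sets.sigma_sets_subset[of _ borel, simplified])
        show "G \<subseteq> sets borel"
        proof
          fix a assume "a \<in> G"
          then obtain A where [measurable]: "\<And>i. A i \<in> sets borel" and a: "a = {x. \<forall>i. x $ i \<in> A i}"
            by (auto simp: G_def)
          show "a \<in> sets borel" unfolding a by measurable
        qed
      qed
    qed
    then show "sets \<eta>1 = sigma_sets UNIV G" "sets \<eta>2 = sigma_sets UNIV G" using M1 M2 by auto
    show "range (\<lambda>_. UNIV) \<subseteq> G" unfolding G_def by (auto intro!: exI[of _ "\<lambda>_. UNIV"])
    show "emeasure \<eta>1 UNIV \<noteq> \<infinity>"
      using finite_measure.emeasure_finite[OF M1(1)] by auto
    fix X assume "X \<in> G"
    then obtain A where A: "\<And>i. A i \<in> sets borel" and X: "X = {x. \<forall>i. x $ i \<in> A i}"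
      by (auto simp: G_def)
    note [measurable] = A
    have ind: "rect_indicator UNIV A x = indicator X x" for x
      unfolding rect_indicator_def X by (auto simp: indicator_def prod_zero_iff)
    have XS: "X \<in> sets borel" unfolding X by measurable
    have "complex_of_real (measure \<eta> X) = (CLINT x|\<eta>. rect_indicator UNIV A x * iexp (0 \<bullet> x))"
      if "sets \<eta> = sets borel" for \<eta>
      using XS sets_eq_imp_space_eq[OF that] that by (simp add: ind)
    from this[of \<eta>1] this[of \<eta>2] have "measure \<eta>1 X = measure \<eta>2 X"
      using vec_char_rect_eq[OF M1 M2 eq, of UNIV A 0] A M1 M2 by simp
    then show "emeasure \<eta>1 X = emeasure \<eta>2 X"
      by (simp add: finite_measure.emeasure_eq_measure M1 M2)
  qed (auto simp: G_def)
qed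

section \<open>Uniqueness of the Levy measure\<close>

definition lk_integrand :: "real ^ 'n \<Rightarrow> real ^ 'n \<Rightarrow> complex" where
  "lk_integrand z x = iexp (z \<bullet> x) - 1 - \<i> * complex_of_real ((z \<bullet> x) / (1 + (norm x)\<^sup>2))"

definition lk_exponent :: "real ^ 'n ^ 'n \<Rightarrow> (real ^ 'n) measure \<Rightarrow> real ^ 'n \<Rightarrow> real ^ 'n \<Rightarrow> complex" where
  "lk_exponent \<Sigma> \<nu> \<gamma> z = - complex_of_real (z \<bullet> (\<Sigma> *v z)) / 2 + (CLINT x|\<nu>. lk_integrand z x)
     + \<i> * complex_of_real (\<gamma> \<bullet> z)"

lemma measurable_lk_integrand[measurable]: "lk_integrand z \<in> borel_measurable borel"
  unfolding lk_integrand_def by measurable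

text \<open>Near the origin, exp (i t) - 1 - i t is of second order in t, and replacing t by t / (1
  + |x|^2) costs at most |z| |x|^2. The dependence on z is explicit because continuity of the
  exponent needs a bound that is uniform for bounded z.\<close>

lemma lk_integrand_bound:
  "norm (lk_integrand z x) \<le> (2 + norm z + (norm z)\<^sup>2) * min 1 ((norm x)\<^sup>2)"
proof (cases "norm x \<le> 1")
  case True
  let ?t = "z \<bullet> x"
  have t: "\<bar>?t\<bar> \<le> norm z * norm x" by (rule Cauchy_Schwarz_ineq2)
  have "lk_integrand z x = (iexp ?t - (1 + \<i> * ?t)) + \<i> * complex_of_real (?t - ?t / (1 + (norm x)\<^sup>2))"
    by (simp add: lk_integrand_def algebra_simps)
  then have "norm (lk_integrand z x) \<le> norm (iexp ?t - (1 + \<i> * ?t)) + \<bar>?t - ?t / (1 + (norm x)\<^sup>2)\<bar>"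
    by (metis norm_triangle_ineq norm_mult norm_ii mult_1 norm_of_real)
  also have "norm (iexp ?t - (1 + \<i> * ?t)) \<le> ?t\<^sup>2 / 2"
    using iexp_approx1[of ?t 1] by (simp add: field_simps power2_eq_square)
  also have "?t\<^sup>2 / 2 \<le> (norm z)\<^sup>2 * (norm x)\<^sup>2"
  proof -
    have "?t\<^sup>2 \<le> (norm z * norm x)\<^sup>2" using t by (metis abs_ge_zero power2_abs power_mono)
    moreover have "0 \<le> (norm z)\<^sup>2 * (norm x)\<^sup>2" by simp
    ultimately show ?thesis unfolding power_mult_distrib by linarith
  qed
  also have "\<bar>?t - ?t / (1 + (norm x)\<^sup>2)\<bar> \<le> norm z * (norm x)\<^sup>2"
  proof -
    have p: "0 < 1 + (norm x)\<^sup>2" by (simp add: add_pos_nonneg)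
    then have "?t - ?t / (1 + (norm x)\<^sup>2) = ?t * ((norm x)\<^sup>2 / (1 + (norm x)\<^sup>2))"
      by (simp add: field_simps)
    also have "\<bar>\<dots>\<bar> = \<bar>?t\<bar> * ((norm x)\<^sup>2 / (1 + (norm x)\<^sup>2))" using p by (simp add: abs_mult)
    also have "\<dots> \<le> norm z * ((norm x)\<^sup>2)"
    proof (rule mult_mono)
      show "\<bar>?t\<bar> \<le> norm z" using t True mult_left_le[of "norm x" "norm z"] by simp
      show "(norm x)\<^sup>2 / (1 + (norm x)\<^sup>2) \<le> (norm x)\<^sup>2"
        using p by (simp add: divide_le_eq mult_le_cancel_left1 add_pos_nonneg)
    qed (use p in auto)
    finally show ?thesis .
  qed
  finally have "norm (lk_integrand z x) \<le> (norm z + (norm z)\<^sup>2) * (norm x)\<^sup>2"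
    by (simp add: algebra_simps)
  also have "\<dots> \<le> (2 + norm z + (norm z)\<^sup>2) * (norm x)\<^sup>2" by (intro mult_right_mono) auto
  also have "(norm x)\<^sup>2 = min 1 ((norm x)\<^sup>2)" using True by (simp add: power_le_one)
  finally show ?thesis .
next
  case False
  let ?t = "z \<bullet> x"
  have t: "\<bar>?t\<bar> \<le> norm z * norm x" by (rule Cauchy_Schwarz_ineq2)
  have "norm (lk_integrand z x) \<le> norm (iexp ?t) + norm (1::complex) + norm (\<i> * complex_of_real (?t / (1 + (norm x)\<^sup>2)))"
    unfolding lk_integrand_def by (metis (no_types, lifting) add.commute add_left_mono norm_triangle_ineq4 order.trans)
  also have "\<dots> = 2 + \<bar>?t\<bar> / (1 + (norm x)\<^sup>2)"
    by (simp add: norm_mult norm_divide add_nonneg_nonneg abs_of_nonneg del: of_real_divide of_real_add)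
  also have "\<bar>?t\<bar> / (1 + (norm x)\<^sup>2) \<le> norm z"
  proof -
    have "\<bar>?t\<bar> \<le> norm z * (1 + (norm x)\<^sup>2)"
      using t False self_le_power[of "norm x" 2] mult_left_mono[of "norm x" "1 + (norm x)\<^sup>2" "norm z"] by simp
    then show ?thesis by (simp add: divide_le_eq add_pos_nonneg)
  qed
  finally have "norm (lk_integrand z x) \<le> 2 + norm z + (norm z)\<^sup>2" by (simp add: add_increasing2)
  moreover have "min 1 ((norm x)\<^sup>2) = 1" using False by (simp add: one_le_power)
  ultimately show ?thesis by simp
qed

lemma levy_measure_integrable_min:
  assumes "\<nu> \<in> levy_measures"
  shows "integrable \<nu> (\<lambda>x. min 1 ((norm x)\<^sup>2))"
proof (rule integrableI_nonneg)
  have [measurable_cong]: "sets \<nu> = sets borel" using assms by (simp add: levy_measures_def)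
  show "(\<lambda>x. min 1 ((norm x)\<^sup>2)) \<in> borel_measurable \<nu>" by measurable
qed (use assms in \<open>auto simp: levy_measures_def\<close>)

lemma integrable_lk_integrand:
  assumes "\<nu> \<in> levy_measures"
  shows "integrable \<nu> (lk_integrand z)"
proof (rule Bochner_Integration.integrable_bound)
  have [measurable_cong]: "sets \<nu> = sets borel" using assms by (simp add: levy_measures_def)
  show "integrable \<nu> (\<lambda>x. (2 + norm z + (norm z)\<^sup>2) * min 1 ((norm x)\<^sup>2))"
    by (intro integrable_mult_right levy_measure_integrable_min assms)
  show "lk_integrand z \<in> borel_measurable \<nu>" by measurable
  show "AE x in \<nu>. norm (lk_integrand z x) \<le> norm ((2 + norm z + (norm z)\<^sup>2) * min 1 ((norm x)\<^sup>2))"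
    by (intro AE_I2 order.trans[OF lk_integrand_bound]) simp
qed

lemma continuous_on_lk_exponent:
  assumes "\<nu> \<in> levy_measures"
  shows "continuous_on UNIV (lk_exponent \<Sigma> \<nu> \<gamma>)"
proof (rule continuous_on_sequentiallyI)
  fix u and a :: "real ^ 'a"
  assume u: "u \<longlonglongrightarrow> a"
  have [measurable_cong]: "sets \<nu> = sets borel" using assms by (simp add: levy_measures_def)
  obtain R where R: "\<And>n. norm (u n) \<le> R"
    using convergent_imp_Bseq[OF convergentI[OF u]] by (auto elim!: BseqE)
  have "(\<lambda>n. CLINT x|\<nu>. lk_integrand (u n) x) \<longlonglongrightarrow> (CLINT x|\<nu>. lk_integrand a x)"
  proof (rule integral_dominated_convergence[where w = "\<lambda>x. (2 + R + R\<^sup>2) * min 1 ((norm x)\<^sup>2)"])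
    show "integrable \<nu> (\<lambda>x. (2 + R + R\<^sup>2) * min 1 ((norm x)\<^sup>2))"
      by (intro integrable_mult_right levy_measure_integrable_min assms)
    show "AE x in \<nu>. (\<lambda>n. lk_integrand (u n) x) \<longlonglongrightarrow> lk_integrand a x"
      unfolding lk_integrand_def using u
      by (intro AE_I2 tendsto_intros) (auto simp: add_nonneg_eq_0_iff)
    show "AE x in \<nu>. norm (lk_integrand (u n) x) \<le> (2 + R + R\<^sup>2) * min 1 ((norm x)\<^sup>2)" for n
      using R[of n] by (intro AE_I2 order.trans[OF lk_integrand_bound] mult_right_mono add_mono power_mono) auto
  qed auto
  moreover have "(\<lambda>n. \<Sigma> *v u n) \<longlonglongrightarrow> \<Sigma> *v a"
    by (rule bounded_linear.tendsto[OF matrix_vector_mul_bounded_linear u])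
  ultimately show "(\<lambda>n. lk_exponent \<Sigma> \<nu> \<gamma> (u n)) \<longlonglongrightarrow> lk_exponent \<Sigma> \<nu> \<gamma> a"
    unfolding lk_exponent_def by (intro tendsto_intros u) simp_all
qed

text \<open>The values lie in the discrete set of integer multiples of 2 pi i, so a continuous
  function on a connected space is constant.\<close>

lemma continuous_exp_eq_1:
  fixes d :: "'a::real_normed_vector \<Rightarrow> complex"
  assumes cont: "continuous_on UNIV d" and exp1: "\<And>z. exp (d z) = 1" and d0: "d 0 = 0"
  shows "d z = 0"
proof -
  have "d constant_on UNIV"
  proof (rule continuous_discrete_range_constant[OF _ cont])
    fix x
    show "\<exists>e>0. \<forall>y. y \<in> UNIV \<and> d y \<noteq> d x \<longrightarrow> e \<le> norm (d y - d x)"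
    proof (intro exI[of _ "2 * pi"] conjI allI impI)
      fix y assume y: "y \<in> UNIV \<and> d y \<noteq> d x"
      obtain m where m: "Im (d x) = of_int (2 * m) * pi" "Re (d x) = 0" using exp1[of x] by (auto simp: exp_eq_1)
      obtain n where n: "Im (d y) = of_int (2 * n) * pi" "Re (d y) = 0" using exp1[of y] by (auto simp: exp_eq_1)
      have "n \<noteq> m" using y m n by (auto simp: complex_eq_iff)
      then have "1 \<le> \<bar>real_of_int (n - m)\<bar>" by linarith
      then have "2 * pi * 1 \<le> 2 * pi * \<bar>real_of_int (n - m)\<bar>" by (intro mult_left_mono) auto
      also have "Im (d y - d x) = 2 * pi * real_of_int (n - m)"
        using m n by (simp add: algebra_simps)
      then have "2 * pi * \<bar>real_of_int (n - m)\<bar> = \<bar>Im (d y - d x)\<bar>"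
        by (simp add: abs_mult)
      also have "\<dots> \<le> norm (d y - d x)" by (rule abs_Im_le_cmod)
      finally show "2 * pi \<le> norm (d y - d x)" by simp
    qed simp
  qed auto
  then show ?thesis using d0 by (auto simp: constant_on_def)
qed

text \<open>Minus one half of the symmetric second difference with step \<open>w\<close>. It
  annihilates affine functions of z and multiplies exp (i z x) by 1 - cos (w x).\<close>

definition half_diff2 :: "('a::real_vector \<Rightarrow> complex) \<Rightarrow> 'a \<Rightarrow> 'a \<Rightarrow> complex" where
  "half_diff2 f w z = f z - (f (z + w) + f (z - w)) / 2"

lemma lk_integrand_half_diff2:
  "lk_integrand z x - (lk_integrand (z + w) x + lk_integrand (z - w) x) / 2
      = iexp (z \<bullet> x) * complex_of_real (1 - cos (w \<bullet> x))"
proof -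
  have c: "complex_of_real (cos (w \<bullet> x)) = (exp (\<i> * of_real (w \<bullet> x)) + exp (- (\<i> * of_real (w \<bullet> x)))) / 2"
    unfolding cos_of_real[symmetric] cos_exp_eq ..
  have avg: "a / k - ((a + b) / k + (a - b) / k) / 2 = 0" for a b k :: real
    by (simp add: add_divide_distrib diff_divide_distrib)
  have "complex_of_real ((z \<bullet> x) / (1 + (norm x)\<^sup>2)) - (complex_of_real (((z + w) \<bullet> x) / (1 + (norm x)\<^sup>2))
      + complex_of_real (((z - w) \<bullet> x) / (1 + (norm x)\<^sup>2))) / 2
    = complex_of_real ((z \<bullet> x) / (1 + (norm x)\<^sup>2) - ((z \<bullet> x + w \<bullet> x) / (1 + (norm x)\<^sup>2)
      + (z \<bullet> x - w \<bullet> x) / (1 + (norm x)\<^sup>2)) / 2)"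
    unfolding inner_add_left inner_diff_left
    by (simp only: of_real_diff of_real_add of_real_divide of_real_numeral)
  also have "\<dots> = 0" unfolding avg by simp
  finally have "complex_of_real ((z \<bullet> x) / (1 + (norm x)\<^sup>2)) - (complex_of_real (((z + w) \<bullet> x) / (1 + (norm x)\<^sup>2))
      + complex_of_real (((z - w) \<bullet> x) / (1 + (norm x)\<^sup>2))) / 2 = 0" .
  moreover have "iexp ((z + w) \<bullet> x) = iexp (z \<bullet> x) * exp (\<i> * of_real (w \<bullet> x))"
    by (simp add: inner_add_left exp_add[symmetric] distrib_left)
  moreover have "iexp ((z - w) \<bullet> x) = iexp (z \<bullet> x) * exp (- (\<i> * of_real (w \<bullet> x)))"
    by (simp add: inner_diff_left exp_add[symmetric] right_diff_distrib)
  moreover have "a - 1 - \<i> * p - ((b - 1 - \<i> * q) + (c - 1 - \<i> * r)) / 2 = a - (b + c) / 2 - \<i> * (p - (q + r) / 2)"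
    for a b c p q r :: complex by (simp add: field_simps)
  ultimately show ?thesis
    unfolding lk_integrand_def by (simp only: of_real_diff c) (simp add: field_simps)
qed

lemma half_diff2_lk_exponent:
  assumes \<nu>: "\<nu> \<in> levy_measures"
  shows "half_diff2 (lk_exponent \<Sigma> \<nu> \<gamma>) w z
    = complex_of_real (w \<bullet> (\<Sigma> *v w)) / 2 + (CLINT x|\<nu>. iexp (z \<bullet> x) * complex_of_real (1 - cos (w \<bullet> x)))"
proof -
  have quad: "z \<bullet> (\<Sigma> *v z) - ((z + w) \<bullet> (\<Sigma> *v (z + w)) + (z - w) \<bullet> (\<Sigma> *v (z - w))) / 2 = - (w \<bullet> (\<Sigma> *v w))"
    by (simp add: matrix_vector_right_distrib matrix_vector_mult_diff_distrib inner_add_left inner_add_right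
        inner_diff_left inner_diff_right field_simps)
  have lin: "\<gamma> \<bullet> z - (\<gamma> \<bullet> (z + w) + \<gamma> \<bullet> (z - w)) / 2 = 0"
    by (simp add: inner_add_right inner_diff_right)
  note pt = lk_integrand_half_diff2
  have I: "(CLINT x|\<nu>. lk_integrand z x) - ((CLINT x|\<nu>. lk_integrand (z + w) x) + (CLINT x|\<nu>. lk_integrand (z - w) x)) / 2
     = (CLINT x|\<nu>. lk_integrand z x - (lk_integrand (z + w) x + lk_integrand (z - w) x) / 2)"
    using integrable_lk_integrand[OF \<nu>] by simp
  have Q: "complex_of_real (z \<bullet> (\<Sigma> *v z)) - (complex_of_real ((z + w) \<bullet> (\<Sigma> *v (z + w))) + complex_of_real ((z - w) \<bullet> (\<Sigma> *v (z - w)))) / 2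
     = complex_of_real (- (w \<bullet> (\<Sigma> *v w)))"
    unfolding quad[symmetric] by simp
  have G: "complex_of_real (\<gamma> \<bullet> z) - (complex_of_real (\<gamma> \<bullet> (z + w)) + complex_of_real (\<gamma> \<bullet> (z - w))) / 2 = 0"
    using arg_cong[OF lin, of complex_of_real] by simp
  have rearrange: "(- a / 2 + I + \<i> * g) - ((- a' / 2 + I' + \<i> * g') + (- a'' / 2 + I'' + \<i> * g'')) / 2
      = - (a - (a' + a'') / 2) / 2 + (I - (I' + I'') / 2) + \<i> * (g - (g' + g'') / 2)" for a a' a'' I I' I'' g g' g'' :: complex
    by (simp add: field_simps)
  show ?thesis
    unfolding half_diff2_def lk_exponent_def rearrange I Q G pt by simp
qed

text \<open>The first difference leaves the constant \<open>w \<bullet> (\<Sigma> *v w) / 2\<close>; the second one removes it.\<close>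

lemma half_diff2_half_diff2_lk_exponent:
  assumes \<nu>: "\<nu> \<in> levy_measures"
  shows "half_diff2 (half_diff2 (lk_exponent \<Sigma> \<nu> \<gamma>) w) w z
    = (CLINT x|\<nu>. iexp (z \<bullet> x) * complex_of_real ((1 - cos (w \<bullet> x))\<^sup>2))"
proof -
  have [measurable_cong]: "sets \<nu> = sets borel" using assms by (simp add: levy_measures_def)
  let ?h = "\<lambda>z x. iexp (z \<bullet> x) * complex_of_real (1 - cos (w \<bullet> x))"
  have int: "integrable \<nu> (?h z)" for z
  proof -
    have "integrable \<nu> (\<lambda>x. lk_integrand z x - (lk_integrand (z + w) x + lk_integrand (z - w) x) / 2)"
      using integrable_lk_integrand[OF \<nu>] by simp
    then show ?thesis by (simp only: lk_integrand_half_diff2)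
  qed
  have pt: "?h z x - (?h (z + w) x + ?h (z - w) x) / 2 = iexp (z \<bullet> x) * complex_of_real ((1 - cos (w \<bullet> x))\<^sup>2)" for x
  proof -
    have c: "complex_of_real (cos (w \<bullet> x)) = (exp (\<i> * of_real (w \<bullet> x)) + exp (- (\<i> * of_real (w \<bullet> x)))) / 2"
      unfolding cos_of_real[symmetric] cos_exp_eq ..
    have e: "iexp ((z + w) \<bullet> x) = iexp (z \<bullet> x) * exp (\<i> * of_real (w \<bullet> x))"
      "iexp ((z - w) \<bullet> x) = iexp (z \<bullet> x) * exp (- (\<i> * of_real (w \<bullet> x)))"
      by (simp_all add: inner_add_left inner_diff_left exp_add[symmetric] distrib_left right_diff_distrib)
    have "?h z x - (?h (z + w) x + ?h (z - w) x) / 2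
       = iexp (z \<bullet> x) * (1 - complex_of_real (cos (w \<bullet> x))) * complex_of_real (1 - cos (w \<bullet> x))"
      unfolding e c by (simp add: field_simps)
    then show ?thesis by (simp add: power2_eq_square mult.assoc)
  qed
  have "half_diff2 (half_diff2 (lk_exponent \<Sigma> \<nu> \<gamma>) w) w z
     = (CLINT x|\<nu>. ?h z x) - ((CLINT x|\<nu>. ?h (z + w) x) + (CLINT x|\<nu>. ?h (z - w) x)) / 2"
    unfolding half_diff2_def[of "half_diff2 _ _"] half_diff2_lk_exponent[OF \<nu>] by (simp add: field_simps)
  also have "\<dots> = (CLINT x|\<nu>. ?h z x - (?h (z + w) x + ?h (z - w) x) / 2)"
    using int by simp
  finally show ?thesis unfolding pt .
qed

text \<open>The weight (1 - cos (w x))^2 makes a Levy measure finite, and the transform of the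
  weighted measure is an iterated difference of the exponent. So the exponent determines the
  weighted measure, and the weight can be divided out where it is positive.\<close>

lemma levy_measures_eq_on:
  assumes \<nu>: "\<nu>1 \<in> levy_measures" "\<nu>2 \<in> levy_measures"
    and eq: "lk_exponent \<Sigma>1 \<nu>1 \<gamma>1 = lk_exponent \<Sigma>2 \<nu>2 \<gamma>2"
    and B: "B \<in> sets borel" "B \<subseteq> {x. cos (w \<bullet> x) \<noteq> 1}"
  shows "emeasure \<nu>1 B = emeasure \<nu>2 B"
proof -
  have [measurable_cong]: "sets \<nu>1 = sets borel" "sets \<nu>2 = sets borel"
    using \<nu> by (auto simp: levy_measures_def)
  define q where "q x = (1 - cos (w \<bullet> x))\<^sup>2" for x
  have [measurable]: "q \<in> borel_measurable borel" unfolding q_def by measurable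
  have q0: "0 \<le> q x" for x by (simp add: q_def)
  have char: "(CLINT x|density \<nu> (\<lambda>x. ennreal (q x)). iexp (z \<bullet> x))
      = half_diff2 (half_diff2 (lk_exponent \<Sigma> \<nu> \<gamma>) w) w z" if "\<nu> \<in> levy_measures" for \<nu> \<Sigma> \<gamma> z
  proof -
    have [measurable_cong]: "sets \<nu> = sets borel" using that by (simp add: levy_measures_def)
    show ?thesis
      unfolding half_diff2_half_diff2_lk_exponent[OF that] using q0
      by (subst integral_density) (auto simp: scaleR_conv_of_real q_def mult.commute)
  qed
  have fin: "finite_measure (density \<nu> (\<lambda>x. ennreal (q x)))" if "\<nu> \<in> levy_measures" for \<nu>
  proof (rule finite_measureI)
    have [measurable_cong]: "sets \<nu> = sets borel" using that by (simp add: levy_measures_def)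
    \<comment> \<open>From 1 - cos <= 2 the weight is at most 4; from 1 - cos a = 2 sin^2 (a / 2) it
      is also at most (w x)^2, hence at most |w|^2 |x|^2.\<close>
    define C where "C = 4 + (norm w)\<^sup>2"
    have "q x \<le> C * min 1 ((norm x)\<^sup>2)" for x
    proof -
      have c: "0 \<le> 1 - cos (w \<bullet> x)" "1 - cos (w \<bullet> x) \<le> 2"
        using cos_ge_minus_one[of "w \<bullet> x"] by auto
      have "q x \<le> 2 * (1 - cos (w \<bullet> x))"
        unfolding q_def power2_eq_square by (rule mult_right_mono[OF c(2,1)])
      also have "\<dots> = 4 * (sin ((w \<bullet> x) / 2))\<^sup>2"
        using cos_double_sin[of "(w \<bullet> x) / 2"] by simp
      also have "\<dots> \<le> 4 * \<bar>(w \<bullet> x) / 2\<bar>\<^sup>2"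
        using power_mono[OF abs_sin_x_le_abs_x abs_ge_zero, of "(w \<bullet> x) / 2" 2] by simp
      also have "\<dots> = \<bar>w \<bullet> x\<bar>\<^sup>2" by (simp add: power2_eq_square)
      also have "\<dots> \<le> (norm w * norm x)\<^sup>2"
        by (intro power_mono Cauchy_Schwarz_ineq2) auto
      finally have "q x \<le> C * (norm x)\<^sup>2"
        by (simp add: C_def power_mult_distrib distrib_right add_increasing)
      moreover have "q x \<le> C"
        using power_mono[OF c(2,1), of 2] by (simp add: q_def C_def add_increasing2)
      ultimately show ?thesis by (simp add: min_def)
    qed
    moreover have "0 \<le> C" by (simp add: C_def)
    ultimately have "(\<integral>\<^sup>+x. ennreal (q x) \<partial>\<nu>) \<le> (\<integral>\<^sup>+x. ennreal C * ennreal (min 1 ((norm x)\<^sup>2)) \<partial>\<nu>)"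
      by (intro nn_integral_mono) (simp add: ennreal_mult'[symmetric] ennreal_leI)
    also have "\<dots> = ennreal C * (\<integral>\<^sup>+x. ennreal (min 1 ((norm x)\<^sup>2)) \<partial>\<nu>)"
      by (rule nn_integral_cmult) measurable
    also have "\<dots> < \<infinity>" using that by (simp add: ennreal_mult_less_top levy_measures_def)
    finally show "emeasure (density \<nu> (\<lambda>x. ennreal (q x))) (space (density \<nu> (\<lambda>x. ennreal (q x)))) \<noteq> \<infinity>"
      by (simp add: emeasure_density cong: nn_integral_cong)
  qed
  have D: "density \<nu>1 (\<lambda>x. ennreal (q x)) = density \<nu>2 (\<lambda>x. ennreal (q x))"
  proof (rule vec_char_eqI)
    show "(CLINT x|density \<nu>1 (\<lambda>x. ennreal (q x)). iexp (z \<bullet> x)) = (CLINT x|density \<nu>2 (\<lambda>x. ennreal (q x)). iexp (z \<bullet> x))" for z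
      unfolding char[OF \<nu>(1), of _ \<Sigma>1 \<gamma>1] char[OF \<nu>(2), of _ \<Sigma>2 \<gamma>2] eq ..
  qed (use \<nu> fin in \<open>auto simp: levy_measures_def\<close>)
  have "emeasure \<nu> B = (\<integral>\<^sup>+x. indicator B x * ennreal (1 / q x) \<partial>density \<nu> (\<lambda>x. ennreal (q x)))"
    if [measurable_cong]: "sets \<nu> = sets borel" for \<nu>
  proof -
    have [measurable]: "B \<in> sets borel" by fact
    have "(\<integral>\<^sup>+x. indicator B x * ennreal (1 / q x) \<partial>density \<nu> (\<lambda>x. ennreal (q x)))
       = (\<integral>\<^sup>+x. ennreal (q x) * (indicator B x * ennreal (1 / q x)) \<partial>\<nu>)"
      by (rule nn_integral_density) measurable
    also have "\<dots> = (\<integral>\<^sup>+x. indicator B x \<partial>\<nu>)"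
    proof (rule nn_integral_cong)
      fix x
      show "ennreal (q x) * (indicator B x * ennreal (1 / q x)) = indicator B x"
      proof (cases "x \<in> B")
        case True
        then have "0 < q x" using B q0 by (auto simp: q_def)
        then show ?thesis using True by (simp add: ennreal_mult'[symmetric])
      qed simp
    qed
    finally show ?thesis using that B by simp
  qed
  from this[of \<nu>1] this[of \<nu>2] show ?thesis using \<nu> D by (simp add: levy_measures_def)
qed

theorem levy_khintchine_measure_unique:
  assumes t1: "has_levy_khintchine_triplet \<mu> \<Sigma>1 \<nu>1 \<gamma>1" and t2: "has_levy_khintchine_triplet \<mu> \<Sigma>2 \<nu>2 \<gamma>2"
  shows "\<nu>1 = \<nu>2"
proof -
  have \<nu>: "\<nu>1 \<in> levy_measures" "\<nu>2 \<in> levy_measures"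
    using t1 t2 by (auto simp: has_levy_khintchine_triplet_def)
  have e: "(CLINT x|\<mu>. iexp (z \<bullet> x)) = exp (lk_exponent \<Sigma>1 \<nu>1 \<gamma>1 z)"
    "(CLINT x|\<mu>. iexp (z \<bullet> x)) = exp (lk_exponent \<Sigma>2 \<nu>2 \<gamma>2 z)" for z
    using t1 t2 by (auto simp: has_levy_khintchine_triplet_def lk_exponent_def lk_integrand_def)
  \<comment> \<open>The exponentials agree, so the exponents could still differ by multiples of 2 pi
    i; continuity and the common value 0 at z = 0 exclude this.\<close>
  have "lk_exponent \<Sigma>1 \<nu>1 \<gamma>1 z - lk_exponent \<Sigma>2 \<nu>2 \<gamma>2 z = 0" for z
  proof (rule continuous_exp_eq_1[of "\<lambda>z. lk_exponent \<Sigma>1 \<nu>1 \<gamma>1 z - lk_exponent \<Sigma>2 \<nu>2 \<gamma>2 z"])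
    show "exp (lk_exponent \<Sigma>1 \<nu>1 \<gamma>1 z - lk_exponent \<Sigma>2 \<nu>2 \<gamma>2 z) = 1" for z
      using e[of z] by (simp add: exp_diff)
    show "lk_exponent \<Sigma>1 \<nu>1 \<gamma>1 0 - lk_exponent \<Sigma>2 \<nu>2 \<gamma>2 0 = 0"
      by (simp add: lk_exponent_def lk_integrand_def)
  qed (intro continuous_intros continuous_on_lk_exponent \<nu>)
  then have eq: "lk_exponent \<Sigma>1 \<nu>1 \<gamma>1 = lk_exponent \<Sigma>2 \<nu>2 \<gamma>2" by (simp add: fun_eq_iff)
  \<comment> \<open>Countably many steps suffice: for x not 0 take a coordinate with x_i not 0 and n
    > |x_i|. Then 0 < |x_i / (n + 1)| < 1 < 2 pi, so the cosine is not 1.\<close>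
  define W :: "(real ^ 'a) set" where "W = (\<lambda>(i, n). axis i (1 / real (Suc n))) ` UNIV"
  have "countable W" "W \<noteq> {}" unfolding W_def by auto
  then obtain w :: "nat \<Rightarrow> real ^ 'a" where w: "range w = W"
    by (metis range_from_nat_into)
  define A where "A n = {x. cos (w n \<bullet> x) \<noteq> 1}" for n
  have A[measurable]: "A n \<in> sets borel" for n unfolding A_def by measurable
  have dA: "disjointed A n \<in> sets borel" for n
  proof -
    have "range (disjointed A) \<subseteq> sets borel"
      using A by (intro sets.range_disjointed_sets) auto
    then show ?thesis by auto
  qed
  have cover: "x \<in> (\<Union>n. A n)" if x: "x \<noteq> 0" for x
  proof -
    obtain i where i: "x $ i \<noteq> 0" using x by (auto simp: vec_eq_iff)
    obtain n where n: "\<bar>x $ i\<bar> < real n" using reals_Archimedean2 by blast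
    have "axis i (1 / real (Suc n)) \<in> range w" unfolding w W_def by auto
    then obtain m where m: "w m = axis i (1 / real (Suc n))" by auto
    let ?t = "x $ i / real (Suc n)"
    have "\<bar>?t\<bar> < 1" using n by (simp add: field_simps)
    moreover have "?t \<noteq> 0" using i by simp
    ultimately have "cos ?t \<noteq> 1"
    proof (intro notI)
      assume t: "\<bar>?t\<bar> < 1" "?t \<noteq> 0" and "cos ?t = 1"
      then obtain k :: int where k: "?t = of_int k * 2 * pi" by (auto simp: cos_one_2pi_int)
      with t have "1 \<le> \<bar>real_of_int k\<bar>" by (cases "k = 0") auto
      then have "1 * (2 * pi) \<le> \<bar>real_of_int k\<bar> * (2 * pi)" by (intro mult_right_mono) auto
      then have "2 * pi \<le> \<bar>?t\<bar>" unfolding k by (simp add: abs_mult mult_ac)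
      then show False using t pi_gt3 by linarith
    qed
    then have "x \<in> A m" by (simp add: A_def m inner_axis')
    then show ?thesis by blast
  qed
  have sum: "emeasure \<nu> B = (\<Sum>n. emeasure \<nu> (B \<inter> disjointed A n))"
    if \<nu>: "\<nu> \<in> levy_measures" and B: "B \<in> sets borel" for \<nu> B
  proof -
    have [measurable_cong]: "sets \<nu> = sets borel" using \<nu> by (simp add: levy_measures_def)
    have BS: "B \<in> sets \<nu>" "B \<inter> (\<Union>n. A n) \<in> sets \<nu>"
      using A B \<nu> by (auto simp: levy_measures_def)
    have "AE x in \<nu>. x \<noteq> 0" using \<nu> by (intro AE_I[of _ _ "{0}"]) (auto simp: levy_measures_def)
    then have "AE x in \<nu>. x \<in> B \<longleftrightarrow> x \<in> B \<inter> (\<Union>n. A n)"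
      by eventually_elim (use cover in blast)
    then have "emeasure \<nu> B = emeasure \<nu> (B \<inter> (\<Union>n. A n))"
      by (rule emeasure_eq_AE[OF _ BS])
    also have "B \<inter> (\<Union>n. A n) = (\<Union>n. B \<inter> disjointed A n)"
      using UN_disjointed_eq[of A] by blast
    also have "emeasure \<nu> \<dots> = (\<Sum>n. emeasure \<nu> (B \<inter> disjointed A n))"
    proof (rule suminf_emeasure[symmetric])
      show "range (\<lambda>n. B \<inter> disjointed A n) \<subseteq> sets \<nu>"
        using dA B \<nu> by (auto simp: levy_measures_def)
      show "disjoint_family (\<lambda>n. B \<inter> disjointed A n)"
        using disjoint_family_disjointed[of A] by (auto simp: disjoint_family_on_def)
    qed
    finally show ?thesis .
  qed
  show ?thesis
  proof (rule measure_eqI)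
    show "sets \<nu>1 = sets \<nu>2" using \<nu> by (auto simp: levy_measures_def)
    fix B assume "B \<in> sets \<nu>1"
    then have B: "B \<in> sets borel" using \<nu> by (auto simp: levy_measures_def)
    have "emeasure \<nu>1 (B \<inter> disjointed A n) = emeasure \<nu>2 (B \<inter> disjointed A n)" for n
    proof (rule levy_measures_eq_on[OF \<nu> eq])
      show "B \<inter> disjointed A n \<in> sets borel"
        using B dA by auto
      show "B \<inter> disjointed A n \<subseteq> {x. cos (w n \<bullet> x) \<noteq> 1}"
        using disjointed_subset[of A n] by (auto simp: A_def)
    qed
    then show "emeasure \<nu>1 B = emeasure \<nu>2 B" by (simp only: sum[OF \<nu>(1) B] sum[OF \<nu>(2) B])
  qed
qed

section \<open>Mixtures along rays\<close>

text \<open>Mixtures over the spherical part of a polar decomposition, which may fail to be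
  sigma-finite, are covered: the identity is lifted from sets to functions by induction over
  nonnegative measurable functions rather than through product measures.\<close>

lemma nn_integral_kernel_mixture:
  assumes P: "sets P = sets N" and K: "\<And>x. x \<in> space \<mu> \<Longrightarrow> sets (K x) = sets N"
    and meas: "\<And>B. B \<in> sets N \<Longrightarrow> (\<lambda>x. emeasure (K x) B) \<in> borel_measurable \<mu>"
    and eq: "\<And>B. B \<in> sets N \<Longrightarrow> emeasure P B = (\<integral>\<^sup>+x. emeasure (K x) B \<partial>\<mu>)"
    and f: "f \<in> borel_measurable N"
  shows "(\<lambda>x. \<integral>\<^sup>+y. f y \<partial>K x) \<in> borel_measurable \<mu> \<and> (\<integral>\<^sup>+y. f y \<partial>P) = (\<integral>\<^sup>+x. \<integral>\<^sup>+y. f y \<partial>K x \<partial>\<mu>)"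
  using f
proof (induction rule: borel_measurable_induct)
  case (cong f g)
  have "(\<integral>\<^sup>+y. f y \<partial>Q) = (\<integral>\<^sup>+y. g y \<partial>Q)" if "sets Q = sets N" for Q
    using cong(3) sets_eq_imp_space_eq[OF that] by (intro nn_integral_cong) simp
  with P K cong(4) show ?case by (simp cong: measurable_cong nn_integral_cong)
next
  case (set B)
  have "(\<integral>\<^sup>+y. indicator B y \<partial>Q) = emeasure Q B" if "sets Q = sets N" for Q
    using set that by simp
  with P K set meas eq show ?case by (simp cong: measurable_cong nn_integral_cong)
next
  case (mult u c)
  have "(\<integral>\<^sup>+y. c * u y \<partial>Q) = c * (\<integral>\<^sup>+y. u y \<partial>Q)" if "sets Q = sets N" for Q
    using mult(2) that by (intro nn_integral_cmult) (simp cong: measurable_cong_sets)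
  moreover have "(\<lambda>x. c * (\<integral>\<^sup>+y. u y \<partial>K x)) \<in> borel_measurable \<mu>"
    using mult(4) by (intro borel_measurable_times_ennreal) auto
  ultimately show ?case using P K mult(4) by (simp add: nn_integral_cmult cong: measurable_cong nn_integral_cong)
next
  case (add u v)
  have sum: "(\<integral>\<^sup>+y. v y + u y \<partial>Q) = (\<integral>\<^sup>+y. v y \<partial>Q) + (\<integral>\<^sup>+y. u y \<partial>Q)" if "sets Q = sets N" for Q
    using add(1,3) that by (intro nn_integral_add) (simp_all cong: measurable_cong_sets)
  have "(\<lambda>x. (\<integral>\<^sup>+y. v y \<partial>K x) + (\<integral>\<^sup>+y. u y \<partial>K x)) \<in> borel_measurable \<mu>"
    using add.IH by (intro borel_measurable_add) auto
  moreover have "(\<integral>\<^sup>+x. (\<integral>\<^sup>+y. v y \<partial>K x) + (\<integral>\<^sup>+y. u y \<partial>K x) \<partial>\<mu>)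
      = (\<integral>\<^sup>+x. \<integral>\<^sup>+y. v y \<partial>K x \<partial>\<mu>) + (\<integral>\<^sup>+x. \<integral>\<^sup>+y. u y \<partial>K x \<partial>\<mu>)"
    using add.IH by (intro nn_integral_add) auto
  ultimately show ?case
    using add.IH K by (simp add: sum P cong: measurable_cong nn_integral_cong)
next
  case (seq U)
  have "(\<integral>\<^sup>+y. (SUP i. U i y) \<partial>Q) = (SUP i. \<integral>\<^sup>+y. U i y \<partial>Q)" if "sets Q = sets N" for Q
    using seq.hyps that by (intro nn_integral_monotone_convergence_SUP) (auto cong: measurable_cong_sets)
  then have *: "(\<integral>\<^sup>+y. (SUP u\<in>range U. u y) \<partial>Q) = (SUP i. \<integral>\<^sup>+y. U i y \<partial>Q)" if "sets Q = sets N" for Q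
    using that by (simp add: image_comp)
  have inc: "incseq (\<lambda>i x. \<integral>\<^sup>+y. U i y \<partial>K x)"
    using seq.hyps by (auto simp: incseq_def le_fun_def intro!: nn_integral_mono)
  have "(\<integral>\<^sup>+x. (SUP i. \<integral>\<^sup>+y. U i y \<partial>K x) \<partial>\<mu>) = (SUP i. \<integral>\<^sup>+x. \<integral>\<^sup>+y. U i y \<partial>K x \<partial>\<mu>)"
    using seq.IH inc by (intro nn_integral_monotone_convergence_SUP) auto
  moreover have "(\<lambda>x. SUP i. \<integral>\<^sup>+y. U i y \<partial>K x) \<in> borel_measurable \<mu>"
    using seq.IH by (intro borel_measurable_SUP) auto
  ultimately show ?case
    using seq.IH K by (simp add: seq.hyps * P cong: measurable_cong nn_integral_cong)
qed

lemma emeasure_kernel_mixture: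
  assumes K: "\<And>x. x \<in> space \<mu> \<Longrightarrow> sets (K x) = sets N"
    and meas: "\<And>B. B \<in> sets N \<Longrightarrow> (\<lambda>x. emeasure (K x) B) \<in> borel_measurable \<mu>"
    and B: "B \<in> sets N"
  shows "emeasure (measure_of (space N) (sets N) (\<lambda>B. \<integral>\<^sup>+x. emeasure (K x) B \<partial>\<mu>)) B = (\<integral>\<^sup>+x. emeasure (K x) B \<partial>\<mu>)"
proof (rule emeasure_measure_of_sigma[OF sets.sigma_algebra_axioms _ _ B])
  show "positive (sets N) (\<lambda>B. \<integral>\<^sup>+x. emeasure (K x) B \<partial>\<mu>)"
    by (simp add: positive_def)
  show "countably_additive (sets N) (\<lambda>B. \<integral>\<^sup>+x. emeasure (K x) B \<partial>\<mu>)"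
  proof (rule countably_additiveI)
    fix A :: "nat \<Rightarrow> 'b set" assume A: "range A \<subseteq> sets N" "disjoint_family A" "(\<Union>i. A i) \<in> sets N"
    have "(\<Sum>i. \<integral>\<^sup>+x. emeasure (K x) (A i) \<partial>\<mu>) = (\<integral>\<^sup>+x. (\<Sum>i. emeasure (K x) (A i)) \<partial>\<mu>)"
      using A meas by (intro nn_integral_suminf[symmetric]) auto
    also have "\<dots> = (\<integral>\<^sup>+x. emeasure (K x) (\<Union>i. A i) \<partial>\<mu>)"
      using A K by (intro nn_integral_cong suminf_emeasure) auto
    finally show "(\<Sum>i. \<integral>\<^sup>+x. emeasure (K x) (A i) \<partial>\<mu>) = (\<integral>\<^sup>+x. emeasure (K x) (\<Union>i. A i) \<partial>\<mu>)" .
  qed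
qed

lemma kernel_mixture_exists:
  assumes K: "\<And>x. x \<in> space \<mu> \<Longrightarrow> sets (K x) = sets N"
    and meas: "\<And>B. B \<in> sets N \<Longrightarrow> (\<lambda>x. emeasure (K x) B) \<in> borel_measurable \<mu>"
  obtains Q where "sets Q = sets N"
    and "\<And>f. f \<in> borel_measurable N \<Longrightarrow> (\<integral>\<^sup>+y. f y \<partial>Q) = (\<integral>\<^sup>+x. \<integral>\<^sup>+y. f y \<partial>K x \<partial>\<mu>)"
proof
  let ?Q = "measure_of (space N) (sets N) (\<lambda>B. \<integral>\<^sup>+x. emeasure (K x) B \<partial>\<mu>)"
  show Q: "sets ?Q = sets N"
    using sets.space_closed[of N] by (simp add: sets.sigma_sets_eq)
  fix f :: "'b \<Rightarrow> ennreal" assume f: "f \<in> borel_measurable N"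
  show "(\<integral>\<^sup>+y. f y \<partial>?Q) = (\<integral>\<^sup>+x. \<integral>\<^sup>+y. f y \<partial>K x \<partial>\<mu>)"
    using nn_integral_kernel_mixture[OF Q K meas _ f] emeasure_kernel_mixture[of \<mu> K N, OF K meas] by simp
qed

section \<open>Directions and mixtures of radial laws\<close>

definition dir :: "real ^ 'n \<Rightarrow> real ^ 'n" where
  "dir x = x /\<^sub>R norm x"

lemma measurable_dir[measurable]: "dir \<in> borel_measurable borel"
  unfolding dir_def[abs_def] by measurable

lemma norm_dir: "x \<noteq> 0 \<Longrightarrow> norm (dir x) = 1"
  by (simp add: dir_def)

lemma dir_scaleR_dir: "x \<noteq> 0 \<Longrightarrow> 0 < t \<Longrightarrow> dir (t *\<^sub>R dir x) = dir x"
  unfolding dir_def[of "t *\<^sub>R dir x"] by (simp add: norm_dir)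

text \<open>The origin is included, as \<open>dir 0\<close> is 0; polar coordinates can therefore be
  inverted without an exceptional set.\<close>

lemma norm_times_dir: "norm x *\<^sub>R dir x = x"
  by (cases "x = 0") (simp_all add: dir_def)

text \<open>Every point x is smeared over its own ray with radial density \<open>p (norm x)\<close>.
  \<open>A1\<close>, \<open>Upsilon0\<close> on Levy measures and their composition all have this
  form.\<close>

definition ray_mixture :: "(real \<Rightarrow> real \<Rightarrow> real) \<Rightarrow> (real ^ 'n) measure \<Rightarrow> (real ^ 'n) measure" where
  "ray_mixture p \<rho> = measure_of UNIV (sets borel)
     (\<lambda>B. \<integral>\<^sup>+x. (\<integral>\<^sup>+r\<in>{0<..}. ennreal (p (norm x) r) * indicator B (r *\<^sub>R dir x) \<partial>lborel) \<partial>\<rho>)"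

lemma sets_ray_mixture[simp, measurable_cong]: "sets (ray_mixture p \<rho>) = sets borel"
  unfolding ray_mixture_def by (simp add: sets.sigma_sets_eq[of borel, simplified])

lemma space_ray_mixture[simp]: "space (ray_mixture p \<rho>) = UNIV"
  by (simp add: sets_eq_imp_space_eq[OF sets_ray_mixture])

lemma nn_integral_ray_mixture:
  fixes \<rho> :: "(real ^ 'n) measure"
  assumes \<rho>[measurable_cong]: "sets \<rho> = sets borel"
    and p[measurable]: "case_prod p \<in> borel_measurable borel" and f[measurable]: "f \<in> borel_measurable borel"
  shows "(\<integral>\<^sup>+y. f y \<partial>ray_mixture p \<rho>)
    = (\<integral>\<^sup>+x. (\<integral>\<^sup>+r\<in>{0<..}. ennreal (p (norm x) r) * f (r *\<^sub>R dir x) \<partial>lborel) \<partial>\<rho>)"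
proof -
  have pm[measurable]: "(\<lambda>x. p (a x) (b x)) \<in> borel_measurable M"
    if [measurable]: "a \<in> borel_measurable M" "b \<in> borel_measurable M" for a b and M :: "'z measure"
    using measurable_compose[OF borel_measurable_Pair[OF that] p] by simp
  define K where "K x = distr (density lborel (\<lambda>r. indicator {0<..} r * ennreal (p (norm x) r))) borel
    (\<lambda>r. r *\<^sub>R dir x)" for x :: "real ^ 'n"
  have K: "sets (K x) = sets borel" for x by (simp add: K_def)
  have nnK: "(\<integral>\<^sup>+y. f y \<partial>K x) = (\<integral>\<^sup>+r\<in>{0<..}. ennreal (p (norm x) r) * f (r *\<^sub>R dir x) \<partial>lborel)"
    if [measurable]: "f \<in> borel_measurable borel" for f and x
    unfolding K_def by (simp add: nn_integral_distr nn_integral_density mult_ac)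
  have eK: "emeasure (K x) B = (\<integral>\<^sup>+r\<in>{0<..}. ennreal (p (norm x) r) * indicator B (r *\<^sub>R dir x) \<partial>lborel)"
    if "B \<in> sets borel" for B x
    using nnK[of "indicator B" x] that by (simp add: K)
  have meas: "(\<lambda>x. emeasure (K x) B) \<in> borel_measurable \<rho>" if [measurable]: "B \<in> sets borel" for B
    unfolding eK[OF that] by measurable
  have eq: "emeasure (ray_mixture p \<rho>) B = (\<integral>\<^sup>+x. emeasure (K x) B \<partial>\<rho>)" if B: "B \<in> sets borel" for B
  proof -
    have "ray_mixture p \<rho> = measure_of UNIV (sets borel) (\<lambda>B. \<integral>\<^sup>+x. emeasure (K x) B \<partial>\<rho>)"
      unfolding ray_mixture_def
      by (rule measure_of_eq) (auto simp: sets.sigma_sets_eq[of borel, simplified] eK)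
    then show ?thesis using emeasure_kernel_mixture[of \<rho> K borel, OF K meas B] by simp
  qed
  show ?thesis
    using nn_integral_kernel_mixture[of "ray_mixture p \<rho>" borel \<rho> K f] K meas eq
    by (simp add: nnK)
qed

lemma ray_mixture_eqI:
  fixes \<rho> :: "(real ^ 'n) measure"
  assumes "sets \<rho> = sets borel" "case_prod p \<in> borel_measurable borel" "sets M = sets borel"
    and "\<And>B. B \<in> sets borel \<Longrightarrow> emeasure M B
      = (\<integral>\<^sup>+x. (\<integral>\<^sup>+r\<in>{0<..}. ennreal (p (norm x) r) * indicator B (r *\<^sub>R dir x) \<partial>lborel) \<partial>\<rho>)"
  shows "M = ray_mixture p \<rho>"
proof (rule measure_eqI)
  fix B assume "B \<in> sets M"
  then have B: "B \<in> sets borel" using assms(3) by simp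
  have "emeasure M B = (\<integral>\<^sup>+y. indicator B y \<partial>ray_mixture p \<rho>)"
    unfolding assms(4)[OF B] by (rule nn_integral_ray_mixture[symmetric]) (use assms B in auto)
  then show "emeasure M B = emeasure (ray_mixture p \<rho>) B" using B by simp
qed (simp add: assms)

text \<open>The origin, excluded in \<open>A1\<close>, contributes nothing here since no r satisfies
  0 < r < sqrt 0.\<close>

lemma A1_eq_ray_mixture: "A1 \<nu> = ray_mixture (\<lambda>s r. a1 r s) \<nu>"
proof -
  have "a1 r 0 = 0" for r by (simp add: a1_def)
  then show ?thesis
    unfolding A1_def ray_mixture_def dir_def
    by (intro arg_cong[where f = "measure_of UNIV (sets borel)"] ext nn_integral_cong)
      (auto split: split_indicator)
qed

lemma measurable_a1[measurable]: "(\<lambda>(s, r). a1 r s) \<in> borel_measurable borel"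
  unfolding a1_def borel_prod[symmetric] by measurable

lemma levy_measure_AE_nonzero:
  assumes "\<rho> \<in> levy_measures"
  shows "AE x in \<rho>. x \<noteq> 0"
  using assms by (intro AE_I[of _ _ "{0}"]) (auto simp: levy_measures_def)

text \<open>By Markov's inequality the sets where min 1 |x|^2 is at least 1 / (n + 1) have finite
  measure; with the null set {0} they exhaust the space. This permits Fubini in the rewriting of
  \<open>Upsilon0\<close>.\<close>

lemma sigma_finite_levy_measure:
  fixes \<rho> :: "(real ^ 'n) measure"
  assumes "\<rho> \<in> levy_measures"
  shows "sigma_finite_measure \<rho>"
proof -
  have [measurable_cong]: "sets \<rho> = sets borel" using assms by (simp add: levy_measures_def)
  define A :: "nat \<Rightarrow> (real ^ 'n) set" where "A n = {x. 1 / real (Suc n) \<le> min 1 ((norm x)\<^sup>2)}" for n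
  have [measurable]: "A n \<in> sets borel" for n unfolding A_def by measurable
  have fin: "emeasure \<rho> (A n) \<noteq> \<infinity>" for n
  proof -
    have "emeasure \<rho> (A n) \<le> ennreal (real (Suc n)) * (\<integral>\<^sup>+x\<in>UNIV. ennreal (min 1 ((norm x)\<^sup>2)) \<partial>\<rho>)"
    proof -
      have c: "1 / real (Suc n) \<le> z \<longleftrightarrow> 1 \<le> ennreal (real (Suc n)) * ennreal z" if "0 \<le> z" for z
        using that by (simp add: ennreal_mult'[symmetric] divide_le_eq mult.commute del: of_nat_Suc)
      have "0 \<le> min 1 ((norm x)\<^sup>2)" for x :: "real ^ 'n" by simp
      then have "A n = {x \<in> UNIV. 1 \<le> ennreal (real (Suc n)) * ennreal (min 1 ((norm x)\<^sup>2))}"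
        by (intro set_eqI) (simp only: A_def mem_Collect_eq c UNIV_I simp_thms)
      then show ?thesis
        using nn_integral_Markov_inequality[of "\<lambda>x. ennreal (min 1 ((norm x)\<^sup>2))" UNIV \<rho> "ennreal (real (Suc n))"]
          sets_eq_imp_space_eq[of \<rho> borel] by simp
    qed
    also have "\<dots> < \<infinity>" using assms by (simp add: ennreal_mult_less_top levy_measures_def del: of_nat_Suc)
    finally show ?thesis by simp
  qed
  have cov: "(\<Union>n. A n) \<union> {0} = UNIV"
  proof -
    have "\<exists>n. x \<in> A n" if "x \<noteq> 0" for x :: "real ^ 'n"
    proof -
      have "0 < min 1 ((norm x)\<^sup>2)" using that by simp
      from nat_approx_posE[OF this] obtain n where "1 / real (Suc n) < min 1 ((norm x)\<^sup>2)" .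
      then show ?thesis by (intro exI[of _ n]) (simp add: A_def)
    qed
    then show ?thesis by auto
  qed
  show ?thesis
  proof
    show "\<exists>B. countable B \<and> B \<subseteq> sets \<rho> \<and> \<Union> B = space \<rho> \<and> (\<forall>a\<in>B. emeasure \<rho> a \<noteq> \<infinity>)"
      using fin cov assms sets_eq_imp_space_eq[of \<rho> borel]
      by (intro exI[of _ "insert {0} (range A)"]) (auto simp: levy_measures_def)
  qed
qed

text \<open>Fubini moves the integral over x outside. For x not 0 the substitution u = r / |x| then
  turns the standard exponential law into the exponential law with mean |x| on the ray through
  x.\<close>

lemma Upsilon0_eq_ray_mixture:
  fixes \<rho> :: "(real ^ 'n) measure"
  assumes \<rho>: "\<rho> \<in> levy_measures"
  shows "Upsilon0 \<rho> = ray_mixture (\<lambda>s r. exp (- r / s) / s) \<rho>"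
proof -
  have [measurable_cong]: "sets \<rho> = sets borel" using \<rho> by (simp add: levy_measures_def)
  interpret sigma_finite_measure \<rho> by (rule sigma_finite_levy_measure[OF \<rho>])
  interpret pair_sigma_finite \<rho> lborel ..
  have "(\<integral>\<^sup>+u\<in>{0<..}. emeasure \<rho> ((\<lambda>x. inverse u *\<^sub>R x) ` B) * ennreal (exp (- u)) \<partial>lborel)
      = (\<integral>\<^sup>+x. (\<integral>\<^sup>+r\<in>{0<..}. ennreal (exp (- r / norm x) / norm x) * indicator B (r *\<^sub>R dir x) \<partial>lborel) \<partial>\<rho>)"
    if B[measurable]: "B \<in> sets borel" for B
  proof -
    have inv: "emeasure \<rho> ((\<lambda>x. inverse u *\<^sub>R x) ` B) = (\<integral>\<^sup>+x. indicator B (u *\<^sub>R x) \<partial>\<rho>)" if "0 < u" for u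
    proof -
      have "(\<lambda>x. inverse u *\<^sub>R x) ` B = (\<lambda>x. u *\<^sub>R x) -` B"
        using that by (auto simp: image_iff intro!: bexI[of _ "u *\<^sub>R _"])
      moreover have "(\<lambda>x. u *\<^sub>R x) -` B \<in> sets \<rho>" using measurable_sets_borel[of "\<lambda>x. u *\<^sub>R x" borel B] by simp
      ultimately show ?thesis
        by (simp add: nn_integral_indicator[symmetric] indicator_vimage del: nn_integral_indicator)
    qed
    have "(\<integral>\<^sup>+u\<in>{0<..}. emeasure \<rho> ((\<lambda>x. inverse u *\<^sub>R x) ` B) * ennreal (exp (- u)) \<partial>lborel)
        = (\<integral>\<^sup>+u. \<integral>\<^sup>+x. indicator B (u *\<^sub>R x) * ennreal (exp (- u)) * indicator {0<..} u \<partial>\<rho> \<partial>lborel)"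
      by (intro nn_integral_cong) (auto simp: inv nn_integral_multc split: split_indicator)
    also have "\<dots> = (\<integral>\<^sup>+x. \<integral>\<^sup>+u. indicator B (u *\<^sub>R x) * ennreal (exp (- u)) * indicator {0<..} u \<partial>lborel \<partial>\<rho>)"
      by (rule Fubini') measurable
    also have "\<dots> = (\<integral>\<^sup>+x. (\<integral>\<^sup>+r\<in>{0<..}. ennreal (exp (- r / norm x) / norm x) * indicator B (r *\<^sub>R dir x) \<partial>lborel) \<partial>\<rho>)"
    proof (rule nn_integral_cong_AE)
      show "AE x in \<rho>. (\<integral>\<^sup>+u. indicator B (u *\<^sub>R x) * ennreal (exp (- u)) * indicator {0<..} u \<partial>lborel)
         = (\<integral>\<^sup>+r\<in>{0<..}. ennreal (exp (- r / norm x) / norm x) * indicator B (r *\<^sub>R dir x) \<partial>lborel)" (is "AE x in _. ?P x")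
        using levy_measure_AE_nonzero[OF \<rho>]
      proof eventually_elim
        fix x :: "real ^ 'n" assume x: "x \<noteq> 0"
        have "(\<integral>\<^sup>+u. indicator B (u *\<^sub>R x) * ennreal (exp (- u)) * indicator {0<..} u \<partial>lborel)
           = ennreal \<bar>1 / norm x\<bar> * (\<integral>\<^sup>+r. indicator B ((0 + 1 / norm x * r) *\<^sub>R x) * ennreal (exp (- (0 + 1 / norm x * r)))
               * indicator {0<..} (0 + 1 / norm x * r) \<partial>lborel)"
          using x by (intro nn_integral_real_affine) auto
        also have "\<dots> = (\<integral>\<^sup>+r\<in>{0<..}. ennreal (exp (- r / norm x) / norm x) * indicator B (r *\<^sub>R dir x) \<partial>lborel)"
          using x
          by (subst nn_integral_cmult[symmetric])
            (auto intro!: nn_integral_cong simp: dir_def ennreal_mult'[symmetric] divide_inverse mult_ac zero_less_mult_iff split: split_indicator)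
        finally show "?P x" .
      qed
    qed
    finally show ?thesis .
  qed
  then show ?thesis
    unfolding Upsilon0_def ray_mixture_def
    by (intro measure_of_eq) (auto simp: sets.sigma_sets_eq[of borel, simplified])
qed

text \<open>For t > 0 the point t * dir x has norm t and the direction of x, so smearing twice never
  leaves the ray and the radial densities compose like transition kernels.\<close>

lemma ray_mixture_ray_mixture:
  fixes \<rho> :: "(real ^ 'n) measure"
  assumes \<rho>: "\<rho> \<in> levy_measures"
    and p1[measurable]: "case_prod p1 \<in> borel_measurable borel" and p2[measurable]: "case_prod p2 \<in> borel_measurable borel"
    and p3: "case_prod p3 \<in> borel_measurable borel"
    and comp: "\<And>s r. 0 < s \<Longrightarrow> 0 < r \<Longrightarrow> (\<integral>\<^sup>+t\<in>{0<..}. ennreal (p2 s t) * ennreal (p1 t r) \<partial>lborel) = ennreal (p3 s r)"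
  shows "ray_mixture p1 (ray_mixture p2 \<rho>) = ray_mixture p3 \<rho>"
proof (rule ray_mixture_eqI[OF _ p3])
  show sets\<rho>[measurable_cong]: "sets \<rho> = sets borel" using \<rho> by (simp add: levy_measures_def)
  fix B :: "(real ^ 'n) set" assume B[measurable]: "B \<in> sets borel"
  have pm: "(\<lambda>x. p (a x) (b x)) \<in> borel_measurable M"
    if [measurable]: "a \<in> borel_measurable M" "b \<in> borel_measurable M" and p: "case_prod p \<in> borel_measurable borel"
    for a b and p :: "real \<Rightarrow> real \<Rightarrow> real" and M :: "'z measure"
    using measurable_compose[OF borel_measurable_Pair[OF that(1,2)] p] by simp
  note m1[measurable] = pm[OF _ _ p1] and m2[measurable] = pm[OF _ _ p2]
  let ?I = "\<lambda>y. \<integral>\<^sup>+r\<in>{0<..}. ennreal (p1 (norm y) r) * indicator B (r *\<^sub>R dir y) \<partial>lborel"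
  have "emeasure (ray_mixture p1 (ray_mixture p2 \<rho>)) B = (\<integral>\<^sup>+y. ?I y \<partial>ray_mixture p2 \<rho>)"
    using nn_integral_ray_mixture[OF _ p1, of "ray_mixture p2 \<rho>" "indicator B"] by simp
  also have "\<dots> = (\<integral>\<^sup>+x. (\<integral>\<^sup>+t\<in>{0<..}. ennreal (p2 (norm x) t) * ?I (t *\<^sub>R dir x) \<partial>lborel) \<partial>\<rho>)"
    by (rule nn_integral_ray_mixture[OF sets\<rho> p2]) measurable
  also have "\<dots> = (\<integral>\<^sup>+x. (\<integral>\<^sup>+r\<in>{0<..}. ennreal (p3 (norm x) r) * indicator B (r *\<^sub>R dir x) \<partial>lborel) \<partial>\<rho>)"
  proof (rule nn_integral_cong_AE)
    show "AE x in \<rho>. (\<integral>\<^sup>+t\<in>{0<..}. ennreal (p2 (norm x) t) * ?I (t *\<^sub>R dir x) \<partial>lborel)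
        = (\<integral>\<^sup>+r\<in>{0<..}. ennreal (p3 (norm x) r) * indicator B (r *\<^sub>R dir x) \<partial>lborel)" (is "AE x in _. ?P x")
      using levy_measure_AE_nonzero[OF \<rho>]
    proof eventually_elim
      fix x :: "real ^ 'n" assume x: "x \<noteq> 0"
      have "(\<integral>\<^sup>+t\<in>{0<..}. ennreal (p2 (norm x) t) * ?I (t *\<^sub>R dir x) \<partial>lborel)
        = (\<integral>\<^sup>+t. \<integral>\<^sup>+r. (ennreal (p2 (norm x) t) * ennreal (p1 t r) * indicator {0<..} t) * (indicator B (r *\<^sub>R dir x) * indicator {0<..} r) \<partial>lborel \<partial>lborel)"
      proof (rule nn_integral_cong)
        fix t :: real
        show "ennreal (p2 (norm x) t) * ?I (t *\<^sub>R dir x) * indicator {0<..} t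
          = (\<integral>\<^sup>+r. (ennreal (p2 (norm x) t) * ennreal (p1 t r) * indicator {0<..} t) * (indicator B (r *\<^sub>R dir x) * indicator {0<..} r) \<partial>lborel)"
        proof (cases "0 < t")
          case True
          then show ?thesis
            by (simp add: norm_dir[OF x] dir_scaleR_dir[OF x] nn_integral_cmult[symmetric] mult_ac)
        qed simp
      qed
      also have "\<dots> = (\<integral>\<^sup>+r. \<integral>\<^sup>+t. (ennreal (p2 (norm x) t) * ennreal (p1 t r) * indicator {0<..} t) * (indicator B (r *\<^sub>R dir x) * indicator {0<..} r) \<partial>lborel \<partial>lborel)"
        by (rule lborel_pair.Fubini') measurable
      also have "\<dots> = (\<integral>\<^sup>+r\<in>{0<..}. ennreal (p3 (norm x) r) * indicator B (r *\<^sub>R dir x) \<partial>lborel)"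
      proof (rule nn_integral_cong)
        fix r :: real
        show "(\<integral>\<^sup>+t. (ennreal (p2 (norm x) t) * ennreal (p1 t r) * indicator {0<..} t) * (indicator B (r *\<^sub>R dir x) * indicator {0<..} r) \<partial>lborel)
          = ennreal (p3 (norm x) r) * indicator B (r *\<^sub>R dir x) * indicator {0<..} r"
          using comp[of "norm x" r] x by (subst nn_integral_multc) (auto simp: mult_ac split: split_indicator)
      qed
      finally show "?P x" .
    qed
  qed
  finally show "emeasure (ray_mixture p1 (ray_mixture p2 \<rho>)) B
    = (\<integral>\<^sup>+x. (\<integral>\<^sup>+r\<in>{0<..}. ennreal (p3 (norm x) r) * indicator B (r *\<^sub>R dir x) \<partial>lborel) \<partial>\<rho>)" .
qed simp

text \<open>As a function of \<open>\<phi> r\<close> a multiple of exp (- \<open>\<phi> r\<close> /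
  s). The instance c = q = 1 with the identity is the exponential law of mean s; c = 2 / sqrt pi, q
  = 1 / 2 with the square is the half-normal law.\<close>

definition laplace_kernel :: "real \<Rightarrow> real \<Rightarrow> (real \<Rightarrow> real) \<Rightarrow> real \<Rightarrow> real \<Rightarrow> real" where
  "laplace_kernel c q \<phi> s r = c * s powr (- q) * exp (- \<phi> r / s)"

lemma measurable_laplace_kernel[measurable]:
  assumes [measurable]: "\<phi> \<in> borel_measurable borel"
  shows "case_prod (laplace_kernel c q \<phi>) \<in> borel_measurable borel"
  unfolding laplace_kernel_def[abs_def] borel_prod[symmetric] by measurable

section \<open>The half-normal law as a composition of arcsine and exponential laws\<close>

lemma nn_integral_Gamma_half:
  "(\<integral>\<^sup>+v\<in>{0<..}. ennreal (v powr (- 1 / 2) * exp (- v)) \<partial>lborel) = ennreal (sqrt pi)"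
proof -
  have "((\<lambda>t::real. t powr (1 / 2 - 1) / exp t) has_integral Gamma (1 / 2)) {0..}"
    by (rule Gamma_integral_real) simp
  then have "(\<integral>\<^sup>+x. ennreal (x powr (1 / 2 - 1) / exp x) * indicator {0..} x \<partial>lborel) = ennreal (Gamma (1 / 2))"
    by (rule nn_integral_has_integral_lebesgue'[rotated]) simp
  also have "(\<integral>\<^sup>+x. ennreal (x powr (1 / 2 - 1) / exp x) * indicator {0..} x \<partial>lborel)
    = (\<integral>\<^sup>+v\<in>{0<..}. ennreal (v powr (- 1 / 2) * exp (- v)) \<partial>lborel)"
  proof (rule nn_integral_cong)
    fix x :: real
    have "1 / 2 - 1 = (- 1 / 2 :: real)" by simp
    then have "x powr (1 / 2 - 1) / exp x = x powr (- 1 / 2) * exp (- x)"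
      by (simp only: exp_minus inverse_eq_divide times_divide_eq_right mult_1_right)
    then show "ennreal (x powr (1 / 2 - 1) / exp x) * indicator {0..} x = ennreal (x powr (- 1 / 2) * exp (- x)) * indicator {0<..} x"
      by (simp only:) (cases "0 < x"; cases "x = 0"; simp)
  qed
  finally show ?thesis by (simp add: Gamma_one_half_real)
qed

text \<open>The substitution t = r^2 + s * v maps the range t > r^2, where \<open>a1 r t\<close> is
  not 0, onto v > 0 and splits off exp (- r^2 / s). What remains is Gamma (1 / 2) = sqrt pi, which
  turns the constant 2 / pi into 2 / sqrt pi.\<close>

lemma arcsine_exponential_integral:
  assumes s: "0 < s" and r: "0 < r"
  shows "(\<integral>\<^sup>+t\<in>{0<..}. ennreal (exp (- t / s) / s) * ennreal (a1 r t) \<partial>lborel)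
    = ennreal (laplace_kernel (2 / sqrt pi) (1 / 2) (\<lambda>r. r\<^sup>2) s r)"
proof -
  define C where "C = 2 / pi * s powr (- 1 / 2) * exp (- r\<^sup>2 / s)"
  have [measurable]: "(\<lambda>t. a1 r t) \<in> borel_measurable borel" unfolding a1_def by measurable
  have "(\<integral>\<^sup>+t\<in>{0<..}. ennreal (exp (- t / s) / s) * ennreal (a1 r t) \<partial>lborel)
    = ennreal \<bar>s\<bar> * (\<integral>\<^sup>+v. ennreal (exp (- (r\<^sup>2 + s * v) / s) / s) * ennreal (a1 r (r\<^sup>2 + s * v)) * indicator {0<..} (r\<^sup>2 + s * v) \<partial>lborel)"
    using s by (intro nn_integral_real_affine) auto
  also have "\<dots> = (\<integral>\<^sup>+v. ennreal C * (ennreal (v powr (- 1 / 2) * exp (- v)) * indicator {0<..} v) \<partial>lborel)"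
  proof (subst nn_integral_cmult[symmetric])
    show "(\<integral>\<^sup>+v. ennreal \<bar>s\<bar> * (ennreal (exp (- (r\<^sup>2 + s * v) / s) / s) * ennreal (a1 r (r\<^sup>2 + s * v)) * indicator {0<..} (r\<^sup>2 + s * v)) \<partial>lborel)
      = (\<integral>\<^sup>+v. ennreal C * (ennreal (v powr (- 1 / 2) * exp (- v)) * indicator {0<..} v) \<partial>lborel)"
    proof (rule nn_integral_cong)
      fix v :: real
      show "ennreal \<bar>s\<bar> * (ennreal (exp (- (r\<^sup>2 + s * v) / s) / s) * ennreal (a1 r (r\<^sup>2 + s * v)) * indicator {0<..} (r\<^sup>2 + s * v))
        = ennreal C * (ennreal (v powr (- 1 / 2) * exp (- v)) * indicator {0<..} v)"
      proof (cases "0 < v")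
        case True
        have "r < sqrt (r\<^sup>2 + s * v)" using True s r by (intro real_less_rsqrt) simp
        then have a: "a1 r (r\<^sup>2 + s * v) = 2 / pi * (s powr (- 1 / 2) * v powr (- 1 / 2))"
          using True s r by (simp add: a1_def powr_mult)
        have e: "exp (- (r\<^sup>2 + s * v) / s) = exp (- r\<^sup>2 / s) * exp (- v)"
          using s by (simp add: exp_add[symmetric] field_simps)
        have "0 < r\<^sup>2 + s * v" using True s r by (simp add: add_pos_pos)
        then show ?thesis
          using True s unfolding a e C_def
          by (simp add: ennreal_mult'[symmetric] ennreal_mult''[symmetric] field_simps)
      next
        case False
        then have "sqrt (r\<^sup>2 + s * v) \<le> r" using s r by (intro real_le_lsqrt) (auto simp: mult_nonneg_nonpos)
        then show ?thesis using False by (simp add: a1_def)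
      qed
    qed
  qed measurable
  also have "\<dots> = ennreal C * ennreal (sqrt pi)"
    by (subst nn_integral_cmult) (simp_all only: nn_integral_Gamma_half, measurable)
  also have "\<dots> = ennreal (laplace_kernel (2 / sqrt pi) (1 / 2) (\<lambda>r. r\<^sup>2) s r)"
    using s by (simp add: C_def laplace_kernel_def ennreal_mult'[symmetric] ennreal_mult''[symmetric] field_simps)
  finally show ?thesis .
qed

lemma A1_Upsilon0_eq_ray_mixture:
  assumes "\<rho> \<in> levy_measures"
  shows "A1 (Upsilon0 \<rho>) = ray_mixture (laplace_kernel (2 / sqrt pi) (1 / 2) (\<lambda>r. r\<^sup>2)) \<rho>"
  unfolding A1_eq_ray_mixture Upsilon0_eq_ray_mixture[OF assms]
proof (rule ray_mixture_ray_mixture[OF assms])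
  show "case_prod (\<lambda>s r. exp (- r / s) / s) \<in> borel_measurable (borel :: (real \<times> real) measure)"
    unfolding borel_prod[symmetric] by measurable
qed (use arcsine_exponential_integral in auto)

lemma Upsilon0_eq_laplace_mixture:
  fixes \<rho> :: "(real ^ 'n) measure"
  assumes "\<rho> \<in> levy_measures"
  shows "Upsilon0 \<rho> = ray_mixture (laplace_kernel 1 1 (\<lambda>r. r)) \<rho>"
proof -
  have "exp (- r / norm x) / norm x = laplace_kernel 1 1 (\<lambda>r. r) (norm x) r" for x :: "real ^ 'n" and r
    by (simp add: laplace_kernel_def powr_minus_divide powr_one' field_simps)
  then show ?thesis
    unfolding Upsilon0_eq_ray_mixture[OF assms] ray_mixture_def by (simp only:)
qed

section \<open>Uniqueness of the representing measure\<close>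

lemma pair_measure_rect_eqI:
  assumes fin: "finite_measure P1" and S: "sets P1 = sets (M \<Otimes>\<^sub>M N)" "sets P2 = sets (M \<Otimes>\<^sub>M N)"
    and eq: "\<And>A B. A \<in> sets M \<Longrightarrow> B \<in> sets N \<Longrightarrow> emeasure P1 (A \<times> B) = emeasure P2 (A \<times> B)"
  shows "P1 = P2"
proof (rule measure_eqI_generator_eq[OF Int_stable_pair_measure_generator[of M N]])
  show "{a \<times> b |a b. a \<in> sets M \<and> b \<in> sets N} \<subseteq> Pow (space M \<times> space N)"
    by (rule pair_measure_closed)
  show "range (\<lambda>i::nat. space M \<times> space N) \<subseteq> {a \<times> b |a b. a \<in> sets M \<and> b \<in> sets N}" by auto
  show "emeasure P1 (space M \<times> space N) \<noteq> \<infinity>"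
    using finite_measure.emeasure_finite[OF fin] by simp
qed (auto simp: S sets_pair_measure eq)

text \<open>Since 1 / s + 1 = 1 / ratio s, a factor exp (- r^2) changes the parameter s of the
  Gaussian kernel exponent into \<open>ratio s\<close>; this is why powers of this particular
  function appear as moments.\<close>

definition ratio :: "real \<Rightarrow> real" where
  "ratio s = s / (1 + s)"

definition unratio :: "real \<Rightarrow> real" where
  "unratio y = y / (1 - y)"

lemma measurable_ratio[measurable]: "ratio \<in> borel_measurable borel" "unratio \<in> borel_measurable borel"
  unfolding ratio_def[abs_def] unratio_def[abs_def] by measurable

lemma ratio_bounds: "0 \<le> s \<Longrightarrow> 0 \<le> ratio s" "0 \<le> s \<Longrightarrow> ratio s < 1" "0 < s \<Longrightarrow> 0 < ratio s"
  by (auto simp: ratio_def)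

lemma unratio_ratio: "0 \<le> s \<Longrightarrow> unratio (ratio s) = s"
  by (simp add: ratio_def unratio_def field_simps)

definition polar_measure :: "(real ^ 'n) measure \<Rightarrow> ((real ^ 'n) \<times> real) measure" where
  "polar_measure \<rho> = distr \<rho> (borel \<Otimes>\<^sub>M borel) (\<lambda>x. (dir x, ratio (norm x)))"

lemma nn_integral_polar_measure:
  fixes \<rho> :: "(real ^ 'n) measure"
  assumes [measurable_cong]: "sets \<rho> = sets borel" and [measurable]: "f \<in> borel_measurable (borel \<Otimes>\<^sub>M borel)"
  shows "(\<integral>\<^sup>+z. f z \<partial>polar_measure \<rho>) = (\<integral>\<^sup>+x. f (dir x, ratio (norm x)) \<partial>\<rho>)"
  unfolding polar_measure_def by (rule nn_integral_distr) measurable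

lemma polar_measure_inverse:
  fixes \<rho> :: "(real ^ 'n) measure"
  assumes [measurable_cong]: "sets \<rho> = sets borel" and [measurable]: "f \<in> borel_measurable borel"
  shows "(\<integral>\<^sup>+x. f x \<partial>\<rho>) = (\<integral>\<^sup>+z. f (unratio (snd z) *\<^sub>R fst z) \<partial>polar_measure \<rho>)"
  by (subst nn_integral_polar_measure[OF assms(1)]) (measurable, simp add: unratio_ratio norm_times_dir)

text \<open>Passing from the radius \<open>s\<close> to the bounded variable \<open>s / (1 + s)\<close> makes the moment problem
  determinate.\<close>

lemma levy_measure_eqI_cone_moments:
  fixes \<rho>1 \<rho>2 :: "(real ^ 'n) measure"
  assumes \<rho>: "\<rho>1 \<in> levy_measures" "\<rho>2 \<in> levy_measures"
    and w[measurable]: "w \<in> borel_measurable borel" and wpos: "\<And>s. 0 < s \<Longrightarrow> 0 < w s"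
    and fin: "(\<integral>\<^sup>+x. ennreal (w (norm x)) \<partial>\<rho>1) < \<infinity>" "(\<integral>\<^sup>+x. ennreal (w (norm x)) \<partial>\<rho>2) < \<infinity>"
    and eq: "\<And>C j. C \<in> sets borel \<Longrightarrow>
      (\<integral>\<^sup>+x. ennreal (w (norm x) * ratio (norm x) ^ j) * indicator C (dir x) \<partial>\<rho>1)
      = (\<integral>\<^sup>+x. ennreal (w (norm x) * ratio (norm x) ^ j) * indicator C (dir x) \<partial>\<rho>2)"
  shows "\<rho>1 = \<rho>2"
proof -
  \<comment> \<open>The part of \<rho> in the cone over \<open>C\<close>, made finite by the
    weight.\<close>
  define D where "D C \<rho> = density \<rho> (\<lambda>x. ennreal (w (norm x)) * indicator C (dir x))" for C and \<rho> :: "(real ^ 'n) measure"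
  have sD: "sets (D C \<rho>) = sets \<rho>" for C \<rho> by (simp add: D_def)
  have finD: "finite_measure (D C \<rho>)"
    if "sets \<rho> = sets borel" "(\<integral>\<^sup>+x. ennreal (w (norm x)) \<partial>\<rho>) < \<infinity>" and [measurable]: "C \<in> sets borel" for C \<rho>
  proof (rule finite_measureI)
    note [measurable_cong] = that(1)
    have "emeasure (D C \<rho>) (space (D C \<rho>)) = (\<integral>\<^sup>+x. ennreal (w (norm x)) * indicator C (dir x) \<partial>\<rho>)"
      unfolding D_def by (simp add: emeasure_density cong: nn_integral_cong)
    also have "\<dots> \<le> (\<integral>\<^sup>+x. ennreal (w (norm x)) \<partial>\<rho>)"
      by (intro nn_integral_mono) (auto split: split_indicator)
    finally show "emeasure (D C \<rho>) (space (D C \<rho>)) \<noteq> \<infinity>" using that(2) by auto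
  qed
  have nnD: "(\<integral>\<^sup>+x. f x \<partial>D C \<rho>) = (\<integral>\<^sup>+x. ennreal (w (norm x)) * indicator C (dir x) * f x \<partial>\<rho>)"
    if [measurable_cong]: "sets \<rho> = sets borel" and [measurable]: "C \<in> sets borel" "f \<in> borel_measurable borel" for \<rho> C f
    unfolding D_def by (rule nn_integral_density) measurable
  define R where "R C \<rho> = distr (D C \<rho>) borel (\<lambda>x. ratio (norm x))" for C \<rho>
  have unit: "unit_supported (R C \<rho>)"
    if s: "sets \<rho> = sets borel" and "(\<integral>\<^sup>+x. ennreal (w (norm x)) \<partial>\<rho>) < \<infinity>" "C \<in> sets borel" for C \<rho>
  proof -
    note [measurable_cong] = s sD
    have "finite_measure (R C \<rho>)"
      unfolding R_def by (rule finite_measure.finite_measure_distr[OF finD[OF that]]) measurable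
    moreover have "AE y in R C \<rho>. y \<in> {0..1}"
      unfolding R_def by (subst AE_distr_iff) (auto simp: ratio_bounds less_imp_le)
    moreover have "sets (R C \<rho>) = sets borel" by (simp add: R_def)
    ultimately show ?thesis unfolding unit_supported_def by blast
  qed
  have mom: "(\<integral>y. y ^ j \<partial>R C \<rho>) = enn2real (\<integral>\<^sup>+x. ennreal (w (norm x) * ratio (norm x) ^ j) * indicator C (dir x) \<partial>\<rho>)"
    if s: "\<rho> \<in> levy_measures" and [measurable]: "C \<in> sets borel" for C \<rho> j
  proof -
    have s': "sets \<rho> = sets borel" using s by (simp add: levy_measures_def)
    note [measurable_cong] = s' sD
    have "(\<integral>y. y ^ j \<partial>R C \<rho>) = (\<integral>x. ratio (norm x) ^ j \<partial>D C \<rho>)"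
      unfolding R_def by (rule integral_distr) measurable
    also have "\<dots> = enn2real (\<integral>\<^sup>+x. ennreal (ratio (norm x) ^ j) \<partial>D C \<rho>)"
      by (rule integral_eq_nn_integral) (auto simp: ratio_bounds)
    also have "(\<integral>\<^sup>+x. ennreal (ratio (norm x) ^ j) \<partial>D C \<rho>)
        = (\<integral>\<^sup>+x. ennreal (w (norm x)) * indicator C (dir x) * ennreal (ratio (norm x) ^ j) \<partial>\<rho>)"
      by (rule nnD[OF s']) measurable
    also have "\<dots> = (\<integral>\<^sup>+x. ennreal (w (norm x) * ratio (norm x) ^ j) * indicator C (dir x) \<partial>\<rho>)"
      by (intro nn_integral_cong) (auto simp: ennreal_mult''[symmetric] ratio_bounds split: split_indicator)
    finally show ?thesis .
  qed
  have s: "sets \<rho>1 = sets borel" "sets \<rho>2 = sets borel" using \<rho> by (auto simp: levy_measures_def)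
  \<comment> \<open>In every cone the transformed radius has a law on [0, 1] with prescribed
    moments. Cones times radial sets are the rectangles of polar coordinates, so these laws
    determine the weighted measures.\<close>
  have RR: "R C \<rho>1 = R C \<rho>2" if C: "C \<in> sets borel" for C
    using unit[OF s(1) fin(1) C] unit[OF s(2) fin(2) C]
    by (rule unit_supported_eqI) (simp only: mom[OF \<rho>(1) C] mom[OF \<rho>(2) C] eq[OF C])
  have P: "polar_measure (D UNIV \<rho>1) = polar_measure (D UNIV \<rho>2)"
  proof (rule pair_measure_rect_eqI)
    note [measurable_cong] = s sD
    show "finite_measure (polar_measure (D UNIV \<rho>1))"
      unfolding polar_measure_def
      by (rule finite_measure.finite_measure_distr[OF finD[OF s(1) fin(1)]]) measurable
    show "sets (polar_measure (D UNIV \<rho>1)) = sets (borel \<Otimes>\<^sub>M borel)"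
      "sets (polar_measure (D UNIV \<rho>2)) = sets (borel \<Otimes>\<^sub>M borel)"
      by (simp_all add: polar_measure_def)
    fix A :: "(real ^ 'n) set" and B :: "real set"
    assume A[measurable]: "A \<in> sets borel" and B[measurable]: "B \<in> sets borel"
    have "emeasure (polar_measure (D UNIV \<rho>)) (A \<times> B) = emeasure (R A \<rho>) B" if s: "sets \<rho> = sets borel" for \<rho>
    proof -
      note [measurable_cong] = s sD
      have "emeasure (polar_measure (D UNIV \<rho>)) (A \<times> B) = (\<integral>\<^sup>+z. indicator (A \<times> B) z \<partial>polar_measure (D UNIV \<rho>))"
        by (simp add: polar_measure_def)
      also have "\<dots> = (\<integral>\<^sup>+x. indicator (A \<times> B) (dir x, ratio (norm x)) \<partial>D UNIV \<rho>)"
        by (rule nn_integral_polar_measure) (auto simp: sD s)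
      also have "\<dots> = (\<integral>\<^sup>+x. ennreal (w (norm x)) * indicator UNIV (dir x) * indicator (A \<times> B) (dir x, ratio (norm x)) \<partial>\<rho>)"
        by (rule nnD[OF s]) measurable
      also have "\<dots> = (\<integral>\<^sup>+x. ennreal (w (norm x)) * indicator A (dir x) * indicator B (ratio (norm x)) \<partial>\<rho>)"
        by (intro nn_integral_cong) (auto split: split_indicator)
      also have "\<dots> = (\<integral>\<^sup>+x. indicator B (ratio (norm x)) \<partial>D A \<rho>)"
        by (rule nnD[OF s, symmetric]) measurable
      also have "\<dots> = (\<integral>\<^sup>+y. indicator B y \<partial>R A \<rho>)"
        unfolding R_def by (rule nn_integral_distr[symmetric]) measurable
      finally show ?thesis by (simp add: R_def)
    qed
    then show "emeasure (polar_measure (D UNIV \<rho>1)) (A \<times> B) = emeasure (polar_measure (D UNIV \<rho>2)) (A \<times> B)"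
      using s RR[OF A] by simp
  qed
  \<comment> \<open>Back from polar coordinates, and the weight is divided out; it is positive off
    the origin, which has measure 0.\<close>
  have rec: "emeasure \<rho> B = (\<integral>\<^sup>+z. indicator B (unratio (snd z) *\<^sub>R fst z) * ennreal (1 / w (norm (unratio (snd z) *\<^sub>R fst z))) \<partial>polar_measure (D UNIV \<rho>))"
    if \<rho>: "\<rho> \<in> levy_measures" and B[measurable]: "B \<in> sets borel" for \<rho> B
  proof -
    have s: "sets \<rho> = sets borel" using \<rho> by (simp add: levy_measures_def)
    note [measurable_cong] = s sD
    have "emeasure \<rho> B = (\<integral>\<^sup>+x. indicator B x \<partial>\<rho>)" by simp
    also have "\<dots> = (\<integral>\<^sup>+x. ennreal (w (norm x)) * indicator UNIV (dir x) * (indicator B x * ennreal (1 / w (norm x))) \<partial>\<rho>)"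
    proof (rule nn_integral_cong_AE)
      show "AE x in \<rho>. indicator B x = ennreal (w (norm x)) * indicator UNIV (dir x) * (indicator B x * ennreal (1 / w (norm x)))" (is "AE x in _. ?P x")
        using levy_measure_AE_nonzero[OF \<rho>]
      proof eventually_elim
        fix x :: "real ^ 'n" assume "x \<noteq> 0"
        then have "0 < w (norm x)" by (simp add: wpos)
        then show "?P x"
          by (auto simp: ennreal_mult'[symmetric] split: split_indicator)
      qed
    qed
    also have "\<dots> = (\<integral>\<^sup>+x. indicator B x * ennreal (1 / w (norm x)) \<partial>D UNIV \<rho>)"
      by (rule nnD[OF s, symmetric]) measurable
    also have "\<dots> = (\<integral>\<^sup>+z. indicator B (unratio (snd z) *\<^sub>R fst z) * ennreal (1 / w (norm (unratio (snd z) *\<^sub>R fst z))) \<partial>polar_measure (D UNIV \<rho>))"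
      by (rule polar_measure_inverse) (auto simp: sD s)
    finally show ?thesis .
  qed
  show ?thesis
    by (rule measure_eqI) (auto simp: s rec[OF \<rho>(1)] rec[OF \<rho>(2)] P)
qed

text \<open>Scaling r = a * v with a^2 = ratio s merges the two exponentials into exp (- v^2). Odd
  powers are taken because a^(2 k + 1) and the Jacobian a combine to an integer power of
  \<open>ratio s\<close>, and the remaining Gaussian moment is k! / 2.\<close>

lemma gaussian_kernel_moment:
  assumes s: "0 < s"
  shows "(\<integral>\<^sup>+r\<in>{0<..}. ennreal (laplace_kernel (2 / sqrt pi) (1 / 2) (\<lambda>r. r\<^sup>2) s r) * ennreal (r ^ (2 * k + 1) * exp (- r\<^sup>2)) \<partial>lborel)
    = ennreal (fact k / sqrt pi * (s powr (- 1 / 2) * ratio s ^ Suc k))"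
proof -
  have base: "(\<integral>\<^sup>+v\<in>{0<..}. ennreal (exp (- v\<^sup>2) * v ^ (2 * k + 1)) \<partial>lborel) = ennreal (fact k / 2)"
  proof -
    let ?f = "\<lambda>x::real. indicator {0..} x *\<^sub>R (exp (- x\<^sup>2) * x ^ (2 * k + 1))"
    have "(\<integral>\<^sup>+x. ennreal (?f x) \<partial>lborel) = ennreal (\<integral>x. ?f x \<partial>lborel)"
      using gaussian_moment_odd_pos[of k]
      by (intro nn_integral_eq_integral) (auto simp: has_bochner_integral_iff split: split_indicator)
    also have "\<dots> = ennreal (fact k / 2)"
      using gaussian_moment_odd_pos[of k] by (simp only: has_bochner_integral_iff)
    also have "(\<integral>\<^sup>+x. ennreal (?f x) \<partial>lborel) = (\<integral>\<^sup>+v\<in>{0<..}. ennreal (exp (- v\<^sup>2) * v ^ (2 * k + 1)) \<partial>lborel)"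
    proof (rule nn_integral_cong)
      fix x :: real
      show "ennreal (?f x) = ennreal (exp (- x\<^sup>2) * x ^ (2 * k + 1)) * indicator {0<..} x"
        by (cases "0 < x"; cases "x = 0") simp_all
    qed
    finally show ?thesis .
  qed
  define a where "a = sqrt (ratio s)"
  have a: "0 < a" "a\<^sup>2 = ratio s" using ratio_bounds[of s] s by (auto simp: a_def)
  define C where "C = 2 / sqrt pi * s powr (- 1 / 2) * a ^ (2 * k + 2)"
  have "(\<integral>\<^sup>+r\<in>{0<..}. ennreal (laplace_kernel (2 / sqrt pi) (1 / 2) (\<lambda>r. r\<^sup>2) s r) * ennreal (r ^ (2 * k + 1) * exp (- r\<^sup>2)) \<partial>lborel)
    = ennreal \<bar>a\<bar> * (\<integral>\<^sup>+v. ennreal (laplace_kernel (2 / sqrt pi) (1 / 2) (\<lambda>r. r\<^sup>2) s (0 + a * v))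
        * ennreal ((0 + a * v) ^ (2 * k + 1) * exp (- (0 + a * v)\<^sup>2)) * indicator {0<..} (0 + a * v) \<partial>lborel)"
    using a(1) by (intro nn_integral_real_affine) (auto simp: laplace_kernel_def)
  also have "\<dots> = (\<integral>\<^sup>+v. ennreal C * (ennreal (exp (- v\<^sup>2) * v ^ (2 * k + 1)) * indicator {0<..} v) \<partial>lborel)"
  proof (subst nn_integral_cmult[symmetric])
    show "(\<integral>\<^sup>+v. ennreal \<bar>a\<bar> * (ennreal (laplace_kernel (2 / sqrt pi) (1 / 2) (\<lambda>r. r\<^sup>2) s (0 + a * v))
        * ennreal ((0 + a * v) ^ (2 * k + 1) * exp (- (0 + a * v)\<^sup>2)) * indicator {0<..} (0 + a * v)) \<partial>lborel)
      = (\<integral>\<^sup>+v. ennreal C * (ennreal (exp (- v\<^sup>2) * v ^ (2 * k + 1)) * indicator {0<..} v) \<partial>lborel)"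
    proof (rule nn_integral_cong)
      fix v :: real
      show "ennreal \<bar>a\<bar> * (ennreal (laplace_kernel (2 / sqrt pi) (1 / 2) (\<lambda>r. r\<^sup>2) s (0 + a * v))
        * ennreal ((0 + a * v) ^ (2 * k + 1) * exp (- (0 + a * v)\<^sup>2)) * indicator {0<..} (0 + a * v))
        = ennreal C * (ennreal (exp (- v\<^sup>2) * v ^ (2 * k + 1)) * indicator {0<..} v)"
      proof (cases "0 < v")
        case True
        have "- (a * v)\<^sup>2 / s + - (a * v)\<^sup>2 = - (v\<^sup>2 * (ratio s * (1 / s + 1)))"
          unfolding power_mult_distrib a by (simp add: algebra_simps)
        also have "1 / s + 1 = (1 + s) / s" using s by (simp add: add_divide_distrib)
        also have "ratio s * ((1 + s) / s) = 1" using s by (simp add: ratio_def)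
        finally have "exp (- (a * v)\<^sup>2 / s) * exp (- (a * v)\<^sup>2) = exp (- v\<^sup>2)"
          by (simp add: exp_add[symmetric])
        moreover have "a * (laplace_kernel (2 / sqrt pi) (1 / 2) (\<lambda>r. r\<^sup>2) s (a * v) * ((a * v) ^ (2 * k + 1) * exp (- (a * v)\<^sup>2)))
            = C * v ^ (2 * k + 1) * (exp (- (a * v)\<^sup>2 / s) * exp (- (a * v)\<^sup>2))"
          by (simp add: laplace_kernel_def C_def power_mult_distrib)
        ultimately have e: "a * (laplace_kernel (2 / sqrt pi) (1 / 2) (\<lambda>r. r\<^sup>2) s (a * v) * ((a * v) ^ (2 * k + 1) * exp (- (a * v)\<^sup>2)))
            = C * (exp (- v\<^sup>2) * v ^ (2 * k + 1))"
          by (simp only: mult_ac)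
        have "0 \<le> C" "0 \<le> laplace_kernel (2 / sqrt pi) (1 / 2) (\<lambda>r. r\<^sup>2) s (a * v)" "0 < a * v"
          using a s True by (auto simp: C_def laplace_kernel_def)
        then have "ennreal \<bar>a\<bar> * (ennreal (laplace_kernel (2 / sqrt pi) (1 / 2) (\<lambda>r. r\<^sup>2) s (a * v))
            * ennreal ((a * v) ^ (2 * k + 1) * exp (- (a * v)\<^sup>2)))
          = ennreal (a * (laplace_kernel (2 / sqrt pi) (1 / 2) (\<lambda>r. r\<^sup>2) s (a * v) * ((a * v) ^ (2 * k + 1) * exp (- (a * v)\<^sup>2))))"
          using a True by (simp only: ennreal_mult' abs_of_pos less_imp_le)
        also have "\<dots> = ennreal C * ennreal (exp (- v\<^sup>2) * v ^ (2 * k + 1))"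
          unfolding e using \<open>0 \<le> C\<close> by (rule ennreal_mult')
        finally show ?thesis using True a by (simp add: mult.assoc zero_less_mult_iff)
      next
        case False
        then show ?thesis using a by (simp add: zero_less_mult_iff)
      qed
    qed
  qed (auto simp: laplace_kernel_def)
  also have "\<dots> = ennreal C * ennreal (fact k / 2)"
    by (subst nn_integral_cmult) (simp_all only: base, measurable)
  also have "\<dots> = ennreal (C * (fact k / 2))"
    using a s by (intro ennreal_mult''[symmetric]) auto
  also have "C * (fact k / 2) = fact k / sqrt pi * (s powr (- 1 / 2) * (a\<^sup>2) ^ Suc k)"
    unfolding power_mult[symmetric] by (simp add: C_def)
  finally show ?thesis unfolding a .
qed

theorem A1_Upsilon0_inj:
  fixes \<rho>1 \<rho>2 :: "(real ^ 'n) measure"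
  assumes \<rho>: "\<rho>1 \<in> levy_measures1" "\<rho>2 \<in> levy_measures1" and eq: "A1 (Upsilon0 \<rho>1) = A1 (Upsilon0 \<rho>2)"
  shows "\<rho>1 = \<rho>2"
proof -
  \<comment> \<open>The moment formula for k = 1, up to constants. One factor \<open>ratio s\<close>
    would leave order sqrt s near 0, which min 1 s does not dominate; with two factors the order is
    s powr (3 / 2). Hence the test functions start with the third power of r.\<close>
  define w where "w s = s powr (- 1 / 2) * (ratio s)\<^sup>2" for s
  have [measurable]: "w \<in> borel_measurable borel" unfolding w_def[abs_def] by measurable
  have levy: "\<rho>1 \<in> levy_measures" "\<rho>2 \<in> levy_measures" using \<rho> by (auto simp: levy_measures1_def)
  have w_le: "w s \<le> min 1 s" if "0 \<le> s" for s
  proof (cases "s = 0")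
    case False
    with that have s: "0 < s" by simp
    have "sqrt s \<le> 1 + s"
      using s by (intro real_le_lsqrt) (auto simp: power2_eq_square algebra_simps)
    then have q: "0 \<le> sqrt s / (1 + s)" "sqrt s / (1 + s) \<le> 1" using s by auto
    have r: "0 \<le> s / (1 + s)" "s / (1 + s) \<le> 1" "s / (1 + s) \<le> s"
      using s by (auto simp: divide_le_eq algebra_simps)
    have "s powr (- 1 / 2) * s = sqrt s"
      using s by (simp add: powr_minus_divide powr_half_sqrt real_div_sqrt)
    then have "w s = sqrt s / (1 + s) * (s / (1 + s))"
      by (simp add: w_def ratio_def power2_eq_square mult.assoc[symmetric])
    moreover have "sqrt s / (1 + s) * (s / (1 + s)) \<le> 1 * min 1 s"
      using q r by (intro mult_mono) auto
    ultimately show ?thesis by simp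
  qed (simp add: w_def)
  have fin: "(\<integral>\<^sup>+x. ennreal (w (norm x)) \<partial>\<rho>) < \<infinity>" if "\<rho> \<in> levy_measures1" for \<rho> :: "(real ^ 'n) measure"
  proof -
    have "(\<integral>\<^sup>+x. ennreal (w (norm x)) \<partial>\<rho>) \<le> (\<integral>\<^sup>+x. ennreal (min 1 (norm x)) \<partial>\<rho>)"
      using w_le by (intro nn_integral_mono ennreal_leI) auto
    also have "\<dots> < \<infinity>" using that by (simp add: levy_measures1_def)
    finally show ?thesis .
  qed
  have mom: "(\<integral>\<^sup>+x. ennreal (w (norm x) * ratio (norm x) ^ j) * indicator C (dir x) \<partial>\<rho>)
     = ennreal (sqrt pi / fact (Suc j)) * (\<integral>\<^sup>+y. ennreal (norm y ^ (2 * Suc j + 1) * exp (- (norm y)\<^sup>2)) * indicator C (dir y) \<partial>A1 (Upsilon0 \<rho>))"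
    if \<rho>: "\<rho> \<in> levy_measures" and C[measurable]: "C \<in> sets borel" for \<rho> :: "(real ^ 'n) measure" and C j
  proof -
    have s: "sets \<rho> = sets borel" using \<rho> by (simp add: levy_measures_def)
    note [measurable_cong] = s
    let ?p = "laplace_kernel (2 / sqrt pi) (1 / 2) (\<lambda>r. r\<^sup>2)"
    let ?f = "\<lambda>y. ennreal (norm y ^ (2 * Suc j + 1) * exp (- (norm y)\<^sup>2)) * indicator C (dir y)"
    have "(\<integral>\<^sup>+y. ?f y \<partial>A1 (Upsilon0 \<rho>))
       = (\<integral>\<^sup>+x. (\<integral>\<^sup>+r\<in>{0<..}. ennreal (?p (norm x) r) * ?f (r *\<^sub>R dir x) \<partial>lborel) \<partial>\<rho>)"
      unfolding A1_Upsilon0_eq_ray_mixture[OF \<rho>] by (rule nn_integral_ray_mixture[OF s]) measurable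
    also have "\<dots> = (\<integral>\<^sup>+x. ennreal (fact (Suc j) / sqrt pi) * (ennreal (w (norm x) * ratio (norm x) ^ j) * indicator C (dir x)) \<partial>\<rho>)"
    proof (rule nn_integral_cong_AE)
      show "AE x in \<rho>. (\<integral>\<^sup>+r\<in>{0<..}. ennreal (?p (norm x) r) * ?f (r *\<^sub>R dir x) \<partial>lborel)
        = ennreal (fact (Suc j) / sqrt pi) * (ennreal (w (norm x) * ratio (norm x) ^ j) * indicator C (dir x))" (is "AE x in _. ?P x")
        using levy_measure_AE_nonzero[OF \<rho>]
      proof eventually_elim
        fix x :: "real ^ 'n" assume x: "x \<noteq> 0"
        have [measurable]: "?p (norm x) \<in> borel_measurable borel" unfolding laplace_kernel_def[abs_def] by measurable
        have "(\<integral>\<^sup>+r\<in>{0<..}. ennreal (?p (norm x) r) * ?f (r *\<^sub>R dir x) \<partial>lborel)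
          = (\<integral>\<^sup>+r. (ennreal (?p (norm x) r) * ennreal (r ^ (2 * Suc j + 1) * exp (- r\<^sup>2)) * indicator {0<..} r) * indicator C (dir x) \<partial>lborel)"
          by (intro nn_integral_cong)
            (simp add: norm_dir[OF x] dir_scaleR_dir[OF x] mult_ac split: split_indicator)
        also have "\<dots> = ennreal (fact (Suc j) / sqrt pi * (norm x powr (- 1 / 2) * ratio (norm x) ^ Suc (Suc j))) * indicator C (dir x)"
          using x by (subst nn_integral_multc, measurable, subst gaussian_kernel_moment) simp_all
        also have "norm x powr (- 1 / 2) * ratio (norm x) ^ Suc (Suc j) = w (norm x) * ratio (norm x) ^ j"
          by (simp add: w_def power2_eq_square)
        finally show "?P x"
          by (simp only: ennreal_mult' divide_nonneg_nonneg fact_ge_zero real_sqrt_ge_zero pi_ge_zero mult.assoc)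
      qed
    qed
    also have "\<dots> = ennreal (fact (Suc j) / sqrt pi) * (\<integral>\<^sup>+x. ennreal (w (norm x) * ratio (norm x) ^ j) * indicator C (dir x) \<partial>\<rho>)"
      by (rule nn_integral_cmult) measurable
    finally show ?thesis
      by (simp only: mult.assoc[symmetric] ennreal_mult'[symmetric] divide_nonneg_nonneg fact_ge_zero real_sqrt_ge_zero pi_ge_zero)
        simp
  qed
  show ?thesis
  proof (rule levy_measure_eqI_cone_moments[OF levy, of w])
    show "0 < w s" if "0 < s" for s using that ratio_bounds(3)[of s] by (simp add: w_def)
    fix C :: "(real ^ 'n) set" and j assume C: "C \<in> sets borel"
    show "(\<integral>\<^sup>+x. ennreal (w (norm x) * ratio (norm x) ^ j) * indicator C (dir x) \<partial>\<rho>1)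
      = (\<integral>\<^sup>+x. ennreal (w (norm x) * ratio (norm x) ^ j) * indicator C (dir x) \<partial>\<rho>2)"
      unfolding mom[OF levy(1) C] mom[OF levy(2) C] eq ..
  qed (use fin \<rho> in auto)
qed

section \<open>Disintegration\<close>

lemma ndiff_const: "0 \<le> (ndiff ^^ l) (\<lambda>_. 1) k"
proof -
  have "(ndiff ^^ l) (\<lambda>_. 1) k = (if l = 0 then 1 else 0)"
    by (induction l arbitrary: k) (simp_all add: ndiff_def)
  then show ?thesis by simp
qed

text \<open>The conditional moments are Radon--Nikodym densities; almost surely they satisfy the
  countably many inequalities of the Hausdorff moment problem, so that they are the moments of a
  conditional distribution.\<close>

lemma conditional_moment_kernel:
  fixes P :: "('a \<times> real) measure"
  assumes fin: "finite_measure P" and sP: "sets P = sets (N \<Otimes>\<^sub>M borel)"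
    and unit: "AE z in P. snd z \<in> {0..1}"
  obtains K where "K \<in> N \<rightarrow>\<^sub>M prob_algebra borel" "\<And>\<xi>. \<xi> \<in> space N \<Longrightarrow> unit_supported (K \<xi>)"
    "\<And>C k. C \<in> sets N \<Longrightarrow> (\<integral>\<^sup>+\<xi>. indicator C \<xi> * ennreal (\<integral>y. y ^ k \<partial>K \<xi>) \<partial>distr P N fst)
       = (\<integral>\<^sup>+z. indicator C (fst z) * ennreal (snd z ^ k) \<partial>P)"
proof -
  interpret P: finite_measure P by (rule fin)
  note [measurable_cong] = sP
  \<comment> \<open>Clamping makes the bounds 0 and 1 hold at every point instead of almost
    everywhere.\<close>
  define c where "c z = max 0 (min 1 (snd z))" for z :: "'a \<times> real"
  have [measurable]: "c \<in> borel_measurable (N \<Otimes>\<^sub>M borel)" unfolding c_def by measurable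
  have c: "0 \<le> c z" "c z \<le> 1" for z by (auto simp: c_def)
  define L where "L = distr P N fst"
  have sL[measurable_cong]: "sets L = sets N" by (simp add: L_def)
  interpret L: finite_measure L unfolding L_def by (rule P.finite_measure_distr) measurable
  \<comment> \<open>The set function sending C to the integral of the k-th power over fst in C. It
    is dominated by the marginal \<open>L\<close>, and its density with respect to \<open>L\<close>
    is the k-th conditional moment.\<close>
  define \<mu> where "\<mu> k = distr (density P (\<lambda>z. ennreal (c z ^ k))) N fst" for k
  have e\<mu>: "emeasure (\<mu> k) C = (\<integral>\<^sup>+z. indicator C (fst z) * ennreal (c z ^ k) \<partial>P)" if [measurable]: "C \<in> sets N" for k C
  proof -
    have "emeasure (\<mu> k) C = (\<integral>\<^sup>+\<xi>. indicator C \<xi> \<partial>\<mu> k)" using that by (simp add: \<mu>_def)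
    also have "\<dots> = (\<integral>\<^sup>+z. indicator C (fst z) \<partial>density P (\<lambda>z. ennreal (c z ^ k)))"
      unfolding \<mu>_def by (rule nn_integral_distr) measurable
    also have "\<dots> = (\<integral>\<^sup>+z. ennreal (c z ^ k) * indicator C (fst z) \<partial>P)"
      by (rule nn_integral_density) measurable
    finally show ?thesis by (simp add: mult.commute)
  qed
  have eL: "emeasure L C = (\<integral>\<^sup>+z. indicator C (fst z) \<partial>P)" if [measurable]: "C \<in> sets N" for C
    using nn_integral_distr[of fst P N "indicator C"] that by (simp add: L_def)
  have \<mu>L: "emeasure (\<mu> k) C \<le> emeasure L C" if "C \<in> sets N" for k C
    unfolding e\<mu>[OF that] eL[OF that] using c
    by (intro nn_integral_mono) (auto intro!: power_le_one split: split_indicator)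
  define h where "h k = RN_deriv L (\<mu> k)" for k
  have [measurable]: "h k \<in> borel_measurable N" for k
    unfolding h_def measurable_cong_sets[OF sL[symmetric] refl] by measurable
  have hden: "density L (h k) = \<mu> k" for k
    unfolding h_def
  proof (rule L.density_RN_deriv)
    show "absolutely_continuous L (\<mu> k)"
      unfolding absolutely_continuous_def
    proof
      fix A assume A: "A \<in> null_sets L"
      then have "A \<in> sets N" "emeasure L A = 0" by (auto simp: null_sets_def sL)
      then show "A \<in> null_sets (\<mu> k)" using \<mu>L[of A k] by (auto simp: null_sets_def \<mu>_def)
    qed
  qed (simp add: sL \<mu>_def)
  have hC: "(\<integral>\<^sup>+\<xi>. indicator C \<xi> * h k \<xi> \<partial>L) = (\<integral>\<^sup>+z. indicator C (fst z) * ennreal (c z ^ k) \<partial>P)"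
    if C[measurable]: "C \<in> sets N" for C k
    using arg_cong[OF hden[of k], of "\<lambda>M. emeasure M C"] e\<mu>[OF C, of k]
    by (simp add: emeasure_density mult.commute)
  define m where "m k \<xi> = enn2real (h k \<xi>)" for k \<xi>
  have [measurable]: "m k \<in> borel_measurable N" for k unfolding m_def by measurable
  have m0: "0 \<le> m k \<xi>" for k \<xi> by (simp add: m_def)
  have hfin: "AE \<xi> in L. ennreal (m k \<xi>) = h k \<xi>" for k
  proof -
    have "(\<integral>\<^sup>+\<xi>. h k \<xi> \<partial>L) = emeasure (density L (h k)) (space L)"
      by (simp add: emeasure_density cong: nn_integral_cong)
    also have "\<dots> \<le> emeasure L (space L)"
      unfolding hden using \<mu>L[of "space L" k] sets.top[of L] by (simp add: sL)
    finally have "(\<integral>\<^sup>+\<xi>. h k \<xi> \<partial>L) \<noteq> \<infinity>" using L.emeasure_finite[of "space L"] by (auto simp: top_unique)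
    then have "AE \<xi> in L. h k \<xi> \<noteq> \<infinity>" by (intro nn_integral_PInf_AE) auto
    then show ?thesis by eventually_elim (simp add: m_def less_top)
  qed
  have mC: "(\<integral>\<^sup>+\<xi>. indicator C \<xi> * ennreal (m k \<xi>) \<partial>L) = (\<integral>\<^sup>+z. indicator C (fst z) * ennreal (c z ^ k) \<partial>P)"
    if C: "C \<in> sets N" for C k
    unfolding hC[OF C, symmetric] by (rule nn_integral_cong_AE) (use hfin[of k] in eventually_elim, simp)
  have intc: "integrable P (\<lambda>z. indicator C (fst z) * (c z ^ k * (1 - c z) ^ l))" if [measurable]: "C \<in> sets N" for C k l
    using c by (intro P.integrable_const_bound[of _ 1])
      (auto simp: abs_mult power_abs intro!: mult_le_one power_le_one split: split_indicator)
  have intm: "integrable L (\<lambda>\<xi>. indicator C \<xi> * m k \<xi>)"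
    and eqm: "(\<integral>\<xi>. indicator C \<xi> * m k \<xi> \<partial>L) = (\<integral>z. indicator C (fst z) * c z ^ k \<partial>P)" if C[measurable]: "C \<in> sets N" for C k
  proof -
    have nn: "(\<integral>\<^sup>+\<xi>. ennreal (indicator C \<xi> * m k \<xi>) \<partial>L) = (\<integral>\<^sup>+z. ennreal (indicator C (fst z) * c z ^ k) \<partial>P)"
      using mC[OF C, of k] by (simp add: ennreal_mult' ennreal_indicator)
    also have "\<dots> = ennreal (\<integral>z. indicator C (fst z) * c z ^ k \<partial>P)"
      using intc[OF C, of k 0] c by (intro nn_integral_eq_integral) auto
    finally have nn': "(\<integral>\<^sup>+\<xi>. ennreal (indicator C \<xi> * m k \<xi>) \<partial>L) = ennreal (\<integral>z. indicator C (fst z) * c z ^ k \<partial>P)" .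
    have "has_bochner_integral L (\<lambda>\<xi>. indicator C \<xi> * m k \<xi>) (\<integral>z. indicator C (fst z) * c z ^ k \<partial>P)"
      using m0 c by (intro has_bochner_integral_nn_integral nn') auto
    then show "integrable L (\<lambda>\<xi>. indicator C \<xi> * m k \<xi>)"
      "(\<integral>\<xi>. indicator C \<xi> * m k \<xi> \<partial>L) = (\<integral>z. indicator C (fst z) * c z ^ k \<partial>P)"
      by (simp_all add: has_bochner_integral_iff)
  qed
  have [measurable]: "(\<lambda>\<xi>. (ndiff ^^ l) (\<lambda>k. m k \<xi>) k) \<in> borel_measurable N" for l k
    by (induction l arbitrary: k) (simp_all add: ndiff_def)
  \<comment> \<open>Over each C the differences of the conditional moments integrate to the integral
    of c^k * (1 - c)^l, which is nonnegative; as C is arbitrary, the differences are nonnegative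
    almost surely.\<close>
  have diff: "integrable L (\<lambda>\<xi>. indicator C \<xi> * (ndiff ^^ l) (\<lambda>k. m k \<xi>) k) \<and>
     (\<integral>\<xi>. indicator C \<xi> * (ndiff ^^ l) (\<lambda>k. m k \<xi>) k \<partial>L) = (\<integral>z. indicator C (fst z) * (c z ^ k * (1 - c z) ^ l) \<partial>P)"
    if C: "C \<in> sets N" for C l k
  proof (induction l arbitrary: k)
    case 0
    then show ?case using intm[OF C] eqm[OF C] by simp
  next
    case (Suc l)
    have "indicator C \<xi> * (ndiff ^^ Suc l) (\<lambda>k. m k \<xi>) k
       = indicator C \<xi> * (ndiff ^^ l) (\<lambda>k. m k \<xi>) k - indicator C \<xi> * (ndiff ^^ l) (\<lambda>k. m k \<xi>) (Suc k)" for \<xi>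
      by (simp add: ndiff_funpow_Suc right_diff_distrib del: funpow.simps)
    moreover have "indicator C (fst z) * (c z ^ k * (1 - c z) ^ Suc l)
       = indicator C (fst z) * (c z ^ k * (1 - c z) ^ l) - indicator C (fst z) * (c z ^ Suc k * (1 - c z) ^ l)" for z
      by (simp add: algebra_simps)
    ultimately show ?case
      using Suc.IH[of k] Suc.IH[of "Suc k"] intc[OF C, of k l] intc[OF C, of "Suc k" l]
      by (simp only: Bochner_Integration.integral_diff Bochner_Integration.integrable_diff)
  qed
  have int1: "integrable L (\<lambda>\<xi>. (ndiff ^^ l) (\<lambda>k. m k \<xi>) k)" for l k
  proof -
    have "integrable L (\<lambda>\<xi>. indicator (space N) \<xi> * (ndiff ^^ l) (\<lambda>k. m k \<xi>) k)" using diff[of "space N" l k] by simp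
    then show ?thesis
      by (rule Bochner_Integration.integrable_cong[THEN iffD1, rotated 2]) (simp_all add: sets_eq_imp_space_eq[OF sL])
  qed
  have "AE \<xi> in L. 0 \<le> (ndiff ^^ l) (\<lambda>k. m k \<xi>) k" for l k
  proof (rule L.density_nonneg[OF int1])
    fix A assume "A \<in> sets L"
    then have "set_lebesgue_integral L A (\<lambda>\<xi>. (ndiff ^^ l) (\<lambda>k. m k \<xi>) k)
        = (\<integral>z. indicator A (fst z) * (c z ^ k * (1 - c z) ^ l) \<partial>P)"
      using diff[of A l k] by (simp add: set_lebesgue_integral_def sL)
    also have "0 \<le> \<dots>" using c by (intro Bochner_Integration.integral_nonneg) auto
    finally show "0 \<le> set_lebesgue_integral L A (\<lambda>\<xi>. (ndiff ^^ l) (\<lambda>k. m k \<xi>) k)" .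
  qed
  moreover have "AE \<xi> in L. m 0 \<xi> - 1 = 0"
  proof (rule L.density_zero)
    show "integrable L (\<lambda>\<xi>. m 0 \<xi> - 1)" using int1[of 0 0] by simp
    fix A assume A: "A \<in> sets L"
    have "measure L A = (\<integral>\<xi>. indicator A \<xi> \<partial>L)" using A by simp
    also have "\<dots> = (\<integral>z. indicator A (fst z) \<partial>P)"
      unfolding L_def using A by (intro integral_distr) (auto simp: sL)
    finally have "(\<integral>\<xi>. indicator A \<xi> * m 0 \<xi> \<partial>L) = measure L A"
      using eqm[of A 0] A by (simp add: sL)
    moreover have "set_lebesgue_integral L A (\<lambda>\<xi>. m 0 \<xi> - 1) = (\<integral>\<xi>. indicator A \<xi> * m 0 \<xi> - indicator A \<xi> \<partial>L)"
      by (simp add: set_lebesgue_integral_def right_diff_distrib)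
    moreover have "\<dots> = (\<integral>\<xi>. indicator A \<xi> * m 0 \<xi> \<partial>L) - (\<integral>\<xi>. indicator A \<xi> \<partial>L)"
      using intm[of A 0] A by (intro Bochner_Integration.integral_diff) (auto simp: sL L.emeasure_finite less_top[symmetric])
    ultimately show "set_lebesgue_integral L A (\<lambda>\<xi>. m 0 \<xi> - 1) = 0" using A by simp
  qed
  ultimately have good: "AE \<xi> in L. (\<forall>l k. 0 \<le> (ndiff ^^ l) (\<lambda>k. m k \<xi>) k) \<and> m 0 \<xi> = 1"
    by (simp add: AE_all_countable)
  \<comment> \<open>On the exceptional null set the moments are replaced by those of the point mass
    at 1, so that a conditional law exists for every \<xi>.\<close>
  define m' where "m' k \<xi> = (if (\<forall>l k. 0 \<le> (ndiff ^^ l) (\<lambda>k. m k \<xi>) k) \<and> m 0 \<xi> = 1 then m k \<xi> else 1)" for k \<xi>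
  have [measurable]: "m' k \<in> borel_measurable N" for k unfolding m'_def by measurable
  have "\<exists>M. prob_space M \<and> unit_supported M \<and> (\<forall>k. (\<integral>y. y ^ k \<partial>M) = m' k \<xi>)" for \<xi>
  proof -
    have "(\<forall>l k. 0 \<le> (ndiff ^^ l) (\<lambda>k. m' k \<xi>) k) \<and> m' 0 \<xi> = 1"
    proof (cases "(\<forall>l k. 0 \<le> (ndiff ^^ l) (\<lambda>k. m k \<xi>) k) \<and> m 0 \<xi> = 1")
      case True
      then have "m' k \<xi> = m k \<xi>" for k unfolding m'_def by (rule if_P)
      with True show ?thesis by (simp only:) blast
    next
      case False
      then have "m' k \<xi> = 1" for k unfolding m'_def by (rule if_not_P)
      then show ?thesis using ndiff_const by (simp only:) blast
    qed
    then have "\<And>l k. 0 \<le> (ndiff ^^ l) (\<lambda>k. m' k \<xi>) k" "m' 0 \<xi> = 1" by blast+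
    from hausdorff_moment_existence[of "\<lambda>k. m' k \<xi>", OF this] show ?thesis by metis
  qed
  then obtain K where K: "\<And>\<xi>. prob_space (K \<xi>)" "\<And>\<xi>. unit_supported (K \<xi>)"
    and mom: "\<And>\<xi> k. (\<integral>y. y ^ k \<partial>K \<xi>) = m' k \<xi>" by metis
  show thesis
  proof (rule that)
    show "K \<in> N \<rightarrow>\<^sub>M prob_algebra borel"
      using K by (intro unit_supported_kernel) (simp_all add: mom)
    show "unit_supported (K \<xi>)" for \<xi> by (rule K)
    fix C k assume C: "C \<in> sets N"
    have "(\<integral>\<^sup>+\<xi>. indicator C \<xi> * ennreal (\<integral>y. y ^ k \<partial>K \<xi>) \<partial>L) = (\<integral>\<^sup>+\<xi>. indicator C \<xi> * ennreal (m k \<xi>) \<partial>L)"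
      unfolding mom by (rule nn_integral_cong_AE) (use good in eventually_elim, simp add: m'_def)
    also have "\<dots> = (\<integral>\<^sup>+z. indicator C (fst z) * ennreal (snd z ^ k) \<partial>P)"
      unfolding mC[OF C] by (rule nn_integral_cong_AE) (use unit in eventually_elim, simp add: c_def)
    finally show "(\<integral>\<^sup>+\<xi>. indicator C \<xi> * ennreal (\<integral>y. y ^ k \<partial>K \<xi>) \<partial>distr P N fst)
       = (\<integral>\<^sup>+z. indicator C (fst z) * ennreal (snd z ^ k) \<partial>P)" unfolding L_def .
  qed
qed

lemma measurable_kernel_nn_integral:
  assumes K: "K \<in> N \<rightarrow>\<^sub>M prob_algebra M" and f: "case_prod f \<in> borel_measurable (N \<Otimes>\<^sub>M M)"
  shows "(\<lambda>x. \<integral>\<^sup>+y. f x y \<partial>K x) \<in> borel_measurable N"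
  using nn_integral_measurable_subprob_algebra2[OF f measurable_prob_algebraD[OF K]] .

lemma kernel_sets: "K \<in> N \<rightarrow>\<^sub>M prob_algebra M \<Longrightarrow> x \<in> space N \<Longrightarrow> sets (K x) = sets M"
  using measurable_space[of K N "prob_algebra M" x] by (simp add: space_prob_algebra)

lemma kernel_prob_space: "K \<in> N \<rightarrow>\<^sub>M prob_algebra M \<Longrightarrow> x \<in> space N \<Longrightarrow> prob_space (K x)"
  using measurable_space[of K N "prob_algebra M" x] by (simp add: space_prob_algebra)

text \<open>The moments of the kernel determine the law of the second coordinate over every set C of
  first coordinates, and hence \<open>P\<close> on rectangles. The set \<open>E\<close> upgrades an
  almost sure support condition to one valid for every \<xi>, as needed when each single ray must
  satisfy it.\<close>

theorem disintegration:
  fixes P :: "('a \<times> real) measure"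
  assumes fin: "finite_measure P" and sP: "sets P = sets (N \<Otimes>\<^sub>M borel)"
    and unit: "AE z in P. snd z \<in> {0..1}" and E: "E \<in> sets borel" "e \<in> E" "AE z in P. snd z \<in> E"
  obtains K where "K \<in> N \<rightarrow>\<^sub>M prob_algebra borel" "\<And>\<xi>. \<xi> \<in> space N \<Longrightarrow> AE y in K \<xi>. y \<in> E"
    "\<And>f. f \<in> borel_measurable (N \<Otimes>\<^sub>M borel) \<Longrightarrow>
       (\<integral>\<^sup>+z. f z \<partial>P) = (\<integral>\<^sup>+\<xi>. \<integral>\<^sup>+y. f (\<xi>, y) \<partial>K \<xi> \<partial>distr P N fst)"
proof -
  interpret P: finite_measure P by (rule fin)
  note [measurable_cong] = sP
  define L where "L = distr P N fst"
  have sL[measurable_cong]: "sets L = sets N" by (simp add: L_def)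
  have spL: "space L = space N" by (simp add: L_def)
  obtain K where K[measurable]: "K \<in> N \<rightarrow>\<^sub>M prob_algebra borel" and unitK: "\<And>\<xi>. \<xi> \<in> space N \<Longrightarrow> unit_supported (K \<xi>)"
    and mom: "\<And>C k. C \<in> sets N \<Longrightarrow> (\<integral>\<^sup>+\<xi>. indicator C \<xi> * ennreal (\<integral>y. y ^ k \<partial>K \<xi>) \<partial>L)
       = (\<integral>\<^sup>+z. indicator C (fst z) * ennreal (snd z ^ k) \<partial>P)"
    using conditional_moment_kernel[OF fin sP unit] unfolding L_def by blast
  note sK = kernel_sets[OF K]
  have measK: "(\<lambda>\<xi>. emeasure (K \<xi>) B) \<in> borel_measurable N" if "B \<in> sets borel" for B
  proof -
    have "(\<lambda>\<xi>. \<integral>\<^sup>+y. indicator B y \<partial>K \<xi>) \<in> borel_measurable N"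
      using that by (intro measurable_kernel_nn_integral[OF K]) simp
    then show ?thesis using that by (simp add: sK cong: measurable_cong)
  qed
  have rect: "(\<integral>\<^sup>+z. indicator C (fst z) * indicator B (snd z) \<partial>P) = (\<integral>\<^sup>+\<xi>. indicator C \<xi> * emeasure (K \<xi>) B \<partial>L)"
    if C[measurable]: "C \<in> sets N" and B: "B \<in> sets borel" for C B
  proof -
    \<comment> \<open>For fixed C the law \<open>R\<close> of the second coordinate under
      \<open>P\<close> restricted to C is compared with the mixture \<open>S\<close> of the kernel
      over C. Both live on [0, 1] and have the same moments.\<close>
    define R where "R = distr (density P (\<lambda>z. indicator C (fst z))) borel snd"
    have nnR: "(\<integral>\<^sup>+y. f y \<partial>R) = (\<integral>\<^sup>+z. indicator C (fst z) * f (snd z) \<partial>P)"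
      if [measurable]: "f \<in> borel_measurable borel" for f
      unfolding R_def by (simp add: nn_integral_distr nn_integral_density)
    obtain S where sS: "sets S = sets borel"
      and nnS': "\<And>f. f \<in> borel_measurable borel \<Longrightarrow> (\<integral>\<^sup>+y. f y \<partial>S) = (\<integral>\<^sup>+\<xi>. \<integral>\<^sup>+y. f y \<partial>K \<xi> \<partial>density L (indicator C))"
      by (rule kernel_mixture_exists[of "density L (indicator C)" K borel])
        (simp_all add: sK spL measK measurable_cong_sets[OF sL refl])
    have nnS: "(\<integral>\<^sup>+y. f y \<partial>S) = (\<integral>\<^sup>+\<xi>. indicator C \<xi> * (\<integral>\<^sup>+y. f y \<partial>K \<xi>) \<partial>L)"
      if f[measurable]: "f \<in> borel_measurable borel" for f
      unfolding nnS'[OF f]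
      using measurable_kernel_nn_integral[OF K, of "\<lambda>\<xi> y. f y"] by (subst nn_integral_density) auto
    have powK: "(\<integral>\<^sup>+y. ennreal (y ^ k) \<partial>K \<xi>) = ennreal (\<integral>y. y ^ k \<partial>K \<xi>)" if "\<xi> \<in> space N" for \<xi> k
    proof -
      interpret K: finite_measure "K \<xi>" using unitK[OF that] by (simp add: unit_supported_def)
      note [measurable_cong] = sK[OF that]
      have ae: "AE y in K \<xi>. 0 \<le> y \<and> y \<le> 1" using unitK[OF that] by (simp add: unit_supported_def)
      have "integrable (K \<xi>) (\<lambda>y. y ^ k)"
        by (rule K.integrable_const_bound[of _ 1], use ae in eventually_elim) (auto intro!: power_le_one)
      moreover have "AE y in K \<xi>. 0 \<le> y ^ k" using ae by eventually_elim simp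
      ultimately show ?thesis by (rule nn_integral_eq_integral)
    qed
    have powS: "(\<integral>\<^sup>+y. ennreal (y ^ k) \<partial>S) = (\<integral>\<^sup>+y. ennreal (y ^ k) \<partial>R)" for k
    proof -
      have "(\<integral>\<^sup>+y. ennreal (y ^ k) \<partial>S) = (\<integral>\<^sup>+\<xi>. indicator C \<xi> * (\<integral>\<^sup>+y. ennreal (y ^ k) \<partial>K \<xi>) \<partial>L)"
        by (rule nnS) measurable
      also have "\<dots> = (\<integral>\<^sup>+\<xi>. indicator C \<xi> * ennreal (\<integral>y. y ^ k \<partial>K \<xi>) \<partial>L)"
        by (intro nn_integral_cong) (simp add: powK spL)
      also have "\<dots> = (\<integral>\<^sup>+z. indicator C (fst z) * ennreal (snd z ^ k) \<partial>P)" by (rule mom[OF C])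
      also have "\<dots> = (\<integral>\<^sup>+y. ennreal (y ^ k) \<partial>R)" by (rule nnR[symmetric]) measurable
      finally show ?thesis .
    qed
    have unitR: "AE y in R. y \<in> {0..1}"
    proof -
      have "AE z in density P (\<lambda>z. indicator C (fst z)). snd z \<in> {0..1}"
        by (subst AE_density, measurable, use unit in eventually_elim) simp
      then show ?thesis unfolding R_def by (subst AE_distr_iff) simp_all
    qed
    have unitS: "AE y in S. y \<in> {0..1}"
    proof -
      have "emeasure S (- {0..1}) = (\<integral>\<^sup>+y. indicator (- {0..1}) y \<partial>S)" using sS by simp
      also have "\<dots> = (\<integral>\<^sup>+\<xi>. indicator C \<xi> * (\<integral>\<^sup>+y. indicator (- {0..1}) y \<partial>K \<xi>) \<partial>L)" by (rule nnS) measurable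
      also have "\<dots> = (\<integral>\<^sup>+\<xi>. 0 \<partial>L)"
      proof (rule nn_integral_cong)
        fix \<xi> assume "\<xi> \<in> space L"
        then have \<xi>: "\<xi> \<in> space N" by (simp add: spL)
        have ae: "AE y in K \<xi>. y \<in> {0..1}" using unitK[OF \<xi>] unfolding unit_supported_def by blast
        have "(\<integral>\<^sup>+y. indicator (- {0..1}) y \<partial>K \<xi>) = (\<integral>\<^sup>+y. 0 \<partial>K \<xi>)"
          by (rule nn_integral_cong_AE, use ae in eventually_elim) simp
        then show "indicator C \<xi> * (\<integral>\<^sup>+y. indicator (- {0..1}) y \<partial>K \<xi>) = 0" by simp
      qed
      finally show ?thesis by (intro AE_I[of _ _ "- {0..1}"]) (auto simp: sS)
    qed
    have finR: "(\<integral>\<^sup>+y. ennreal (y ^ 0) \<partial>R) < \<infinity>"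
    proof -
      have "(\<integral>\<^sup>+y. ennreal (y ^ 0) \<partial>R) = (\<integral>\<^sup>+z. indicator C (fst z) * ennreal (snd z ^ 0) \<partial>P)" by (rule nnR) measurable
      also have "\<dots> \<le> (\<integral>\<^sup>+z. 1 \<partial>P)" by (intro nn_integral_mono) (auto split: split_indicator)
      also have "\<dots> < \<infinity>" by (simp add: P.emeasure_finite less_top[symmetric])
      finally show ?thesis .
    qed
    have "R = S"
    proof (rule unit_supported_eqI)
      have "finite_measure R" using finR by (intro finite_measureI) simp
      moreover have "sets R = sets borel" by (simp add: R_def)
      ultimately show "unit_supported R" using unitR unfolding unit_supported_def by blast
      have "finite_measure S" using finR unfolding powS[symmetric] by (intro finite_measureI) simp
      then show "unit_supported S" using unitS sS unfolding unit_supported_def by blast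
      note [measurable_cong] = sS
      have [measurable_cong]: "sets R = sets borel" by (simp add: R_def)
      have enn: "(\<integral>y. y ^ k \<partial>M) = enn2real (\<integral>\<^sup>+y. ennreal (y ^ k) \<partial>M)"
        if [measurable_cong]: "sets M = sets borel" and "AE y in M. y \<in> {0..1}" for M :: "real measure" and k
        by (rule integral_eq_nn_integral, measurable, use that(2) in eventually_elim) simp
      show "(\<integral>y. y ^ k \<partial>R) = (\<integral>y. y ^ k \<partial>S)" for k
        using enn[OF _ unitR, of k] enn[OF sS unitS, of k] powS[of k] by (simp add: R_def)
    qed
    then have "(\<integral>\<^sup>+z. indicator C (fst z) * indicator B (snd z) \<partial>P)
        = (\<integral>\<^sup>+\<xi>. indicator C \<xi> * (\<integral>\<^sup>+y. indicator B y \<partial>K \<xi>) \<partial>L)"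
      using B nnR[of "indicator B"] nnS[of "indicator B"] by simp
    also have "\<dots> = (\<integral>\<^sup>+\<xi>. indicator C \<xi> * emeasure (K \<xi>) B \<partial>L)"
      using B by (intro nn_integral_cong) (simp add: spL sK)
    finally show ?thesis .
  qed
  \<comment> \<open>Conditional laws charging the complement of \<open>E\<close> are replaced by the
    point mass at e. This concerns a null set of \<xi> only, but makes the support condition hold
    for all \<xi>.\<close>
  define K' where "K' \<xi> = (if emeasure (K \<xi>) (- E) = 0 then K \<xi> else return borel e)" for \<xi>
  have K'[measurable]: "K' \<in> N \<rightarrow>\<^sub>M prob_algebra borel"
    unfolding K'_def
  proof (rule measurable_If[OF K])
    show "(\<lambda>_. return borel e) \<in> N \<rightarrow>\<^sub>M prob_algebra borel"
      by (rule measurable_const) (simp add: space_prob_algebra prob_space_return)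
    have "(\<lambda>\<xi>. emeasure (K \<xi>) (- E)) -` {0} \<inter> space N \<in> sets N"
      using measK[of "- E"] E by (intro measurable_sets) auto
    then show "{\<xi> \<in> space N. emeasure (K \<xi>) (- E) = 0} \<in> sets N"
      by (rule back_subst[of "\<lambda>A. A \<in> sets N"]) auto
  qed
  have K'K: "AE \<xi> in L. K' \<xi> = K \<xi>"
  proof -
    have "(\<integral>\<^sup>+\<xi>. emeasure (K \<xi>) (- E) \<partial>L) = (\<integral>\<^sup>+\<xi>. indicator (space N) \<xi> * emeasure (K \<xi>) (- E) \<partial>L)"
      by (intro nn_integral_cong) (simp add: spL)
    also have "\<dots> = (\<integral>\<^sup>+z. indicator (space N) (fst z) * indicator (- E) (snd z) \<partial>P)"
      using E by (intro rect[symmetric]) auto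
    also have "\<dots> = (\<integral>\<^sup>+z. 0 \<partial>P)"
      by (rule nn_integral_cong_AE) (use E(3) in eventually_elim, simp)
    finally have "(\<integral>\<^sup>+\<xi>. emeasure (K \<xi>) (- E) \<partial>L) = 0" by simp
    moreover have "(\<lambda>\<xi>. emeasure (K \<xi>) (- E)) \<in> borel_measurable L"
      using measK[of "- E"] E by (simp add: measurable_cong_sets[OF sL refl])
    ultimately have "AE \<xi> in L. emeasure (K \<xi>) (- E) = 0"
      by (simp only: nn_integral_0_iff_AE)
    then show ?thesis by eventually_elim (simp add: K'_def)
  qed
  show thesis
  proof (rule that[OF K'])
    fix \<xi> assume \<xi>: "\<xi> \<in> space N"
    show "AE y in K' \<xi>. y \<in> E"
    proof (cases "emeasure (K \<xi>) (- E) = 0")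
      case True
      then have "AE y in K \<xi>. y \<in> E" using E sK[OF \<xi>] by (intro AE_I[of _ _ "- E"]) auto
      moreover have "K' \<xi> = K \<xi>" using True by (simp add: K'_def)
      ultimately show ?thesis by (simp only:)
    next
      case False
      then have "K' \<xi> = return borel e" by (simp add: K'_def)
      moreover have "AE y in return borel e. y \<in> E" using E by (subst AE_return) auto
      ultimately show ?thesis by (simp only:)
    qed
  next
    fix f :: "'a \<times> real \<Rightarrow> ennreal" assume f[measurable]: "f \<in> borel_measurable (N \<Otimes>\<^sub>M borel)"
    define J where "J \<xi> = distr (K' \<xi>) (N \<Otimes>\<^sub>M borel) (Pair \<xi>)" for \<xi>
    note sK' = kernel_sets[OF K']
    have pairK: "Pair \<xi> \<in> K' \<xi> \<rightarrow>\<^sub>M N \<Otimes>\<^sub>M borel" if "\<xi> \<in> space N" for \<xi>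
      using that by (simp add: measurable_cong_sets[OF sK'[OF that] refl])
    have nnJ: "(\<integral>\<^sup>+z. f z \<partial>J \<xi>) = (\<integral>\<^sup>+y. f (\<xi>, y) \<partial>K' \<xi>)"
      if "\<xi> \<in> space N" "f \<in> borel_measurable (N \<Otimes>\<^sub>M borel)" for \<xi> f
      unfolding J_def using that pairK by (subst nn_integral_distr) auto
    have eJ: "emeasure (J \<xi>) A = (\<integral>\<^sup>+y. indicator A (\<xi>, y) \<partial>K' \<xi>)"
      if "\<xi> \<in> space N" "A \<in> sets (N \<Otimes>\<^sub>M borel)" for \<xi> A
      using nnJ[of \<xi> "indicator A"] that by (simp add: J_def)
    have measJ: "(\<lambda>\<xi>. emeasure (J \<xi>) A) \<in> borel_measurable L" if A[measurable]: "A \<in> sets (N \<Otimes>\<^sub>M borel)" for A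
    proof -
      have "(\<lambda>\<xi>. \<integral>\<^sup>+y. indicator A (\<xi>, y) \<partial>K' \<xi>) \<in> borel_measurable N"
        by (rule measurable_kernel_nn_integral[OF K']) simp
      also have "?this \<longleftrightarrow> (\<lambda>\<xi>. emeasure (J \<xi>) A) \<in> borel_measurable N"
        by (intro measurable_cong) (simp only: eJ[OF _ A])
      finally show ?thesis by (simp only: measurable_cong_sets[OF sL refl])
    qed
    obtain Q where sQ: "sets Q = sets (N \<Otimes>\<^sub>M borel)"
      and nnQ: "\<And>f. f \<in> borel_measurable (N \<Otimes>\<^sub>M borel) \<Longrightarrow> (\<integral>\<^sup>+z. f z \<partial>Q) = (\<integral>\<^sup>+\<xi>. \<integral>\<^sup>+z. f z \<partial>J \<xi> \<partial>L)"
      by (rule kernel_mixture_exists[of L J "N \<Otimes>\<^sub>M borel"]) (auto simp: J_def[abs_def] measJ[unfolded J_def])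
    have "P = Q"
    proof (rule pair_measure_rect_eqI[OF fin sP sQ])
      fix C :: "'a set" and B :: "real set" assume C[measurable]: "C \<in> sets N" and B[measurable]: "B \<in> sets borel"
      have "emeasure Q (C \<times> B) = (\<integral>\<^sup>+z. indicator (C \<times> B) z \<partial>Q)" using sQ by simp
      also have "\<dots> = (\<integral>\<^sup>+\<xi>. \<integral>\<^sup>+z. indicator (C \<times> B) z \<partial>J \<xi> \<partial>L)" by (rule nnQ) measurable
      also have "\<dots> = (\<integral>\<^sup>+\<xi>. indicator C \<xi> * emeasure (K \<xi>) B \<partial>L)"
      proof (rule nn_integral_cong_AE)
        show "AE \<xi> in L. (\<integral>\<^sup>+z. indicator (C \<times> B) z \<partial>J \<xi>) = indicator C \<xi> * emeasure (K \<xi>) B" (is "AE \<xi> in _. ?P \<xi>")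
          using K'K AE_space
        proof eventually_elim
          fix \<xi> assume k: "K' \<xi> = K \<xi>" and "\<xi> \<in> space L"
          then have \<xi>: "\<xi> \<in> space N" by (simp add: spL)
          have "(\<integral>\<^sup>+z. indicator (C \<times> B) z \<partial>J \<xi>) = (\<integral>\<^sup>+y. indicator (C \<times> B) (\<xi>, y) \<partial>K \<xi>)"
            using nnJ[OF \<xi>, of "indicator (C \<times> B)"] by (simp add: k)
          also have "\<dots> = (\<integral>\<^sup>+y. indicator C \<xi> * indicator B y \<partial>K \<xi>)"
            by (intro nn_integral_cong) (auto split: split_indicator)
          also have "\<dots> = indicator C \<xi> * emeasure (K \<xi>) B"
            using sK[OF \<xi>] by (subst nn_integral_cmult) (auto cong: measurable_cong_sets)
          finally show "?P \<xi>" .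
        qed
      qed
      also have "\<dots> = (\<integral>\<^sup>+z. indicator C (fst z) * indicator B (snd z) \<partial>P)" by (rule rect[OF C B, symmetric])
      also have "\<dots> = (\<integral>\<^sup>+z. indicator (C \<times> B) z \<partial>P)"
        by (intro nn_integral_cong) (auto split: split_indicator)
      finally show "emeasure P (C \<times> B) = emeasure Q (C \<times> B)" using sP by simp
    qed
    then have "(\<integral>\<^sup>+z. f z \<partial>P) = (\<integral>\<^sup>+\<xi>. \<integral>\<^sup>+z. f z \<partial>J \<xi> \<partial>L)" using nnQ[OF f] by simp
    also have "\<dots> = (\<integral>\<^sup>+\<xi>. \<integral>\<^sup>+y. f (\<xi>, y) \<partial>K' \<xi> \<partial>L)"
      by (intro nn_integral_cong nnJ) (simp_all add: spL)
    finally show "(\<integral>\<^sup>+z. f z \<partial>P) = (\<integral>\<^sup>+\<xi>. \<integral>\<^sup>+y. f (\<xi>, y) \<partial>K' \<xi> \<partial>distr P N fst)" unfolding L_def .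
  qed
qed

section \<open>Laplace mixtures and completely monotone radial densities\<close>

text \<open>Differentiation under the integral. Powers of \<open>T\<close> stay integrable because T
  * exp (- d T) <= 1 / d: each factor \<open>T\<close> is paid for with half of the current
  exponent, and u > 0 is arbitrary.\<close>

lemma laplace_integral_completely_monotone:
  fixes W T :: "'a \<Rightarrow> real"
  assumes [measurable]: "W \<in> borel_measurable Q" "T \<in> borel_measurable Q"
    and W: "\<And>y. 0 \<le> W y" and T: "\<And>y. 0 \<le> T y"
    and int: "\<And>u. 0 < u \<Longrightarrow> integrable Q (\<lambda>y. W y * exp (- u * T y))"
  shows "completely_monotone (\<lambda>u. \<integral>y. W y * exp (- u * T y) \<partial>Q)"
proof -
  have texp: "T y * exp (- d * T y) \<le> 1 / d" if "0 < d" for d y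
  proof -
    have "d * T y \<le> exp (d * T y)" using exp_ge_add_one_self[of "d * T y"] by linarith
    then have "d * T y * exp (- d * T y) \<le> exp (d * T y) * exp (- d * T y)" by (intro mult_right_mono) auto
    also have "\<dots> = 1" by (simp add: exp_add[symmetric])
    finally show ?thesis using that by (simp add: field_simps)
  qed
  have intk: "integrable Q (\<lambda>y. T y ^ k * (W y * exp (- u * T y)))" if "0 < u" for k u
    using that
  proof (induction k arbitrary: u)
    case (Suc k)
    show ?case
    proof (rule Bochner_Integration.integrable_bound)
      show "integrable Q (\<lambda>y. 2 / u * (T y ^ k * (W y * exp (- (u / 2) * T y))))"
        using Suc.IH[of "u / 2"] Suc.prems by (intro integrable_mult_right) simp
      show "AE y in Q. norm (T y ^ Suc k * (W y * exp (- u * T y))) \<le> norm (2 / u * (T y ^ k * (W y * exp (- (u / 2) * T y))))" (is "AE y in _. ?P y")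
      proof (rule AE_I2)
        fix y
        have e: "exp (- u * T y) = exp (- (u / 2) * T y) * exp (- (u / 2) * T y)"
          by (simp add: exp_add[symmetric] field_simps)
        have "T y ^ Suc k * (W y * exp (- u * T y)) = (T y * exp (- (u / 2) * T y)) * (T y ^ k * (W y * exp (- (u / 2) * T y)))"
          unfolding e by (simp only: power_Suc mult_ac)
        also have "\<dots> \<le> 1 / (u / 2) * (T y ^ k * (W y * exp (- (u / 2) * T y)))"
          using texp[of "u / 2" y] Suc.prems W T by (intro mult_right_mono) auto
        finally have "T y ^ Suc k * (W y * exp (- u * T y)) \<le> 2 / u * (T y ^ k * (W y * exp (- (u / 2) * T y)))" by simp
        moreover have "0 \<le> T y ^ Suc k * (W y * exp (- u * T y))" using W T by simp
        ultimately show "?P y"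
          by (simp only: real_norm_def)
      qed
    qed simp
  qed (use int in simp)
  define F where "F k u = (\<integral>y. (- T y) ^ k * (W y * exp (- u * T y)) \<partial>Q)" for k u
  have intF: "integrable Q (\<lambda>y. (- T y) ^ k * (W y * exp (- u * T y)))" if "0 < u" for k u
    using integrable_mult_right[OF intk[OF that, of k], of "(- 1) ^ k"]
    by (simp add: power_minus[of "T _"] mult.assoc)
  have exp_diff_bound: "\<bar>exp a - exp b\<bar> \<le> \<bar>a - b\<bar> * exp (max a b)" for a b :: real
  proof -
    have *: "\<bar>exp a - exp b\<bar> \<le> \<bar>a - b\<bar> * exp a" if "b \<le> a" for a b :: real
    proof -
      have "1 - exp (b - a) \<le> a - b" using exp_ge_add_one_self[of "b - a"] by linarith
      then have "exp a * (1 - exp (b - a)) \<le> exp a * (a - b)" by (intro mult_left_mono) auto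
      also have "exp a * (1 - exp (b - a)) = exp a - exp b" by (simp add: right_diff_distrib exp_add[symmetric])
      finally show ?thesis using that by (simp add: mult.commute)
    qed
    show ?thesis using *[of b a] *[of a b] by (cases "b \<le> a") (auto simp: abs_minus_commute max_def)
  qed
  have der: "(F k has_real_derivative F (Suc k) u) (at u)" if u: "0 < u" for k u
    unfolding DERIV_def tendsto_at_iff_sequentially
  proof (intro allI impI)
    fix X :: "nat \<Rightarrow> real" assume X: "\<forall>i. X i \<in> UNIV - {0}" and X0: "X \<longlonglongrightarrow> 0"
    obtain N where N: "\<And>i. N \<le> i \<Longrightarrow> \<bar>X i\<bar> < u / 2"
      using LIMSEQ_D[OF X0, of "u / 2"] u by auto
    \<comment> \<open>On the tail the increments are below u / 2, so all exponents stay above u / 2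
      and one dominating function serves the whole sequence of difference quotients.\<close>
    define Y where "Y i = X (i + N)" for i
    have Y: "Y i \<noteq> 0" "\<bar>Y i\<bar> < u / 2" for i using X N[of "i + N"] by (auto simp: Y_def)
    have Y0: "Y \<longlonglongrightarrow> 0" unfolding Y_def using X0 by (rule LIMSEQ_ignore_initial_segment)
    have uY: "0 < u + Y i" for i using Y(2)[of i] by linarith
    let ?D = "\<lambda>i y. ((- T y) ^ k * (W y * exp (- (u + Y i) * T y)) - (- T y) ^ k * (W y * exp (- u * T y))) / Y i"
    have quot: "(F k (u + Y i) - F k u) / Y i = (\<integral>y. ?D i y \<partial>Q)" for i
      unfolding F_def using intF[OF uY] intF[OF u] by simp
    have "(\<lambda>i. \<integral>y. ?D i y \<partial>Q) \<longlonglongrightarrow> (\<integral>y. (- T y) ^ Suc k * (W y * exp (- u * T y)) \<partial>Q)"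
    proof (rule integral_dominated_convergence[where w = "\<lambda>y. T y ^ Suc k * (W y * exp (- (u / 2) * T y))"])
      show "integrable Q (\<lambda>y. T y ^ Suc k * (W y * exp (- (u / 2) * T y)))" using u by (intro intk) simp
      show "AE y in Q. (\<lambda>i. ?D i y) \<longlonglongrightarrow> (- T y) ^ Suc k * (W y * exp (- u * T y))" (is "AE y in _. ?P y")
      proof (rule AE_I2)
        fix y
        have "((\<lambda>v. (- T y) ^ k * (W y * exp (- v * T y))) has_real_derivative (- T y) ^ k * (W y * (exp (- u * T y) * (- T y)))) (at u)"
          by (auto intro!: derivative_eq_intros)
        then have "(\<lambda>h. ((- T y) ^ k * (W y * exp (- (u + h) * T y)) - (- T y) ^ k * (W y * exp (- u * T y))) / h) \<midarrow>0\<rightarrow> (- T y) ^ k * (W y * (exp (- u * T y) * (- T y)))"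
          unfolding DERIV_def .
        then have "(\<lambda>i. ?D i y) \<longlonglongrightarrow> (- T y) ^ k * (W y * (exp (- u * T y) * (- T y)))"
          unfolding tendsto_at_iff_sequentially using Y0 Y(1) by (auto simp: o_def)
        then show "?P y"
          by (simp only: power_Suc mult_ac)
      qed
      show "AE y in Q. norm (?D i y) \<le> T y ^ Suc k * (W y * exp (- (u / 2) * T y))" (is "AE y in _. ?P y") for i
      proof (rule AE_I2)
        fix y
        have "\<bar>exp (- (u + Y i) * T y) - exp (- u * T y)\<bar> \<le> \<bar>- (u + Y i) * T y - - u * T y\<bar> * exp (max (- (u + Y i) * T y) (- u * T y))"
          by (rule exp_diff_bound)
        also have "\<dots> = \<bar>Y i\<bar> * T y * exp (max (- (u + Y i) * T y) (- u * T y))"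
          using T[of y] by (simp add: algebra_simps abs_mult)
        also have "\<dots> \<le> \<bar>Y i\<bar> * T y * exp (- (u / 2) * T y)"
        proof -
          have "- (u + Y i) * T y \<le> - (u / 2) * T y" "- u * T y \<le> - (u / 2) * T y"
            using Y(2)[of i] T[of y] u by (intro mult_right_mono; linarith)+
          then show ?thesis using T by (intro mult_left_mono) auto
        qed
        finally have b: "\<bar>exp (- (u + Y i) * T y) - exp (- u * T y)\<bar> \<le> \<bar>Y i\<bar> * T y * exp (- (u / 2) * T y)" .
        have "?D i y = (- T y) ^ k * W y * (exp (- (u + Y i) * T y) - exp (- u * T y)) / Y i"
          by (simp add: right_diff_distrib mult.assoc)
        then have "norm (?D i y) = T y ^ k * W y * \<bar>exp (- (u + Y i) * T y) - exp (- u * T y)\<bar> / \<bar>Y i\<bar>"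
          using T W by (simp only: real_norm_def abs_divide abs_mult power_abs abs_minus abs_of_nonneg)
        also have "\<dots> \<le> T y ^ k * W y * (\<bar>Y i\<bar> * T y * exp (- (u / 2) * T y)) / \<bar>Y i\<bar>"
          using T W b by (intro divide_right_mono mult_left_mono) auto
        also have "\<dots> = T y ^ Suc k * (W y * exp (- (u / 2) * T y))"
          using Y(1)[of i] by simp
        finally show "?P y" .
      qed
    qed measurable
    then have "(\<lambda>i. (F k (u + Y i) - F k u) / Y i) \<longlonglongrightarrow> F (Suc k) u"
      unfolding quot F_def[of "Suc k"] .
    then have "(\<lambda>i. ((\<lambda>h. (F k (u + h) - F k u) / h) \<circ> X) (i + N)) \<longlonglongrightarrow> F (Suc k) u"
      by (simp add: Y_def o_def)
    then show "((\<lambda>h. (F k (u + h) - F k u) / h) \<circ> X) \<longlonglongrightarrow> F (Suc k) u"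
      by (rule LIMSEQ_offset)
  qed
  show ?thesis
  proof (rule completely_monotoneI[of F])
    show "(\<integral>y. W y * exp (- u * T y) \<partial>Q) = F 0 u" for u by (simp add: F_def)
    fix k and u :: real
    have "(- 1) ^ k * F k u = (\<integral>y. T y ^ k * (W y * exp (- u * T y)) \<partial>Q)"
      unfolding F_def integral_mult_right_zero[symmetric]
      by (intro Bochner_Integration.integral_cong) (simp_all add: power_minus[of "T _"] mult.assoc[symmetric])
    also have "0 \<le> \<dots>" using W T by (intro Bochner_Integration.integral_nonneg) auto
    finally show "0 \<le> (- 1) ^ k * F k u" .
  qed (rule der)
qed

text \<open>A polar decomposition wants a measure living on the sphere itself and radial measures
  that never vanish. Here the spherical part may be built on the whole space if it is concentrated
  on the sphere, and strict positivity of h secures positive radial mass.\<close>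

lemma has_radial_densityI:
  fixes \<nu> \<Lambda> :: "(real ^ 'n) measure"
  assumes \<Lambda>: "sets \<Lambda> = sets borel" and sph: "AE \<xi> in \<Lambda>. \<xi> \<in> sphere 0 1"
    and h: "(\<lambda>(\<xi>, r). ennreal (h \<xi> r)) \<in> borel_measurable (borel \<Otimes>\<^sub>M borel)"
    and pos: "\<And>\<xi> r. \<xi> \<in> sphere 0 1 \<Longrightarrow> 0 < r \<Longrightarrow> 0 < h \<xi> r"
    and eq: "\<And>B. B \<in> sets borel \<Longrightarrow>
      emeasure \<nu> B = (\<integral>\<^sup>+\<xi>. (\<integral>\<^sup>+r\<in>{0<..}. ennreal (h \<xi> r) * indicator B (r *\<^sub>R \<xi>) \<partial>lborel) \<partial>\<Lambda>)"
  shows "has_radial_density \<nu> h"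
proof -
  let ?S = "sphere 0 1 :: (real ^ 'n) set"
  note [measurable_cong] = \<Lambda> and [measurable] = h
  define \<Lambda>' where "\<Lambda>' = restrict_space \<Lambda> ?S"
  define \<kappa> where "\<kappa> \<xi> = density (restrict_space lborel {0<..}) (\<lambda>r. ennreal (h \<xi> r))" for \<xi>
  have [measurable]: "?S \<in> sets borel" by simp
  have sets\<Lambda>': "sets \<Lambda>' = sets (restrict_space borel ?S)"
    unfolding \<Lambda>'_def by (rule sets_restrict_space_cong[OF \<Lambda>])
  have h\<xi>[measurable]: "(\<lambda>r. ennreal (h \<xi> r)) \<in> borel_measurable borel" for \<xi>
    using measurable_compose[OF measurable_Pair1' h, of \<xi>] by simp
  have nn\<kappa>: "(\<integral>\<^sup>+r. f r \<partial>\<kappa> \<xi>) = (\<integral>\<^sup>+r\<in>{0<..}. ennreal (h \<xi> r) * f r \<partial>lborel)"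
    if [measurable]: "f \<in> borel_measurable borel" for f \<xi>
    unfolding \<kappa>_def
    by (subst nn_integral_density) (auto simp: nn_integral_restrict_space measurable_restrict_space1)
  have "polar_decomposition \<nu> \<Lambda>' \<kappa>"
    unfolding polar_decomposition_def
  proof (intro conjI ballI)
    show "space \<Lambda>' = ?S" by (simp add: sets_eq_imp_space_eq[OF sets\<Lambda>'] space_restrict_space)
    show "sets \<Lambda>' = sets (restrict_space borel ?S)" by (rule sets\<Lambda>')
    show "space (\<kappa> \<xi>) = {0<..}" for \<xi> by (simp add: \<kappa>_def space_restrict_space)
    show s\<kappa>: "sets (\<kappa> \<xi>) = sets (restrict_space borel {0<..})" for \<xi>
      unfolding \<kappa>_def sets_density by (rule sets_restrict_space_cong) simp
    have e\<kappa>: "emeasure (\<kappa> \<xi>) E = (\<integral>\<^sup>+r\<in>{0<..}. ennreal (h \<xi> r) * indicator E r \<partial>lborel)"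
      if "E \<in> sets (restrict_space borel {0<..})" for E \<xi>
    proof -
      have "E \<in> sets borel" using that by (auto simp: sets_restrict_space_iff)
      then show ?thesis using nn\<kappa>[of "indicator E" \<xi>] that s\<kappa>[of \<xi>] by simp
    qed
    show "0 < emeasure (\<kappa> \<xi>) {0<..}" if "\<xi> \<in> ?S" for \<xi>
    proof (rule ccontr)
      assume "\<not> 0 < emeasure (\<kappa> \<xi>) {0<..}"
      then have "(\<integral>\<^sup>+r\<in>{0<..}. ennreal (h \<xi> r) * indicator {0<..} r \<partial>lborel) = 0"
        using e\<kappa>[of "{0<..}" \<xi>] by (simp add: sets_restrict_space_iff not_less)
      then have "AE r in lborel. ennreal (h \<xi> r) * indicator {0<..} r * indicator {0<..} r = 0"
        by (subst (asm) nn_integral_0_iff_AE) measurable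
      then have "AE r in lborel. r \<notin> {0<..<1::real}"
      proof eventually_elim
        fix r :: real assume "ennreal (h \<xi> r) * indicator {0<..} r * indicator {0<..} r = 0"
        then show "r \<notin> {0<..<1}" using pos[OF that, of r] by (auto simp: ennreal_eq_0_iff)
      qed
      then have "emeasure lborel {0<..<1::real} = 0" by (subst (asm) AE_iff_measurable[of "{0<..<1}"]) auto
      then show False by simp
    qed
    show "(\<lambda>\<xi>. emeasure (\<kappa> \<xi>) E) \<in> borel_measurable \<Lambda>'" if E: "E \<in> sets (restrict_space borel {0<..})" for E
    proof -
      have [measurable]: "E \<in> sets borel" using E by (auto simp: sets_restrict_space_iff)
      have "(\<lambda>\<xi>. \<integral>\<^sup>+r\<in>{0<..}. ennreal (h \<xi> r) * indicator E r \<partial>lborel) \<in> borel_measurable \<Lambda>"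
        by measurable
      then show ?thesis unfolding \<Lambda>'_def e\<kappa>[OF E] by (rule measurable_restrict_space1)
    qed
    fix B :: "(real ^ 'n) set" assume B[measurable]: "B \<in> sets borel"
    have "(\<integral>\<^sup>+\<xi>. (\<integral>\<^sup>+u. indicator B (u *\<^sub>R \<xi>) \<partial>\<kappa> \<xi>) \<partial>\<Lambda>')
      = (\<integral>\<^sup>+\<xi>. (\<integral>\<^sup>+r\<in>{0<..}. ennreal (h \<xi> r) * indicator B (r *\<^sub>R \<xi>) \<partial>lborel) * indicator ?S \<xi> \<partial>\<Lambda>)"
      unfolding \<Lambda>'_def by (subst nn_integral_restrict_space) (simp_all add: nn\<kappa> \<Lambda>)
    also have "\<dots> = (\<integral>\<^sup>+\<xi>. (\<integral>\<^sup>+r\<in>{0<..}. ennreal (h \<xi> r) * indicator B (r *\<^sub>R \<xi>) \<partial>lborel) \<partial>\<Lambda>)"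
      by (rule nn_integral_cong_AE, use sph in eventually_elim) simp
    finally show "emeasure \<nu> B = (\<integral>\<^sup>+\<xi>. (\<integral>\<^sup>+u. indicator B (u *\<^sub>R \<xi>) \<partial>\<kappa> \<xi>) \<partial>\<Lambda>')"
      using eq[OF B] by simp
  qed
  then show ?thesis unfolding has_radial_density_def \<kappa>_def by blast
qed

lemma has_radial_densityE:
  fixes \<nu> :: "(real ^ 'n) measure"
  assumes "has_radial_density \<nu> h"
    and h: "\<And>\<xi>. \<xi> \<in> sphere 0 1 \<Longrightarrow> (\<lambda>r. ennreal (h \<xi> r)) \<in> borel_measurable (restrict_space borel {0<..})"
  obtains \<Lambda> where "sets \<Lambda> = sets (restrict_space borel (sphere 0 1))"
    and "\<And>B. B \<in> sets borel \<Longrightarrow>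
      emeasure \<nu> B = (\<integral>\<^sup>+\<xi>. (\<integral>\<^sup>+r\<in>{0<..}. ennreal (h \<xi> r) * indicator B (r *\<^sub>R \<xi>) \<partial>lborel) \<partial>\<Lambda>)"
proof -
  obtain \<Lambda> \<kappa> where pd: "polar_decomposition \<nu> \<Lambda> \<kappa>"
    and \<kappa>: "\<And>\<xi>. \<xi> \<in> sphere 0 1 \<Longrightarrow> \<kappa> \<xi> = density (restrict_space lborel {0<..}) (\<lambda>r. ennreal (h \<xi> r))"
    using assms(1) unfolding has_radial_density_def by blast
  have sp: "space \<Lambda> = sphere 0 1" and s: "sets \<Lambda> = sets (restrict_space borel (sphere 0 1))"
    and eq: "\<And>B. B \<in> sets borel \<Longrightarrow> emeasure \<nu> B = (\<integral>\<^sup>+\<xi>. (\<integral>\<^sup>+u. indicator B (u *\<^sub>R \<xi>) \<partial>\<kappa> \<xi>) \<partial>\<Lambda>)"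
    using pd unfolding polar_decomposition_def by blast+
  show thesis
  proof (rule that[OF s])
    fix B :: "(real ^ 'n) set" assume B[measurable]: "B \<in> sets borel"
    have "(\<integral>\<^sup>+u. indicator B (u *\<^sub>R \<xi>) \<partial>\<kappa> \<xi>) = (\<integral>\<^sup>+r\<in>{0<..}. ennreal (h \<xi> r) * indicator B (r *\<^sub>R \<xi>) \<partial>lborel)"
      if "\<xi> \<in> space \<Lambda>" for \<xi>
    proof -
      have \<xi>: "\<xi> \<in> sphere 0 1" using that by (simp add: sp)
      have [measurable_cong]: "sets (restrict_space lborel {0<..}) = sets (restrict_space (borel :: real measure) {0<..})"
        by (rule sets_restrict_space_cong) simp
      have m: "(\<lambda>u. indicator B (u *\<^sub>R \<xi>)) \<in> borel_measurable (restrict_space lborel {0<..})"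
        by (rule measurable_restrict_space1) simp
      show ?thesis
        unfolding \<kappa>[OF \<xi>] using h[OF \<xi>] m
        by (subst nn_integral_density) (auto simp: nn_integral_restrict_space)
    qed
    then show "emeasure \<nu> B = (\<integral>\<^sup>+\<xi>. (\<integral>\<^sup>+r\<in>{0<..}. ennreal (h \<xi> r) * indicator B (r *\<^sub>R \<xi>) \<partial>lborel) \<partial>\<Lambda>)"
      unfolding eq[OF B] by (intro nn_integral_cong)
  qed
qed

text \<open>The constant a = max 1 (2 / u) satisfies both 1 <= a and t <= a * (u * t / 2), so 1 + t
  <= a * (1 + u * t / 2) <= a * exp (u * t / 2), which is squared.\<close>

lemma power2_exp_bound:
  fixes t u :: real
  assumes t: "0 \<le> t" and u: "0 < u"
  shows "(1 + t)\<^sup>2 * exp (- u * t) \<le> (max 1 (2 / u))\<^sup>2"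
proof -
  define a where "a = max 1 (2 / u)"
  have a: "1 \<le> a" "2 / u \<le> a" by (auto simp: a_def)
  have "1 + t \<le> a * (1 + u * t / 2)"
  proof -
    have "2 / u * (u * t / 2) \<le> a * (u * t / 2)" using a t u by (intro mult_right_mono) auto
    then show ?thesis using a(1) u by (simp add: algebra_simps)
  qed
  also have "\<dots> \<le> a * exp (u * t / 2)"
    using a exp_ge_add_one_self[of "u * t / 2"] by (intro mult_left_mono) auto
  finally have "(1 + t)\<^sup>2 \<le> (a * exp (u * t / 2))\<^sup>2" using t by (intro power_mono) auto
  also have "\<dots> = a\<^sup>2 * exp (u * t)" by (simp add: power_mult_distrib power2_eq_square exp_add[symmetric])
  finally have "(1 + t)\<^sup>2 * exp (- u * t) \<le> a\<^sup>2 * exp (u * t) * exp (- u * t)" by (intro mult_right_mono) auto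
  also have "\<dots> = a\<^sup>2" by (simp add: mult.assoc exp_add[symmetric])
  finally show ?thesis by (simp add: a_def)
qed

text \<open>The Laplace variable is t = 1 / |x|. Weighted with min 1 |x| the measure \<rho> is
  finite and can be disintegrated over directions; \<open>g \<xi>\<close> is the Laplace transform
  of the conditional law in direction \<xi>, with the weight divided out again.\<close>

lemma laplace_mixture_has_radial_density:
  fixes \<rho> :: "(real ^ 'n) measure"
  assumes \<rho>: "\<rho> \<in> levy_measures1" and c: "0 < c" and q: "0 < q" "q \<le> 1"
    and \<phi>[measurable]: "\<phi> \<in> borel_measurable borel" and \<phi>pos: "\<And>r. 0 < r \<Longrightarrow> 0 < \<phi> r"
  obtains g where "completely_monotone_family g"
    "has_radial_density (ray_mixture (laplace_kernel c q \<phi>) \<rho>) (\<lambda>\<xi> r. g \<xi> (\<phi> r))"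
proof -
  have levy: "\<rho> \<in> levy_measures" using \<rho> by (simp add: levy_measures1_def)
  have s: "sets \<rho> = sets borel" using levy by (simp add: levy_measures_def)
  note [measurable_cong] = s
  define D where "D = density \<rho> (\<lambda>x. ennreal (min 1 (norm x)))"
  have sD: "sets D = sets borel" by (simp add: D_def s)
  note [measurable_cong] = sD
  have finD: "finite_measure D"
    using \<rho> by (intro finite_measureI) (simp add: D_def emeasure_density levy_measures1_def less_top cong: nn_integral_cong)
  define P where "P = polar_measure D"
  have sP: "sets P = sets (borel \<Otimes>\<^sub>M borel)" by (simp add: P_def polar_measure_def)
  note [measurable_cong] = sP
  have finP: "finite_measure P"
    unfolding P_def polar_measure_def by (rule finite_measure.finite_measure_distr[OF finD]) measurable
  have nnP: "(\<integral>\<^sup>+z. f z \<partial>P) = (\<integral>\<^sup>+x. ennreal (min 1 (norm x)) * f (dir x, ratio (norm x)) \<partial>\<rho>)"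
    if [measurable]: "f \<in> borel_measurable (borel \<Otimes>\<^sub>M borel)" for f
    unfolding P_def nn_integral_polar_measure[OF sD that] unfolding D_def by (rule nn_integral_density) measurable
  have aeP: "AE z in P. norm (fst z) = 1 \<and> 0 < snd z \<and> snd z < 1"
  proof -
    have "AE x in D. norm (fst (dir x, ratio (norm x))) = 1 \<and> 0 < snd (dir x, ratio (norm x)) \<and> snd (dir x, ratio (norm x)) < 1"
      unfolding D_def
      by (subst AE_density, measurable, use levy_measure_AE_nonzero[OF levy] in eventually_elim)
        (simp add: norm_dir ratio_bounds)
    then show ?thesis unfolding P_def polar_measure_def by (subst AE_distr_iff) simp_all
  qed
  \<comment> \<open>The open interval is demanded for every \<xi>, not almost every one: it makes
    \<open>g \<xi>\<close> strictly positive, as \<open>has_radial_densityI\<close>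
    requires.\<close>
  obtain K where K[measurable]: "K \<in> borel \<rightarrow>\<^sub>M prob_algebra borel" and aeK: "\<And>\<xi>. AE y in K \<xi>. y \<in> {0<..<1::real}"
    and dis: "\<And>f. f \<in> borel_measurable (borel \<Otimes>\<^sub>M borel) \<Longrightarrow>
       (\<integral>\<^sup>+z. f z \<partial>P) = (\<integral>\<^sup>+\<xi>. \<integral>\<^sup>+y. f (\<xi>, y) \<partial>K \<xi> \<partial>distr P borel fst)"
  proof (rule disintegration[OF finP sP])
    show "AE z in P. snd z \<in> {0..1}" "AE z in P. snd z \<in> {0<..<1}" using aeP by (eventually_elim, simp)+
    show "(1 / 2 :: real) \<in> {0<..<1}" by simp
  qed auto
  note sK = kernel_sets[OF K, simplified]
  \<comment> \<open>If y = ratio s then (1 - y) / y = 1 / s. The absolute value only makes t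
    nonnegative at irrelevant y.\<close>
  define t where "t y = \<bar>(1 - y) / y\<bar>" for y :: real
  \<comment> \<open>The factor c * s powr (- q) of the kernel, written in t = 1 / s, times max 1 (1
    / s), which cancels the weight min 1 s.\<close>
  define W where "W y = (if 0 < y \<and> y < 1 then c * t y powr q * max 1 (t y) else 0)" for y
  have [measurable]: "t \<in> borel_measurable borel" "W \<in> borel_measurable borel" unfolding t_def W_def by measurable
  have t0: "0 \<le> t y" for y by (simp add: t_def)
  have W0: "0 \<le> W y" for y using c by (simp add: W_def)
  have bound: "W y * exp (- u * t y) \<le> c * (max 1 (2 / u))\<^sup>2" if u: "0 < u" for u y
  proof -
    have "t y powr q \<le> 1 + t y"
    proof (cases "t y \<le> 1")
      case True
      then show ?thesis using t0[of y] q powr_le1[of q "t y"] by simp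
    next
      case False
      then have "t y powr q \<le> t y powr 1" using q by (intro powr_mono) auto
      then show ?thesis using False by simp
    qed
    then have "t y powr q * max 1 (t y) \<le> (1 + t y) * (1 + t y)" using t0[of y] by (intro mult_mono) auto
    then have "c * (t y powr q * max 1 (t y)) \<le> c * (1 + t y)\<^sup>2"
      using c by (simp add: power2_eq_square)
    then have "W y \<le> c * (1 + t y)\<^sup>2" using c by (simp add: W_def mult.assoc)
    then have "W y * exp (- u * t y) \<le> c * (1 + t y)\<^sup>2 * exp (- u * t y)" by (intro mult_right_mono) auto
    also have "\<dots> \<le> c * (max 1 (2 / u))\<^sup>2"
      using power2_exp_bound[OF t0 u, of y] c by (simp add: mult.assoc)
    finally show ?thesis .
  qed
  have int: "integrable (K \<xi>) (\<lambda>y. W y * exp (- u * t y))" if u: "0 < u" for u \<xi>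
  proof -
    interpret K: prob_space "K \<xi>" by (rule kernel_prob_space[OF K]) simp
    note [measurable_cong] = sK[of \<xi>]
    show ?thesis
      by (rule K.integrable_const_bound[of _ "c * (max 1 (2 / u))\<^sup>2"]) (use bound[OF u] W0 in auto)
  qed
  define g where "g \<xi> u = (\<integral>y. W y * exp (- u * t y) \<partial>K \<xi>)" for \<xi> u
  have nng: "(\<integral>\<^sup>+y. ennreal (W y * exp (- u * t y)) \<partial>K \<xi>) = ennreal (g \<xi> u)" if "0 < u" for u \<xi>
    unfolding g_def using W0 by (intro nn_integral_eq_integral int that) auto
  have cm: "completely_monotone (g \<xi>)" for \<xi>
  proof -
    note [measurable_cong] = sK[of \<xi>]
    show ?thesis unfolding g_def using W0 t0 int by (intro laplace_integral_completely_monotone) auto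
  qed
  have gpos: "0 < g \<xi> u" if u: "0 < u" for \<xi> u
  proof -
    interpret K: prob_space "K \<xi>" by (rule kernel_prob_space[OF K]) simp
    have "0 \<le> g \<xi> u" unfolding g_def using W0 by (intro Bochner_Integration.integral_nonneg) auto
    moreover have "g \<xi> u \<noteq> 0"
    proof
      assume "g \<xi> u = 0"
      then have "AE y in K \<xi>. W y * exp (- u * t y) = 0"
        unfolding g_def using int[OF u] W0 by (subst (asm) integral_nonneg_eq_0_iff_AE) auto
      with aeK[of \<xi>] have "AE y in K \<xi>. False"
      proof eventually_elim
        fix y :: real assume y: "y \<in> {0<..<1}" and "W y * exp (- u * t y) = 0"
        moreover have "0 < t y" using y by (simp add: t_def)
        ultimately show False using c by (simp add: W_def)
      qed
      then show False by simp
    qed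
    ultimately show ?thesis by simp
  qed
  have gm: "(\<lambda>z. g (fst z) (snd z)) \<in> borel_measurable (borel \<Otimes>\<^sub>M borel)"
  proof -
    have "(\<lambda>z. \<integral>\<^sup>+y. ennreal (W y * exp (- snd z * t y)) \<partial>K (fst z)) \<in> borel_measurable ((borel :: (real ^ 'n) measure) \<Otimes>\<^sub>M (borel :: real measure))"
      by (rule measurable_kernel_nn_integral[where M = borel]) measurable
    then have "(\<lambda>z. enn2real (\<integral>\<^sup>+y. ennreal (W y * exp (- snd z * t y)) \<partial>K (fst z))) \<in> borel_measurable ((borel :: (real ^ 'n) measure) \<Otimes>\<^sub>M (borel :: real measure))"
      by measurable
    moreover have "enn2real (\<integral>\<^sup>+y. ennreal (W y * exp (- u * t y)) \<partial>K \<xi>) = g \<xi> u" for \<xi> u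
    proof -
      note [measurable_cong] = sK[of \<xi>]
      show ?thesis unfolding g_def using W0 by (intro integral_eq_nn_integral[symmetric]) auto
    qed
    ultimately show ?thesis by simp
  qed
  show thesis
  proof (rule that)
    show "completely_monotone_family g"
      unfolding completely_monotone_family_def
    proof (intro conjI ballI cm)
      have "(\<lambda>z. (fst z, snd z)) \<in> restrict_space borel (sphere 0 1) \<Otimes>\<^sub>M restrict_space borel {0<..} \<rightarrow>\<^sub>M (borel :: (real ^ 'n) measure) \<Otimes>\<^sub>M (borel :: real measure)"
        by (intro measurable_Pair measurable_compose[OF measurable_fst] measurable_compose[OF measurable_snd]
            measurable_restrict_space1) simp_all
      from measurable_compose[OF this gm]
      show "(\<lambda>(\<xi>, u). g \<xi> u) \<in> borel_measurable (restrict_space borel (sphere 0 1) \<Otimes>\<^sub>M restrict_space borel {0<..})"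
        by (simp add: case_prod_beta')
    qed
    show "has_radial_density (ray_mixture (laplace_kernel c q \<phi>) \<rho>) (\<lambda>\<xi> r. g \<xi> (\<phi> r))"
    proof (rule has_radial_densityI[where \<Lambda> = "distr P borel fst"])
      have "AE z in P. fst z \<in> sphere 0 1" using aeP by eventually_elim simp
      then show "AE \<xi> in distr P borel fst. \<xi> \<in> sphere 0 1" by (subst AE_distr_iff) simp_all
      have "(\<lambda>z. g (fst z) (\<phi> (snd z))) \<in> borel_measurable ((borel :: (real ^ 'n) measure) \<Otimes>\<^sub>M (borel :: real measure))"
        using measurable_compose[OF _ gm, of "\<lambda>z. (fst z, \<phi> (snd z))" "(borel :: (real ^ 'n) measure) \<Otimes>\<^sub>M (borel :: real measure)"] by simp
      then show "(\<lambda>(\<xi>, r). ennreal (g \<xi> (\<phi> r))) \<in> borel_measurable (borel \<Otimes>\<^sub>M borel)"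
        by (simp add: case_prod_beta')
      show "0 < g \<xi> (\<phi> r)" if "0 < r" for \<xi> r using gpos \<phi>pos that by simp
      fix B :: "(real ^ 'n) set" assume B[measurable]: "B \<in> sets borel"
      let ?p = "laplace_kernel c q \<phi>"
      define J where "J z = (\<integral>\<^sup>+r\<in>{0<..}. ennreal (W (snd z) * exp (- \<phi> r * t (snd z))) * indicator B (r *\<^sub>R fst z) \<partial>lborel)"
        for z :: "(real ^ 'n) \<times> real"
      have J[measurable]: "J \<in> borel_measurable (borel \<Otimes>\<^sub>M borel)" unfolding J_def by measurable
      have "emeasure (ray_mixture ?p \<rho>) B = (\<integral>\<^sup>+y. indicator B y \<partial>ray_mixture ?p \<rho>)" by simp
      also have "\<dots> = (\<integral>\<^sup>+x. (\<integral>\<^sup>+r\<in>{0<..}. ennreal (?p (norm x) r) * indicator B (r *\<^sub>R dir x) \<partial>lborel) \<partial>\<rho>)"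
        by (rule nn_integral_ray_mixture[OF s]) measurable
      also have "\<dots> = (\<integral>\<^sup>+x. ennreal (min 1 (norm x)) * J (dir x, ratio (norm x)) \<partial>\<rho>)"
      proof (rule nn_integral_cong_AE)
        show "AE x in \<rho>. (\<integral>\<^sup>+r\<in>{0<..}. ennreal (?p (norm x) r) * indicator B (r *\<^sub>R dir x) \<partial>lborel)
            = ennreal (min 1 (norm x)) * J (dir x, ratio (norm x))" (is "AE x in _. ?P x")
          using levy_measure_AE_nonzero[OF levy]
        proof eventually_elim
          fix x :: "real ^ 'n" assume x: "x \<noteq> 0"
          define s where "s = norm x"
          have s: "0 < s" using x by (simp add: s_def)
          have ts: "t (ratio s) = 1 / s" using s by (simp add: t_def ratio_def field_simps)
          have "min 1 s * max 1 (1 / s) = 1" using s by (auto simp: min_def max_def field_simps)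
          moreover have "W (ratio s) = c * s powr (- q) * max 1 (1 / s)"
            using s ratio_bounds[of s] by (simp add: W_def ts powr_minus_divide powr_divide)
          ultimately have "min 1 s * W (ratio s) = c * s powr (- q)" by (simp add: mult_ac)
          then have p: "min 1 s * (W (ratio s) * exp (- \<phi> r * t (ratio s))) = ?p s r" for r
            by (simp add: laplace_kernel_def ts mult.assoc[symmetric])
          have "ennreal (min 1 s) * J (dir x, ratio s)
            = (\<integral>\<^sup>+r. ennreal (min 1 s) * (ennreal (W (ratio s) * exp (- \<phi> r * t (ratio s))) * indicator B (r *\<^sub>R dir x) * indicator {0<..} r) \<partial>lborel)"
            unfolding J_def fst_conv snd_conv by (rule nn_integral_cmult[symmetric]) measurable
          also have "\<dots> = (\<integral>\<^sup>+r\<in>{0<..}. ennreal (?p s r) * indicator B (r *\<^sub>R dir x) \<partial>lborel)"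
            using s by (intro nn_integral_cong) (simp add: p[symmetric] ennreal_mult' mult.assoc)
          finally show "?P x" by (simp add: s_def)
        qed
      qed
      also have "\<dots> = (\<integral>\<^sup>+z. J z \<partial>P)" by (rule nnP[OF J, symmetric])
      also have "\<dots> = (\<integral>\<^sup>+\<xi>. \<integral>\<^sup>+y. J (\<xi>, y) \<partial>K \<xi> \<partial>distr P borel fst)" by (rule dis[OF J])
      also have "\<dots> = (\<integral>\<^sup>+\<xi>. (\<integral>\<^sup>+r\<in>{0<..}. ennreal (g \<xi> (\<phi> r)) * indicator B (r *\<^sub>R \<xi>) \<partial>lborel) \<partial>distr P borel fst)"
      proof (rule nn_integral_cong)
        fix \<xi>
        interpret K: prob_space "K \<xi>" by (rule kernel_prob_space[OF K]) simp
        interpret pair_sigma_finite "K \<xi>" lborel ..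
        note [measurable_cong] = sK[of \<xi>]
        have "(\<integral>\<^sup>+y. J (\<xi>, y) \<partial>K \<xi>)
          = (\<integral>\<^sup>+r. \<integral>\<^sup>+y. ennreal (W y * exp (- \<phi> r * t y)) * indicator B (r *\<^sub>R \<xi>) * indicator {0<..} r \<partial>K \<xi> \<partial>lborel)"
          unfolding J_def fst_conv snd_conv by (rule Fubini'[symmetric]) measurable
        also have "\<dots> = (\<integral>\<^sup>+r\<in>{0<..}. ennreal (g \<xi> (\<phi> r)) * indicator B (r *\<^sub>R \<xi>) \<partial>lborel)"
        proof (rule nn_integral_cong)
          fix r :: real
          have "(\<integral>\<^sup>+y. ennreal (W y * exp (- \<phi> r * t y)) * indicator B (r *\<^sub>R \<xi>) * indicator {0<..} r \<partial>K \<xi>)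
            = (\<integral>\<^sup>+y. ennreal (W y * exp (- \<phi> r * t y)) \<partial>K \<xi>) * (indicator B (r *\<^sub>R \<xi>) * indicator {0<..} r)"
            unfolding mult.assoc by (rule nn_integral_multc) measurable
          then show "(\<integral>\<^sup>+y. ennreal (W y * exp (- \<phi> r * t y)) * indicator B (r *\<^sub>R \<xi>) * indicator {0<..} r \<partial>K \<xi>)
            = ennreal (g \<xi> (\<phi> r)) * indicator B (r *\<^sub>R \<xi>) * indicator {0<..} r"
            using nng[of "\<phi> r" \<xi>] \<phi>pos[of r] by (cases "0 < r") simp_all
        qed
        finally show "(\<integral>\<^sup>+y. J (\<xi>, y) \<partial>K \<xi>) = (\<integral>\<^sup>+r\<in>{0<..}. ennreal (g \<xi> (\<phi> r)) * indicator B (r *\<^sub>R \<xi>) \<partial>lborel)" .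
      qed
      finally show "emeasure (ray_mixture ?p \<rho>) B
        = (\<integral>\<^sup>+\<xi>. (\<integral>\<^sup>+r\<in>{0<..}. ennreal (g \<xi> (\<phi> r)) * indicator B (r *\<^sub>R \<xi>) \<partial>lborel) \<partial>distr P borel fst)" .
    qed simp
  qed
qed

section \<open>Total mass and truncated integrals of the radial laws\<close>

lemma kernel_total_exponential:
  assumes s: "0 < s"
  shows "(\<integral>\<^sup>+r\<in>{0<..}. ennreal (laplace_kernel 1 1 (\<lambda>r. r) s r) \<partial>lborel) = 1"
proof -
  have "(\<integral>\<^sup>+r\<in>{0<..}. ennreal (laplace_kernel 1 1 (\<lambda>r. r) s r) \<partial>lborel)
    = ennreal \<bar>s\<bar> * (\<integral>\<^sup>+v. ennreal (laplace_kernel 1 1 (\<lambda>r. r) s (0 + s * v)) * indicator {0<..} (0 + s * v) \<partial>lborel)"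
    using s by (intro nn_integral_real_affine) (auto simp: laplace_kernel_def)
  also have "\<dots> = (\<integral>\<^sup>+v. ennreal \<bar>s\<bar> * (ennreal (laplace_kernel 1 1 (\<lambda>r. r) s (0 + s * v)) * indicator {0<..} (0 + s * v)) \<partial>lborel)"
    by (rule nn_integral_cmult[symmetric]) (simp add: laplace_kernel_def)
  also have "\<dots> = (\<integral>\<^sup>+v. ennreal (v ^ 0 * exp (- v)) * indicator {0..} v \<partial>lborel)"
  proof (rule nn_integral_cong_AE)
    have "AE v in lborel. v \<noteq> (0::real)" by (rule AE_lborel_singleton)
    then show "AE v in lborel. ennreal \<bar>s\<bar> * (ennreal (laplace_kernel 1 1 (\<lambda>r. r) s (0 + s * v)) * indicator {0<..} (0 + s * v))
      = ennreal (v ^ 0 * exp (- v)) * indicator {0..} v" (is "AE v in _. ?P v")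
    proof eventually_elim
      fix v :: real assume v: "v \<noteq> 0"
      have "s * laplace_kernel 1 1 (\<lambda>r. r) s (s * v) = exp (- v)"
        using s by (simp add: laplace_kernel_def powr_minus_divide)
      then have "ennreal \<bar>s\<bar> * ennreal (laplace_kernel 1 1 (\<lambda>r. r) s (s * v)) = ennreal (exp (- v))"
        using s by (simp add: ennreal_mult'[symmetric])
      then show "?P v"
        using s v by (cases "0 < v") (simp_all add: zero_less_mult_iff)
    qed
  qed
  also have "\<dots> = 1" by (subst nn_intergal_power_times_exp_Ici) simp
  finally show ?thesis .
qed

lemma kernel_total_gaussian:
  assumes s: "0 < s"
  shows "(\<integral>\<^sup>+r\<in>{0<..}. ennreal (laplace_kernel (2 / sqrt pi) (1 / 2) (\<lambda>r. r\<^sup>2) s r) \<partial>lborel) = 1"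
proof -
  let ?p = "laplace_kernel (2 / sqrt pi) (1 / 2) (\<lambda>r. r\<^sup>2)"
  let ?f = "\<lambda>x::real. indicator {0..} x *\<^sub>R (exp (- x\<^sup>2) * x ^ (2 * 0))"
  have "has_bochner_integral lborel ?f (sqrt pi / 2)" using gaussian_moment_even_pos[of 0] by simp
  then have base: "(\<integral>\<^sup>+x. ennreal (?f x) \<partial>lborel) = ennreal (sqrt pi / 2)"
    by (subst nn_integral_eq_integral) (auto simp: has_bochner_integral_iff)
  define a where "a = sqrt s"
  have a: "0 < a" "a\<^sup>2 = s" using s by (auto simp: a_def)
  have [measurable]: "?p s \<in> borel_measurable borel" unfolding laplace_kernel_def[abs_def] by measurable
  have "(\<integral>\<^sup>+r\<in>{0<..}. ennreal (?p s r) \<partial>lborel)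
    = ennreal \<bar>a\<bar> * (\<integral>\<^sup>+v. ennreal (?p s (0 + a * v)) * indicator {0<..} (0 + a * v) \<partial>lborel)"
    using a by (intro nn_integral_real_affine) auto
  also have "\<dots> = (\<integral>\<^sup>+v. ennreal \<bar>a\<bar> * (ennreal (?p s (0 + a * v)) * indicator {0<..} (0 + a * v)) \<partial>lborel)"
    by (rule nn_integral_cmult[symmetric]) measurable
  also have "\<dots> = (\<integral>\<^sup>+v. ennreal (2 / sqrt pi) * ennreal (?f v) \<partial>lborel)"
  proof (rule nn_integral_cong_AE)
    have "AE v in lborel. v \<noteq> (0::real)" by (rule AE_lborel_singleton)
    then show "AE v in lborel. ennreal \<bar>a\<bar> * (ennreal (?p s (0 + a * v)) * indicator {0<..} (0 + a * v))
      = ennreal (2 / sqrt pi) * ennreal (?f v)" (is "AE v in _. ?P v")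
    proof eventually_elim
      fix v :: real assume v: "v \<noteq> 0"
      have "a * s powr (- (1 / 2)) = 1" using s by (simp add: a_def powr_minus_divide powr_half_sqrt)
      moreover have "(a * v)\<^sup>2 / s = v\<^sup>2" using s by (simp add: power_mult_distrib a)
      ultimately have "a * ?p s (a * v) = 2 / sqrt pi * exp (- v\<^sup>2)"
        by (simp add: laplace_kernel_def mult_ac)
      then have "ennreal \<bar>a\<bar> * ennreal (?p s (a * v)) = ennreal (2 / sqrt pi) * ennreal (exp (- v\<^sup>2))"
        using a by (simp add: ennreal_mult'[symmetric])
      then show "?P v"
        using a v by (cases "0 < v") (simp_all add: zero_less_mult_iff)
    qed
  qed
  also have "\<dots> = ennreal (2 / sqrt pi) * ennreal (sqrt pi / 2)"
    unfolding base[symmetric] by (rule nn_integral_cmult) simp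
  also have "\<dots> = 1" by (simp add: ennreal_mult'[symmetric])
  finally show ?thesis .
qed

text \<open>For m = min 1 s one has sqrt (1 + s) >= 1 + m / 3, and 1 / (1 + m / 3) <= 1 - m / 4;
  both follow from m^2 <= m. Larger q only helps.\<close>

lemma one_minus_powr_bound:
  fixes s q :: real
  assumes s: "0 < s" and q: "1 / 2 \<le> q"
  shows "min 1 s / 4 \<le> 1 - (1 + s) powr (- q)"
proof -
  define m where "m = min 1 s"
  have m: "0 < m" "m \<le> 1" "m \<le> s" using s by (auto simp: m_def)
  have "(1 + m / 3)\<^sup>2 \<le> 1 + s"
  proof -
    have "m * m \<le> 1 * m" using m by (intro mult_right_mono) auto
    moreover have "(1 + m / 3)\<^sup>2 = 1 + 2 * m / 3 + m * m / 9" by (simp add: power2_eq_square field_simps)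
    ultimately show ?thesis using m by linarith
  qed
  then have "1 + m / 3 \<le> sqrt (1 + s)" using m by (intro real_le_rsqrt)
  also have "\<dots> = (1 + s) powr (1 / 2)" using s by (simp add: powr_half_sqrt)
  also have "\<dots> \<le> (1 + s) powr q" using s q by (intro powr_mono) auto
  finally have "inverse ((1 + s) powr q) \<le> inverse (1 + m / 3)" using m by (intro le_imp_inverse_le) auto
  also have "\<dots> \<le> 1 - m / 4"
  proof -
    have "1 \<le> (1 - m / 4) * (1 + m / 3)"
    proof -
      have "m * m \<le> 1 * m" using m by (intro mult_right_mono) auto
      moreover have "(1 - m / 4) * (1 + m / 3) = 1 + m / 12 - m * m / 12" by (simp add: field_simps)
      ultimately show ?thesis by linarith
    qed
    then show ?thesis using m by (simp add: inverse_eq_divide divide_le_eq)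
  qed
  finally show ?thesis by (simp add: m_def powr_minus)
qed

text \<open>Bound min 1 (\<open>\<phi> r\<close>) below by 1 - exp (- \<open>\<phi> r\<close>). The
  factor exp (- \<open>\<phi> r\<close>) shifts 1 / s to 1 / s + 1, so the kernel becomes (1 + s)
  powr (- q) times the kernel for s / (1 + s). Total mass 1 for both parameters leaves 1 - (1 + s)
  powr (- q).\<close>

lemma laplace_kernel_truncated_lower_bound:
  assumes s: "0 < s" and c: "0 < c" and q: "1 / 2 \<le> q"
    and \<phi>[measurable]: "\<phi> \<in> borel_measurable borel" and \<phi>pos: "\<And>r. 0 < r \<Longrightarrow> 0 < \<phi> r"
    and tot: "\<And>s. 0 < s \<Longrightarrow> (\<integral>\<^sup>+r\<in>{0<..}. ennreal (laplace_kernel c q \<phi> s r) \<partial>lborel) = 1"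
  shows "ennreal (min 1 s / 4) \<le> (\<integral>\<^sup>+r\<in>{0<..}. ennreal (laplace_kernel c q \<phi> s r) * ennreal (min 1 (\<phi> r)) \<partial>lborel)"
proof -
  let ?p = "laplace_kernel c q \<phi>"
  define b where "b = (1 + s) powr (- q)"
  define s' where "s' = s / (1 + s)"
  have s': "0 < s'" using s by (simp add: s'_def)
  have p0: "0 \<le> ?p s r" for s r using c by (simp add: laplace_kernel_def)
  have [measurable]: "?p s \<in> borel_measurable borel" for s unfolding laplace_kernel_def[abs_def] by measurable
  have shift: "?p s r * exp (- \<phi> r) = b * ?p s' r" for r
  proof -
    have "s' powr (- q) = s powr (- q) / (1 + s) powr (- q)" using s by (simp add: s'_def powr_divide)
    then have e1: "b * s' powr (- q) = s powr (- q)" using s by (simp add: b_def)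
    have "- \<phi> r / s + - \<phi> r = - \<phi> r / s'" using s by (simp add: s'_def field_simps)
    then have e2: "exp (- \<phi> r / s) * exp (- \<phi> r) = exp (- \<phi> r / s')" by (simp add: exp_add[symmetric])
    show ?thesis unfolding laplace_kernel_def e1[symmetric] e2[symmetric] by (simp only: mult_ac)
  qed
  have "1 = (\<integral>\<^sup>+r\<in>{0<..}. ennreal (?p s r) \<partial>lborel)" by (rule tot[OF s, symmetric])
  also have "\<dots> \<le> (\<integral>\<^sup>+r. ennreal (?p s r) * ennreal (min 1 (\<phi> r)) * indicator {0<..} r + ennreal b * (ennreal (?p s' r) * indicator {0<..} r) \<partial>lborel)"
  proof (rule nn_integral_mono)
    fix r :: real
    show "ennreal (?p s r) * indicator {0<..} r \<le> ennreal (?p s r) * ennreal (min 1 (\<phi> r)) * indicator {0<..} r + ennreal b * (ennreal (?p s' r) * indicator {0<..} r)"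
    proof (cases "0 < r")
      case True
      have "1 - exp (- \<phi> r) \<le> min 1 (\<phi> r)" using exp_ge_add_one_self[of "- \<phi> r"] by simp
      then have "1 \<le> min 1 (\<phi> r) + exp (- \<phi> r)" by linarith
      then have "?p s r * 1 \<le> ?p s r * (min 1 (\<phi> r) + exp (- \<phi> r))" using p0 by (rule mult_left_mono)
      then have "?p s r \<le> ?p s r * min 1 (\<phi> r) + b * ?p s' r" by (simp add: distrib_left shift)
      then have "ennreal (?p s r) \<le> ennreal (?p s r * min 1 (\<phi> r) + b * ?p s' r)" by (rule ennreal_leI)
      also have "\<dots> = ennreal (?p s r) * ennreal (min 1 (\<phi> r)) + ennreal b * ennreal (?p s' r)"
        using p0 \<phi>pos[OF True] by (subst ennreal_plus) (auto simp: ennreal_mult b_def)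
      finally show ?thesis using True by simp
    qed simp
  qed
  also have "\<dots> = (\<integral>\<^sup>+r\<in>{0<..}. ennreal (?p s r) * ennreal (min 1 (\<phi> r)) \<partial>lborel) + ennreal b * (\<integral>\<^sup>+r\<in>{0<..}. ennreal (?p s' r) \<partial>lborel)"
    by (subst nn_integral_add, measurable, subst nn_integral_cmult) simp_all
  finally have le: "1 \<le> (\<integral>\<^sup>+r\<in>{0<..}. ennreal (?p s r) * ennreal (min 1 (\<phi> r)) \<partial>lborel) + ennreal b"
    by (simp add: tot[OF s'])
  have "ennreal (min 1 s / 4) \<le> ennreal (1 - b)"
    unfolding b_def by (intro ennreal_leI one_minus_powr_bound s q)
  also have "\<dots> = 1 - ennreal b" by (simp add: ennreal_minus[symmetric] b_def ennreal_1[symmetric] del: ennreal_1)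
  also have "\<dots> \<le> (\<integral>\<^sup>+r\<in>{0<..}. ennreal (?p s r) * ennreal (min 1 (\<phi> r)) \<partial>lborel)"
    using le by (subst ennreal_minus_le_iff) (auto simp: add.commute)
  finally show ?thesis .
qed

lemma levy_measures1I:
  assumes s: "sets \<rho> = sets borel" and z: "emeasure \<rho> {0} = 0" and fin: "(\<integral>\<^sup>+x. ennreal (min 1 (norm x)) \<partial>\<rho>) < \<infinity>"
  shows "\<rho> \<in> levy_measures1"
proof -
  have "(\<integral>\<^sup>+x. ennreal (min 1 ((norm x)\<^sup>2)) \<partial>\<rho>) \<le> (\<integral>\<^sup>+x. ennreal (min 1 (norm x)) \<partial>\<rho>)"
  proof (intro nn_integral_mono ennreal_leI)
    fix x :: "real ^ 'a"
    show "min 1 ((norm x)\<^sup>2) \<le> min 1 (norm x)"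
    proof (cases "norm x \<le> 1")
      case True
      then have "(norm x)\<^sup>2 \<le> norm x" by (simp add: power2_eq_square mult_left_le)
      then show ?thesis by simp
    qed simp
  qed
  with assms show ?thesis by (simp add: levy_measures1_def levy_measures_def)
qed

text \<open>The exponential law of mean s integrates min 1 r to at most 2 * min 1 s: for s > 1 by
  its total mass, for small s by comparison with the exponential law of mean 2 s.\<close>

lemma Upsilon0_levy_measures1:
  fixes \<rho> :: "(real ^ 'n) measure"
  assumes \<rho>: "\<rho> \<in> levy_measures1"
  shows "Upsilon0 \<rho> \<in> levy_measures1"
proof -
  have levy: "\<rho> \<in> levy_measures" using \<rho> by (simp add: levy_measures1_def)
  have s: "sets \<rho> = sets borel" using levy by (simp add: levy_measures_def)
  note [measurable_cong] = s
  let ?p = "laplace_kernel 1 1 (\<lambda>r. r)"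
  have [measurable]: "?p s \<in> borel_measurable borel" for s unfolding laplace_kernel_def[abs_def] by measurable
  have p0: "0 \<le> ?p s r" for s r by (simp add: laplace_kernel_def)
  have inner: "(\<integral>\<^sup>+r\<in>{0<..}. ennreal (?p s r) * ennreal (min 1 r) \<partial>lborel) \<le> ennreal (2 * min 1 s)" if s: "0 < s" for s
  proof -
    have "(\<integral>\<^sup>+r\<in>{0<..}. ennreal (?p s r) * ennreal (min 1 r) \<partial>lborel) \<le> (\<integral>\<^sup>+r\<in>{0<..}. ennreal (?p s r) \<partial>lborel)"
      by (intro nn_integral_mono) (auto simp: p0 ennreal_mult'[symmetric] intro!: ennreal_leI mult_left_le split: split_indicator)
    then have 1: "(\<integral>\<^sup>+r\<in>{0<..}. ennreal (?p s r) * ennreal (min 1 r) \<partial>lborel) \<le> 1"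
      unfolding kernel_total_exponential[OF s] .
    have "(\<integral>\<^sup>+r\<in>{0<..}. ennreal (?p s r) * ennreal (min 1 r) \<partial>lborel) \<le> (\<integral>\<^sup>+r. ennreal (2 * s) * (ennreal (?p (2 * s) r) * indicator {0<..} r) \<partial>lborel)"
    proof (rule nn_integral_mono)
      fix r :: real
      show "ennreal (?p s r) * ennreal (min 1 r) * indicator {0<..} r \<le> ennreal (2 * s) * (ennreal (?p (2 * s) r) * indicator {0<..} r)"
      proof (cases "0 < r")
        case True
        define x where "x = r / s"
        have x: "0 < x" using True s by (simp add: x_def)
        \<comment> \<open>Equivalent to x <= (1 + x / 4)^2, hence x <= exp (x / 2). So the density
          times r is at most 2 s times the density with mean 2 s, whose mass is known to be
          1.\<close>
        have "0 \<le> (x / 4 - 1)\<^sup>2" by simp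
        then have "x \<le> (1 + x / 4)\<^sup>2" by (simp add: power2_eq_square algebra_simps)
        also have "\<dots> \<le> (exp (x / 4))\<^sup>2" using x exp_ge_add_one_self[of "x / 4"] by (intro power_mono) auto
        also have "\<dots> = exp (x / 2)" by (simp add: power2_eq_square exp_add[symmetric])
        finally have "x * exp (- x) \<le> exp (x / 2) * exp (- x)" by (intro mult_right_mono) auto
        also have "\<dots> = exp (- (x / 2))" by (simp add: exp_add[symmetric])
        finally have "x * exp (- x) \<le> exp (- (x / 2))" .
        moreover have "?p s r * r = x * exp (- x)" "2 * s * ?p (2 * s) r = exp (- (x / 2))"
          using s by (simp_all add: laplace_kernel_def powr_minus_divide x_def field_simps)
        moreover have "?p s r * min 1 r \<le> ?p s r * r" using p0 by (intro mult_left_mono) auto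
        ultimately have "?p s r * min 1 r \<le> 2 * s * ?p (2 * s) r" by linarith
        then show ?thesis using True s by (simp add: ennreal_mult'[symmetric] p0 ennreal_leI)
      qed simp
    qed
    also have "\<dots> = ennreal (2 * s) * 1"
      using s by (subst nn_integral_cmult) (simp_all add: kernel_total_exponential)
    finally have 2: "(\<integral>\<^sup>+r\<in>{0<..}. ennreal (?p s r) * ennreal (min 1 r) \<partial>lborel) \<le> ennreal (2 * s)" by simp
    show ?thesis
    proof (cases "s \<le> 1")
      case True then show ?thesis using 2 by simp
    next
      case False
      have "1 \<le> (2 :: ennreal)" by simp
      with 1 False show ?thesis by (auto intro: order.trans)
    qed
  qed
  show ?thesis
    unfolding Upsilon0_eq_laplace_mixture[OF levy]
  proof (rule levy_measures1I)
    have "emeasure (ray_mixture ?p \<rho>) {0} = (\<integral>\<^sup>+y. indicator {0} y \<partial>ray_mixture ?p \<rho>)" by simp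
    also have "\<dots> = (\<integral>\<^sup>+x. (\<integral>\<^sup>+r\<in>{0<..}. ennreal (?p (norm x) r) * indicator {0} (r *\<^sub>R dir x) \<partial>lborel) \<partial>\<rho>)"
      by (rule nn_integral_ray_mixture[OF s]) measurable
    also have "\<dots> = (\<integral>\<^sup>+x. 0 \<partial>\<rho>)"
    proof (rule nn_integral_cong_AE)
      show "AE x in \<rho>. (\<integral>\<^sup>+r\<in>{0<..}. ennreal (?p (norm x) r) * indicator {0} (r *\<^sub>R dir x) \<partial>lborel) = 0" (is "AE x in _. ?P x")
        using levy_measure_AE_nonzero[OF levy]
      proof eventually_elim
        fix x :: "real ^ 'n" assume "x \<noteq> 0"
        then have "ennreal (?p (norm x) r) * indicator {0} (r *\<^sub>R dir x) * indicator {0<..} r = 0" for r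
          by (auto simp: dir_def split: split_indicator)
        then show "?P x"
          by (simp only: nn_integral_const mult_zero_left)
      qed
    qed
    finally show "emeasure (ray_mixture ?p \<rho>) {0} = 0" by simp
    have "(\<integral>\<^sup>+y. ennreal (min 1 (norm y)) \<partial>ray_mixture ?p \<rho>)
      = (\<integral>\<^sup>+x. (\<integral>\<^sup>+r\<in>{0<..}. ennreal (?p (norm x) r) * ennreal (min 1 (norm (r *\<^sub>R dir x))) \<partial>lborel) \<partial>\<rho>)"
      by (rule nn_integral_ray_mixture[OF s]) measurable
    also have "\<dots> \<le> (\<integral>\<^sup>+x. 2 * ennreal (min 1 (norm x)) \<partial>\<rho>)"
    proof (rule nn_integral_mono_AE)
      show "AE x in \<rho>. (\<integral>\<^sup>+r\<in>{0<..}. ennreal (?p (norm x) r) * ennreal (min 1 (norm (r *\<^sub>R dir x))) \<partial>lborel) \<le> 2 * ennreal (min 1 (norm x))" (is "AE x in _. ?P x")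
        using levy_measure_AE_nonzero[OF levy]
      proof eventually_elim
        fix x :: "real ^ 'n" assume x: "x \<noteq> 0"
        have "(\<integral>\<^sup>+r\<in>{0<..}. ennreal (?p (norm x) r) * ennreal (min 1 (norm (r *\<^sub>R dir x))) \<partial>lborel)
          = (\<integral>\<^sup>+r\<in>{0<..}. ennreal (?p (norm x) r) * ennreal (min 1 r) \<partial>lborel)"
          by (intro nn_integral_cong) (auto simp: norm_dir[OF x] split: split_indicator)
        also have "\<dots> \<le> ennreal (2 * min 1 (norm x))" using x by (intro inner) simp
        also have "\<dots> = 2 * ennreal (min 1 (norm x))" by (subst ennreal_mult) simp_all
        finally show "?P x" .
      qed
    qed
    also have "\<dots> = 2 * (\<integral>\<^sup>+x. ennreal (min 1 (norm x)) \<partial>\<rho>)" by (rule nn_integral_cmult) measurable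
    also have "\<dots> < \<infinity>" using \<rho> by (simp add: levy_measures1_def ennreal_mult_less_top)
    finally show "(\<integral>\<^sup>+y. ennreal (min 1 (norm y)) \<partial>ray_mixture ?p \<rho>) < \<infinity>" .
  qed simp
qed

section \<open>From completely monotone radial densities to mixtures\<close>

lemma emeasure_lborel_atLeast: "emeasure lborel {a::real..} = \<infinity>"
proof -
  have "of_nat n \<le> emeasure lborel {a..}" for n
  proof -
    have "of_nat n = emeasure lborel {a..a + real n}" by (simp add: ennreal_of_nat_eq_real_of_nat)
    also have "\<dots> \<le> emeasure lborel {a..}" by (rule emeasure_mono) auto
    finally show ?thesis .
  qed
  then have "(SUP n. of_nat n) \<le> emeasure lborel {a..}" by (rule SUP_least)
  then show ?thesis by (simp add: ennreal_SUP_of_nat_eq_top top_unique)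
qed

text \<open>The converse construction: the Bernstein variable y = exp (- t) in direction \<xi> is
  sent to the point \<xi> / t, that is |x| = 1 / (- ln y), with a weight that turns the kernel of
  this point into the Bernstein integrand. Pushing all conditional laws forward and mixing them over
  the sphere yields \<rho>.\<close>

theorem radial_density_imp_laplace_mixture:
  fixes \<nu> :: "(real ^ 'n) measure"
  assumes s\<nu>: "sets \<nu> = sets borel" and cm: "completely_monotone_family g"
    and rad: "has_radial_density \<nu> (\<lambda>\<xi> r. g \<xi> (\<phi> r))"
    and c: "0 < c" and q: "1 / 2 \<le> q"
    and \<phi>[measurable]: "\<phi> \<in> borel_measurable borel" and \<phi>pos: "\<And>r. 0 < r \<Longrightarrow> 0 < \<phi> r"
    and \<phi>1: "\<And>r. 1 \<le> r \<Longrightarrow> 1 \<le> \<phi> r"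
    and tot: "\<And>s. 0 < s \<Longrightarrow> (\<integral>\<^sup>+r\<in>{0<..}. ennreal (laplace_kernel c q \<phi> s r) \<partial>lborel) = 1"
    and fin: "(\<integral>\<^sup>+x. ennreal (min 1 (\<phi> (norm x))) \<partial>\<nu>) < \<infinity>"
  obtains \<rho> where "\<rho> \<in> levy_measures1" "\<nu> = ray_mixture (laplace_kernel c q \<phi>) \<rho>"
proof -
  let ?S = "restrict_space borel (sphere 0 1) :: (real ^ 'n) measure"
  let ?p = "laplace_kernel c q \<phi>"
  have m4: "(\<lambda>x::real ^ 'n. ennreal (min 1 (norm x) / 4)) \<in> borel_measurable borel" by measurable
  have spS: "space ?S = sphere 0 1" by (simp add: space_restrict_space)
  have gm: "(\<lambda>(\<xi>, u). g \<xi> u) \<in> borel_measurable (?S \<Otimes>\<^sub>M restrict_space borel {0<..})"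
    and gcm: "\<And>\<xi>. \<xi> \<in> sphere 0 1 \<Longrightarrow> completely_monotone (g \<xi>)"
    using cm by (auto simp: completely_monotone_family_def)
  obtain K where K[measurable]: "K \<in> ?S \<rightarrow>\<^sub>M prob_algebra borel"
    and aeK: "\<And>\<xi>. \<xi> \<in> space ?S \<Longrightarrow> AE y in K \<xi>. 0 < y \<and> y \<le> 1"
    and repK: "\<And>\<xi> u. \<xi> \<in> space ?S \<Longrightarrow> 0 < u \<Longrightarrow> (\<integral>\<^sup>+y. ennreal (g \<xi> 1 * y powr (u - 1)) \<partial>K \<xi>) = ennreal (g \<xi> u)"
    by (rule bernstein_kernel[OF gm]) (simp_all add: spS gcm)
  have g1[measurable]: "(\<lambda>\<xi>. g \<xi> 1) \<in> borel_measurable ?S"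
    using measurable_compose[OF measurable_Pair2' gm, of 1] by (simp add: space_restrict_space)
  have g0: "0 \<le> g \<xi> 1" if "\<xi> \<in> sphere 0 1" for \<xi> using completely_monotone_nonneg[OF gcm[OF that]] by simp
  have hm: "(\<lambda>r. ennreal (g \<xi> (\<phi> r))) \<in> borel_measurable (restrict_space borel {0<..})" if \<xi>: "\<xi> \<in> sphere 0 1" for \<xi>
  proof -
    have "(\<lambda>r. (\<xi>, \<phi> r)) \<in> restrict_space borel {0<..} \<rightarrow>\<^sub>M ?S \<Otimes>\<^sub>M restrict_space borel {0<..}"
    proof (intro measurable_Pair measurable_const measurable_restrict_space2)
      show "\<phi> \<in> restrict_space borel {0<..} \<rightarrow>\<^sub>M borel" by (rule measurable_restrict_space1) (rule \<phi>)
    qed (use \<xi> \<phi>pos in \<open>auto simp: space_restrict_space\<close>)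
    from measurable_compose[OF this gm]
    show ?thesis by simp
  qed
  obtain \<Lambda> where s\<Lambda>[measurable_cong]: "sets \<Lambda> = sets ?S"
    and eq\<nu>: "\<And>B. B \<in> sets borel \<Longrightarrow>
      emeasure \<nu> B = (\<integral>\<^sup>+\<xi>. (\<integral>\<^sup>+r\<in>{0<..}. ennreal (g \<xi> (\<phi> r)) * indicator B (r *\<^sub>R \<xi>) \<partial>lborel) \<partial>\<Lambda>)"
    by (rule has_radial_densityE[OF rad hm]) (assumption, rule that)
  have sp\<Lambda>: "space \<Lambda> = sphere 0 1" using sets_eq_imp_space_eq[OF s\<Lambda>] spS by simp
  have idm[measurable]: "(\<lambda>\<xi>. \<xi>) \<in> ?S \<rightarrow>\<^sub>M borel" by (rule measurable_restrict_space1) simp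
  note sK = kernel_sets[OF K]
  \<comment> \<open>The density in the form of a kernel integral is jointly measurable for all real
    r, whereas g (\<open>\<phi> r\<close>) is controlled only for r > 0, where both agree.\<close>
  define G where "G \<xi> r = (\<integral>\<^sup>+y. ennreal (g \<xi> 1 * y powr (\<phi> r - 1)) \<partial>K \<xi>)" for \<xi> r
  have Gg: "G \<xi> r = ennreal (g \<xi> (\<phi> r))" if "\<xi> \<in> sphere 0 1" "0 < r" for \<xi> r
    unfolding G_def using that \<phi>pos by (intro repK) (auto simp: spS)
  have Gm: "(\<lambda>z. G (fst z) (snd z)) \<in> borel_measurable (?S \<Otimes>\<^sub>M borel)"
    unfolding G_def by (rule measurable_kernel_nn_integral[where M = borel]) measurable
  have Gm'[measurable]: "(\<lambda>x. G (a x) (b x)) \<in> borel_measurable M"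
    if "a \<in> M \<rightarrow>\<^sub>M ?S" "b \<in> borel_measurable M" for a b and M :: "'z measure"
    using measurable_compose[OF measurable_Pair[OF that] Gm] by simp
  define R where "R \<xi> = distr (density lborel (\<lambda>r. indicator {0<..} r * G \<xi> r)) borel (\<lambda>r. r *\<^sub>R \<xi>)" for \<xi>
  have nnR: "(\<integral>\<^sup>+x. f x \<partial>R \<xi>) = (\<integral>\<^sup>+r\<in>{0<..}. G \<xi> r * f (r *\<^sub>R \<xi>) \<partial>lborel)"
    if "\<xi> \<in> space \<Lambda>" and [measurable]: "f \<in> borel_measurable borel" for f \<xi>
  proof -
    have [measurable]: "G \<xi> \<in> borel_measurable borel"
      using that Gm'[of "\<lambda>_. \<xi>" borel "\<lambda>r. r"] by (simp add: spS sp\<Lambda>)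
    show ?thesis unfolding R_def by (simp add: nn_integral_distr nn_integral_density mult_ac)
  qed
  have eR: "emeasure (R \<xi>) B = (\<integral>\<^sup>+r\<in>{0<..}. G \<xi> r * indicator B (r *\<^sub>R \<xi>) \<partial>lborel)"
    if "\<xi> \<in> space \<Lambda>" "B \<in> sets borel" for B \<xi>
    using nnR[OF that(1), of "indicator B"] that(2) by (simp add: R_def)
  have nn\<nu>: "(\<integral>\<^sup>+x. f x \<partial>\<nu>) = (\<integral>\<^sup>+\<xi>. (\<integral>\<^sup>+r\<in>{0<..}. G \<xi> r * f (r *\<^sub>R \<xi>) \<partial>lborel) \<partial>\<Lambda>)"
    if f[measurable]: "f \<in> borel_measurable borel" for f
  proof -
    have "(\<integral>\<^sup>+x. f x \<partial>\<nu>) = (\<integral>\<^sup>+\<xi>. \<integral>\<^sup>+x. f x \<partial>R \<xi> \<partial>\<Lambda>)"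
    proof (rule nn_integral_kernel_mixture[THEN conjunct2, OF s\<nu> _ _ _ f])
      show "sets (R \<xi>) = sets borel" for \<xi> by (simp add: R_def)
      fix B :: "(real ^ 'n) set" assume B[measurable]: "B \<in> sets borel"
      have "(\<lambda>\<xi>. \<integral>\<^sup>+r\<in>{0<..}. G \<xi> r * indicator B (r *\<^sub>R \<xi>) \<partial>lborel) \<in> borel_measurable \<Lambda>"
        by measurable
      also have "?this \<longleftrightarrow> (\<lambda>\<xi>. emeasure (R \<xi>) B) \<in> borel_measurable \<Lambda>"
        by (intro measurable_cong) (simp only: eR B)
      finally show "(\<lambda>\<xi>. emeasure (R \<xi>) B) \<in> borel_measurable \<Lambda>" .
      show "emeasure \<nu> B = (\<integral>\<^sup>+\<xi>. emeasure (R \<xi>) B \<partial>\<Lambda>)"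
        unfolding eq\<nu>[OF B]
        by (intro nn_integral_cong) (auto simp: eR Gg sp\<Lambda> intro!: nn_integral_cong split: split_indicator)
    qed
    also have "\<dots> = (\<integral>\<^sup>+\<xi>. (\<integral>\<^sup>+r\<in>{0<..}. G \<xi> r * f (r *\<^sub>R \<xi>) \<partial>lborel) \<partial>\<Lambda>)"
      by (intro nn_integral_cong nnR f)
    finally show ?thesis .
  qed
  \<comment> \<open>An atom of the Bernstein measure at \<open>y = 1\<close> (that is, at \<open>t = 0\<close>) would make the density
    bounded below along the ray, contradicting the integrability at infinity.\<close>
  have atom: "AE \<xi> in \<Lambda>. ennreal (g \<xi> 1) * emeasure (K \<xi>) {1} = 0"
  proof -
    have "(\<integral>\<^sup>+\<xi>. (\<integral>\<^sup>+r\<in>{0<..}. G \<xi> r * ennreal (min 1 (\<phi> (norm (r *\<^sub>R \<xi>)))) \<partial>lborel) \<partial>\<Lambda>) \<noteq> \<infinity>"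
      using fin nn\<nu>[of "\<lambda>x. ennreal (min 1 (\<phi> (norm x)))"] by simp
    then have "AE \<xi> in \<Lambda>. (\<integral>\<^sup>+r\<in>{0<..}. G \<xi> r * ennreal (min 1 (\<phi> (norm (r *\<^sub>R \<xi>)))) \<partial>lborel) \<noteq> \<infinity>"
      by (rule nn_integral_PInf_AE[rotated]) measurable
    with AE_space show ?thesis
    proof eventually_elim
      fix \<xi> assume "\<xi> \<in> space \<Lambda>" and ne: "(\<integral>\<^sup>+r\<in>{0<..}. G \<xi> r * ennreal (min 1 (\<phi> (norm (r *\<^sub>R \<xi>)))) \<partial>lborel) \<noteq> \<infinity>"
      then have \<xi>: "\<xi> \<in> sphere 0 1" by (simp add: sp\<Lambda>)
      note [measurable_cong] = sK[of \<xi>, unfolded spS, OF \<xi>]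
      let ?a = "ennreal (g \<xi> 1) * emeasure (K \<xi>) {1}"
      have aG: "?a \<le> G \<xi> r" for r
      proof -
        have "?a = (\<integral>\<^sup>+y. ennreal (g \<xi> 1) * indicator {1} y \<partial>K \<xi>)"
          by (rule nn_integral_cmult_indicator[symmetric]) measurable
        also have "\<dots> \<le> G \<xi> r" unfolding G_def by (intro nn_integral_mono) (auto split: split_indicator)
        finally show ?thesis .
      qed
      have "(\<integral>\<^sup>+r. ?a * indicator {1::real..} r \<partial>lborel) \<le> (\<integral>\<^sup>+r\<in>{0<..}. G \<xi> r * ennreal (min 1 (\<phi> (norm (r *\<^sub>R \<xi>)))) \<partial>lborel)"
      proof (rule nn_integral_mono)
        fix r :: real
        show "?a * indicator {1::real..} r \<le> G \<xi> r * ennreal (min 1 (\<phi> (norm (r *\<^sub>R \<xi>)))) * indicator {0<..} r"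
        proof (cases "1 \<le> r")
          case True
          then have "min 1 (\<phi> (norm (r *\<^sub>R \<xi>))) = 1" using \<phi>1[of r] \<xi> by simp
          then show ?thesis using aG[of r] True by simp
        qed simp
      qed
      moreover have "(\<integral>\<^sup>+r. ?a * indicator {1::real..} r \<partial>lborel) = ?a * \<infinity>"
        by (subst nn_integral_cmult_indicator) (simp_all add: emeasure_lborel_atLeast)
      ultimately have "?a * \<infinity> \<noteq> \<infinity>" using ne by (auto simp: top_unique)
      then show "?a = 0" by (auto simp: ennreal_mult_top split: if_splits)
    qed
  qed
  \<comment> \<open>Solved from w * c * (1 / t) powr (- q) * exp (- \<open>\<phi> r\<close> * t) = g
    1 * y powr (\<open>\<phi> r\<close> - 1) with t = - ln y. It is set to 0 outside (0, 1), where t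
    is not a positive radius parameter.\<close>
  define w where "w \<xi> y = (if 0 < y \<and> y < 1 then g \<xi> 1 * y powr (- 1) * (- ln y) powr (- q) / c else 0)" for \<xi> y
  have wm: "(\<lambda>z. ennreal (w (fst z) (snd z))) \<in> borel_measurable (?S \<Otimes>\<^sub>M borel)"
    unfolding w_def by measurable
  define Q where "Q \<xi> = distr (density (K \<xi>) (\<lambda>y. ennreal (w \<xi> y))) borel (\<lambda>y. (1 / (- ln y)) *\<^sub>R \<xi>)" for \<xi>
  have nnQ: "(\<integral>\<^sup>+x. f x \<partial>Q \<xi>) = (\<integral>\<^sup>+y. ennreal (w \<xi> y) * f ((1 / (- ln y)) *\<^sub>R \<xi>) \<partial>K \<xi>)"
    if \<xi>: "\<xi> \<in> sphere 0 1" and [measurable]: "f \<in> borel_measurable borel" for f \<xi>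
  proof -
    note [measurable_cong] = sK[of \<xi>, unfolded spS, OF \<xi>]
    have [measurable]: "w \<xi> \<in> borel_measurable borel" unfolding w_def by measurable
    show ?thesis unfolding Q_def by (simp add: nn_integral_distr nn_integral_density)
  qed
  obtain \<rho> where s\<rho>: "sets \<rho> = sets borel"
    and nn\<rho>': "\<And>f. f \<in> borel_measurable borel \<Longrightarrow> (\<integral>\<^sup>+x. f x \<partial>\<rho>) = (\<integral>\<^sup>+\<xi>. \<integral>\<^sup>+x. f x \<partial>Q \<xi> \<partial>\<Lambda>)"
  proof (rule kernel_mixture_exists[of \<Lambda> Q borel])
    show "sets (Q \<xi>) = sets borel" for \<xi> by (simp add: Q_def)
    fix B :: "(real ^ 'n) set" assume B[measurable]: "B \<in> sets borel"
    have "(\<lambda>\<xi>. \<integral>\<^sup>+y. ennreal (w \<xi> y) * indicator B ((1 / (- ln y)) *\<^sub>R \<xi>) \<partial>K \<xi>) \<in> borel_measurable ?S"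
      by (rule measurable_kernel_nn_integral[OF K]) (use wm in measurable)
    also have "?this \<longleftrightarrow> (\<lambda>\<xi>. emeasure (Q \<xi>) B) \<in> borel_measurable ?S"
    proof (intro measurable_cong)
      fix \<xi> assume "\<xi> \<in> space ?S"
      then show "(\<integral>\<^sup>+y. ennreal (w \<xi> y) * indicator B ((1 / (- ln y)) *\<^sub>R \<xi>) \<partial>K \<xi>) = emeasure (Q \<xi>) B"
        using nnQ[of \<xi> "indicator B"] B by (simp add: Q_def spS)
    qed
    finally show "(\<lambda>\<xi>. emeasure (Q \<xi>) B) \<in> borel_measurable \<Lambda>"
      by (simp only: measurable_cong_sets[OF s\<Lambda> refl])
  qed (rule that)
  note [measurable_cong] = s\<rho>
  have nn\<rho>: "(\<integral>\<^sup>+x. f x \<partial>\<rho>) = (\<integral>\<^sup>+\<xi>. \<integral>\<^sup>+y. ennreal (w \<xi> y) * f ((1 / (- ln y)) *\<^sub>R \<xi>) \<partial>K \<xi> \<partial>\<Lambda>)"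
    if f: "f \<in> borel_measurable borel" for f
    unfolding nn\<rho>'[OF f] by (intro nn_integral_cong nnQ f) (simp add: sp\<Lambda>)
  have \<rho>0: "emeasure \<rho> {0} = 0"
  proof -
    have "emeasure \<rho> {0} = (\<integral>\<^sup>+x. indicator {0} x \<partial>\<rho>)" using s\<rho> by simp
    also have "\<dots> = (\<integral>\<^sup>+\<xi>. \<integral>\<^sup>+y. ennreal (w \<xi> y) * indicator {0} ((1 / (- ln y)) *\<^sub>R \<xi>) \<partial>K \<xi> \<partial>\<Lambda>)"
      by (rule nn\<rho>) simp
    also have "\<dots> = (\<integral>\<^sup>+\<xi>. \<integral>\<^sup>+y. 0 \<partial>K \<xi> \<partial>\<Lambda>)"
      by (intro nn_integral_cong) (auto simp: w_def sp\<Lambda> split: split_indicator)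
    finally show ?thesis by simp
  qed
  have \<rho>ae: "AE x in \<rho>. x \<noteq> 0" using \<rho>0 by (intro AE_I[of _ _ "{0}"]) (auto simp: s\<rho>)
  have mix: "\<nu> = ray_mixture ?p \<rho>"
  proof (rule ray_mixture_eqI[OF s\<rho> _ s\<nu>])
    show "case_prod ?p \<in> borel_measurable borel" by measurable
    fix B :: "(real ^ 'n) set" assume B[measurable]: "B \<in> sets borel"
    define I where "I x = (\<integral>\<^sup>+r\<in>{0<..}. ennreal (?p (norm x) r) * indicator B (r *\<^sub>R dir x) \<partial>lborel)" for x
    have pm: "(\<lambda>z. ?p (norm (fst z)) (snd z)) \<in> borel_measurable ((borel :: (real ^ 'n) measure) \<Otimes>\<^sub>M (borel :: real measure))"
      unfolding laplace_kernel_def by measurable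
    have Im: "I \<in> borel_measurable borel" unfolding I_def using pm by measurable
    have "(\<integral>\<^sup>+x. I x \<partial>\<rho>) = (\<integral>\<^sup>+\<xi>. \<integral>\<^sup>+y. ennreal (w \<xi> y) * I ((1 / (- ln y)) *\<^sub>R \<xi>) \<partial>K \<xi> \<partial>\<Lambda>)"
      by (rule nn\<rho>[OF Im])
    also have "\<dots> = (\<integral>\<^sup>+\<xi>. (\<integral>\<^sup>+r\<in>{0<..}. G \<xi> r * indicator B (r *\<^sub>R \<xi>) \<partial>lborel) \<partial>\<Lambda>)"
    proof (rule nn_integral_cong_AE)
      show "AE \<xi> in \<Lambda>. (\<integral>\<^sup>+y. ennreal (w \<xi> y) * I ((1 / (- ln y)) *\<^sub>R \<xi>) \<partial>K \<xi>) = (\<integral>\<^sup>+r\<in>{0<..}. G \<xi> r * indicator B (r *\<^sub>R \<xi>) \<partial>lborel)"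
        using atom AE_space
      proof eventually_elim
        fix \<xi> assume at: "ennreal (g \<xi> 1) * emeasure (K \<xi>) {1} = 0" and "\<xi> \<in> space \<Lambda>"
        then have \<xi>: "\<xi> \<in> sphere 0 1" by (simp add: sp\<Lambda>)
        then have \<xi>n: "norm \<xi> = 1" "\<xi> \<noteq> 0" by auto
        have \<xi>S: "\<xi> \<in> space ?S" using \<xi> by (simp add: spS)
        interpret K: prob_space "K \<xi>" by (rule kernel_prob_space[OF K \<xi>S])
        interpret pair_sigma_finite "K \<xi>" lborel ..
        note [measurable_cong] = sK[OF \<xi>S]
        let ?h = "\<lambda>y r. ennreal (g \<xi> 1 * y powr (\<phi> r - 1)) * (indicator B (r *\<^sub>R \<xi>) * indicator {0<..} r)"
        have "(\<integral>\<^sup>+y. ennreal (w \<xi> y) * I ((1 / (- ln y)) *\<^sub>R \<xi>) \<partial>K \<xi>) = (\<integral>\<^sup>+y. \<integral>\<^sup>+r. ?h y r \<partial>lborel \<partial>K \<xi>)"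
        proof (rule nn_integral_cong_AE)
          have "AE y in K \<xi>. g \<xi> 1 = 0 \<or> y \<noteq> 1"
          proof (cases "g \<xi> 1 = 0")
            case False
            then have "emeasure (K \<xi>) {1} = 0" using at g0[OF \<xi>] by (auto simp: ennreal_eq_0_iff)
            then have "AE y in K \<xi>. y \<noteq> 1" using sK[OF \<xi>S] by (intro AE_I[of _ _ "{1}"]) auto
            then show ?thesis by eventually_elim simp
          qed simp
          then show "AE y in K \<xi>. ennreal (w \<xi> y) * I ((1 / (- ln y)) *\<^sub>R \<xi>) = (\<integral>\<^sup>+r. ?h y r \<partial>lborel)" (is "AE y in _. ?P y")
            using aeK[OF \<xi>S]
          proof eventually_elim
            fix y :: real assume y: "0 < y \<and> y \<le> 1" and gy: "g \<xi> 1 = 0 \<or> y \<noteq> 1"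
            show "?P y"
            proof (cases "g \<xi> 1 = 0")
              case True
              then show ?thesis by (simp add: w_def)
            next
              case False
              with gy y have y: "0 < y" "y < 1" by auto
              define t where "t = - ln y"
              have t: "0 < t" using y by (simp add: t_def)
              have dn: "norm ((1 / t) *\<^sub>R \<xi>) = 1 / t" "dir ((1 / t) *\<^sub>R \<xi>) = \<xi>"
                using t \<xi>n by (simp_all add: dir_def)
              have w0: "0 \<le> w \<xi> y" using g0[OF \<xi>] c by (simp add: w_def)
              have wp: "w \<xi> y * ?p (1 / t) r = g \<xi> 1 * y powr (\<phi> r - 1)" for r
              proof -
                have "exp (- \<phi> r / (1 / t)) = y powr (\<phi> r)" using y by (simp add: powr_def t_def)
                moreover have "(1 / t) powr (- q) = t powr q" using t by (simp add: powr_divide powr_minus_divide)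
                moreover have "t powr (- q) * t powr q = 1" using t by (simp add: powr_add[symmetric])
                moreover have "y powr (\<phi> r - 1) = y powr (- 1) * y powr (\<phi> r)"
                  by (simp only: powr_add[symmetric]) (simp add: add.commute)
                ultimately show ?thesis
                  using y c by (simp add: w_def laplace_kernel_def t_def[symmetric])
              qed
              have [measurable]: "?p s \<in> borel_measurable borel" for s unfolding laplace_kernel_def[abs_def] by measurable
              have "ennreal (w \<xi> y) * I ((1 / (- ln y)) *\<^sub>R \<xi>)
                = (\<integral>\<^sup>+r. ennreal (w \<xi> y) * (ennreal (?p (1 / t) r) * indicator B (r *\<^sub>R \<xi>) * indicator {0<..} r) \<partial>lborel)"
                unfolding t_def[symmetric] I_def dn by (rule nn_integral_cmult[symmetric]) measurable
              also have "\<dots> = (\<integral>\<^sup>+r. ?h y r \<partial>lborel)"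
                by (intro nn_integral_cong) (simp add: wp[symmetric] ennreal_mult'[OF w0] mult.assoc)
              finally show ?thesis .
            qed
          qed
        qed
        also have "\<dots> = (\<integral>\<^sup>+r. \<integral>\<^sup>+y. ?h y r \<partial>K \<xi> \<partial>lborel)" by (rule Fubini'[symmetric]) measurable
        also have "\<dots> = (\<integral>\<^sup>+r\<in>{0<..}. G \<xi> r * indicator B (r *\<^sub>R \<xi>) \<partial>lborel)"
        proof (rule nn_integral_cong)
          fix r :: real
          show "(\<integral>\<^sup>+y. ?h y r \<partial>K \<xi>) = G \<xi> r * indicator B (r *\<^sub>R \<xi>) * indicator {0<..} r"
            unfolding G_def mult.assoc by (rule nn_integral_multc) measurable
        qed
        finally show "(\<integral>\<^sup>+y. ennreal (w \<xi> y) * I ((1 / (- ln y)) *\<^sub>R \<xi>) \<partial>K \<xi>) = (\<integral>\<^sup>+r\<in>{0<..}. G \<xi> r * indicator B (r *\<^sub>R \<xi>) \<partial>lborel)" .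
      qed
    qed
    also have "\<dots> = (\<integral>\<^sup>+x. indicator B x \<partial>\<nu>)" by (rule nn\<nu>[symmetric]) simp
    also have "\<dots> = emeasure \<nu> B" using s\<nu> by simp
    finally show "emeasure \<nu> B = (\<integral>\<^sup>+x. (\<integral>\<^sup>+r\<in>{0<..}. ennreal (?p (norm x) r) * indicator B (r *\<^sub>R dir x) \<partial>lborel) \<partial>\<rho>)"
      unfolding I_def by simp
  qed
  have "(\<integral>\<^sup>+x. ennreal (min 1 (norm x)) \<partial>\<rho>) < \<infinity>"
  proof -
    \<comment> \<open>Each point x contributes at least min 1 |x| / 4 to the integral of min 1
      (\<open>\<phi>\<close> |y|) under the mixture. With the square for \<open>\<phi>\<close> this
      is how the quadratic Levy condition on \<nu> becomes the linear one on \<rho>.\<close>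
    have "(\<integral>\<^sup>+x. ennreal (min 1 (norm x) / 4) \<partial>\<rho>)
      \<le> (\<integral>\<^sup>+x. (\<integral>\<^sup>+r\<in>{0<..}. ennreal (?p (norm x) r) * ennreal (min 1 (\<phi> (norm (r *\<^sub>R dir x)))) \<partial>lborel) \<partial>\<rho>)"
    proof (rule nn_integral_mono_AE)
      show "AE x in \<rho>. ennreal (min 1 (norm x) / 4) \<le> (\<integral>\<^sup>+r\<in>{0<..}. ennreal (?p (norm x) r) * ennreal (min 1 (\<phi> (norm (r *\<^sub>R dir x)))) \<partial>lborel)" (is "AE x in _. ?P x")
        using \<rho>ae
      proof eventually_elim
        fix x :: "real ^ 'n" assume x: "x \<noteq> 0"
        have "ennreal (min 1 (norm x) / 4) \<le> (\<integral>\<^sup>+r\<in>{0<..}. ennreal (?p (norm x) r) * ennreal (min 1 (\<phi> r)) \<partial>lborel)"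
          using x by (intro laplace_kernel_truncated_lower_bound c q \<phi> \<phi>pos tot) auto
        also have "\<dots> = (\<integral>\<^sup>+r\<in>{0<..}. ennreal (?p (norm x) r) * ennreal (min 1 (\<phi> (norm (r *\<^sub>R dir x)))) \<partial>lborel)"
          by (intro nn_integral_cong) (auto simp: norm_dir[OF x] split: split_indicator)
        finally show "?P x" .
      qed
    qed
    also have "\<dots> = (\<integral>\<^sup>+x. ennreal (min 1 (\<phi> (norm x))) \<partial>\<nu>)"
      unfolding mix by (rule nn_integral_ray_mixture[OF s\<rho>, symmetric]) measurable
    also have "\<dots> < \<infinity>" by (rule fin)
    finally have "4 * (\<integral>\<^sup>+x. ennreal (min 1 (norm x) / 4) \<partial>\<rho>) < \<infinity>" by (simp add: ennreal_mult_less_top)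
    also have "4 * (\<integral>\<^sup>+x. ennreal (min 1 (norm x) / 4) \<partial>\<rho>) = (\<integral>\<^sup>+x. ennreal 4 * ennreal (min 1 (norm x) / 4) \<partial>\<rho>)"
      using m4 by (subst nn_integral_cmult) (simp_all add: measurable_cong_sets[OF s\<rho> refl])
    also have "\<dots> = (\<integral>\<^sup>+x. ennreal (min 1 (norm x)) \<partial>\<rho>)"
      by (intro nn_integral_cong) (simp only: ennreal_mult'[symmetric], simp)
    finally show ?thesis .
  qed
  then have "\<rho> \<in> levy_measures1" by (rule levy_measures1I[OF s\<rho> \<rho>0])
  with mix show thesis by (rule that[rotated])
qed

section \<open>The two instances and the equivalences\<close>

lemma levy_measures_B_imp_Upsilon0:
  fixes \<nu> :: "(real ^ 'n) measure"
  assumes B: "\<nu> \<in> levy_measures_B" and \<nu>: "\<nu> \<in> levy_measures1"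
  obtains \<rho> where "\<rho> \<in> levy_measures1" "\<nu> = Upsilon0 \<rho>"
proof -
  obtain l where l: "completely_monotone_family l" "has_radial_density \<nu> (\<lambda>\<xi> r. l \<xi> r)"
    using B by (auto simp: levy_measures_B_def)
  have "sets \<nu> = sets borel" "(\<integral>\<^sup>+x. ennreal (min 1 (norm x)) \<partial>\<nu>) < \<infinity>"
    using \<nu> by (auto simp: levy_measures1_def levy_measures_def)
  then obtain \<rho> where \<rho>: "\<rho> \<in> levy_measures1" "\<nu> = ray_mixture (laplace_kernel 1 1 (\<lambda>r. r)) \<rho>"
    using radial_density_imp_laplace_mixture[OF _ l, of 1 1] kernel_total_exponential by auto
  then show thesis
    using that[of \<rho>] Upsilon0_eq_laplace_mixture[of \<rho>] by (simp add: levy_measures1_def)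
qed

lemma Upsilon0_levy_measures_B:
  fixes \<rho> :: "(real ^ 'n) measure"
  assumes \<rho>: "\<rho> \<in> levy_measures1"
  shows "Upsilon0 \<rho> \<in> levy_measures_B \<inter> levy_measures1"
proof -
  have levy: "\<rho> \<in> levy_measures" using \<rho> by (simp add: levy_measures1_def)
  obtain g where "completely_monotone_family g" "has_radial_density (ray_mixture (laplace_kernel 1 1 (\<lambda>r. r)) \<rho>) (\<lambda>\<xi> r. g \<xi> r)"
    using laplace_mixture_has_radial_density[OF \<rho>, of 1 1 "\<lambda>r. r"] by auto
  then show ?thesis
    using Upsilon0_levy_measures1[OF \<rho>] Upsilon0_eq_laplace_mixture[OF levy]
    by (auto simp: levy_measures_B_def levy_measures1_def)
qed

lemma radial_density_square_imp_A1_Upsilon0: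
  fixes \<nu> :: "(real ^ 'n) measure"
  assumes \<nu>: "\<nu> \<in> levy_measures" and g: "completely_monotone_family g" "has_radial_density \<nu> (\<lambda>\<xi> r. g \<xi> (r\<^sup>2))"
  obtains \<rho> where "\<rho> \<in> levy_measures1" "\<nu> = A1 (Upsilon0 \<rho>)"
proof -
  have "sets \<nu> = sets borel" "(\<integral>\<^sup>+x. ennreal (min 1 ((norm x)\<^sup>2)) \<partial>\<nu>) < \<infinity>"
    using \<nu> by (auto simp: levy_measures_def)
  then obtain \<rho> where \<rho>: "\<rho> \<in> levy_measures1"
    "\<nu> = ray_mixture (laplace_kernel (2 / sqrt pi) (1 / 2) (\<lambda>r. r\<^sup>2)) \<rho>"
    using radial_density_imp_laplace_mixture[OF _ g, of "2 / sqrt pi" "1 / 2"] kernel_total_gaussian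
    by (auto simp: one_le_power)
  then show thesis
    using that[of \<rho>] A1_Upsilon0_eq_ray_mixture[of \<rho>] by (simp add: levy_measures1_def)
qed

lemma A1_Upsilon0_has_radial_density_square:
  fixes \<rho> :: "(real ^ 'n) measure"
  assumes \<rho>: "\<rho> \<in> levy_measures1"
  obtains g where "completely_monotone_family g" "has_radial_density (A1 (Upsilon0 \<rho>)) (\<lambda>\<xi> r. g \<xi> (r\<^sup>2))"
proof -
  have levy: "\<rho> \<in> levy_measures" using \<rho> by (simp add: levy_measures1_def)
  show thesis
    using laplace_mixture_has_radial_density[OF \<rho>, of "2 / sqrt pi" "1 / 2" "\<lambda>r. r\<^sup>2"] that
    unfolding A1_Upsilon0_eq_ray_mixture[OF levy] by auto
qed

theorem theorem3p11:
  fixes \<mu>' :: "(real ^ 'n) measure" and \<Sigma>' :: "real ^ 'n ^ 'n"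
    and \<nu>' :: "(real ^ 'n) measure" and \<gamma>' :: "real ^ 'n"
  assumes "infinitely_divisible \<mu>'"
    and "has_levy_khintchine_triplet \<mu>' \<Sigma>' \<nu>' \<gamma>'"
  shows "(\<mu>' \<in> type_G \<longleftrightarrow> (\<exists>\<nu> \<in> levy_measures_B \<inter> levy_measures1. \<nu>' = A1 \<nu>)) \<and>
         ((\<exists>\<nu> \<in> levy_measures_B \<inter> levy_measures1. \<nu>' = A1 \<nu>)
            \<longleftrightarrow> (\<exists>\<rho> \<in> levy_measures1. \<nu>' = A1 (Upsilon0 \<rho>))) \<and>
         (\<forall>\<nu>1 \<in> levy_measures_B \<inter> levy_measures1. \<forall>\<nu>2 \<in> levy_measures_B \<inter> levy_measures1.
            \<nu>' = A1 \<nu>1 \<longrightarrow> \<nu>' = A1 \<nu>2 \<longrightarrow> \<nu>1 = \<nu>2) \<and>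
         (\<forall>\<rho>1 \<in> levy_measures1. \<forall>\<rho>2 \<in> levy_measures1.
            \<nu>' = A1 (Upsilon0 \<rho>1) \<longrightarrow> \<nu>' = A1 (Upsilon0 \<rho>2) \<longrightarrow> \<rho>1 = \<rho>2)"
proof -
  let ?b = "\<exists>\<nu> \<in> levy_measures_B \<inter> levy_measures1. \<nu>' = A1 \<nu>"
  let ?c = "\<exists>\<rho> \<in> levy_measures1. \<nu>' = A1 (Upsilon0 \<rho>)"
  have bc: "?b \<longleftrightarrow> ?c"
    by (metis Int_iff Upsilon0_levy_measures_B levy_measures_B_imp_Upsilon0)
  have "\<mu>' \<in> type_G \<longleftrightarrow> ?c"
  proof
    assume "\<mu>' \<in> type_G"
    then obtain \<Sigma> \<nu> \<gamma> g where t: "has_levy_khintchine_triplet \<mu>' \<Sigma> \<nu> \<gamma>"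
      and g: "completely_monotone_family g" "has_radial_density \<nu> (\<lambda>\<xi> r. g \<xi> (r\<^sup>2))"
      by (auto simp: type_G_def)
    have "\<nu> = \<nu>'" by (rule levy_khintchine_measure_unique[OF t assms(2)])
    moreover have "\<nu> \<in> levy_measures" using t by (simp add: has_levy_khintchine_triplet_def)
    ultimately show ?c using radial_density_square_imp_A1_Upsilon0[OF _ g] by metis
  next
    assume ?c
    then obtain \<rho> where \<rho>: "\<rho> \<in> levy_measures1" and \<nu>': "\<nu>' = A1 (Upsilon0 \<rho>)" by blast
    obtain g where "completely_monotone_family g" "has_radial_density \<nu>' (\<lambda>\<xi> r. g \<xi> (r\<^sup>2))"
      unfolding \<nu>' by (rule A1_Upsilon0_has_radial_density_square[OF \<rho>])
    with assms show "\<mu>' \<in> type_G" unfolding type_G_def by auto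
  qed
  moreover have "\<nu>1 = \<nu>2"
    if \<nu>: "\<nu>1 \<in> levy_measures_B \<inter> levy_measures1" "\<nu>2 \<in> levy_measures_B \<inter> levy_measures1"
      and eq: "\<nu>' = A1 \<nu>1" "\<nu>' = A1 \<nu>2" for \<nu>1 \<nu>2
  proof -
    \<comment> \<open>\<open>A1\<close> is not inverted directly: both measures are written as
      images under \<open>Upsilon0\<close>, and the injectivity of the composition decides.\<close>
    obtain \<rho>1 where 1: "\<rho>1 \<in> levy_measures1" "\<nu>1 = Upsilon0 \<rho>1"
      using levy_measures_B_imp_Upsilon0[of \<nu>1] \<nu> by blast
    obtain \<rho>2 where 2: "\<rho>2 \<in> levy_measures1" "\<nu>2 = Upsilon0 \<rho>2"
      using levy_measures_B_imp_Upsilon0[of \<nu>2] \<nu> by blast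
    show ?thesis using A1_Upsilon0_inj[OF 1(1) 2(1)] 1 2 eq by simp
  qed
  moreover have "\<rho>1 = \<rho>2"
    if "\<rho>1 \<in> levy_measures1" "\<rho>2 \<in> levy_measures1" "\<nu>' = A1 (Upsilon0 \<rho>1)" "\<nu>' = A1 (Upsilon0 \<rho>2)" for \<rho>1 \<rho>2
    using A1_Upsilon0_inj[OF that(1,2)] that(3,4) by simp
  ultimately show ?thesis using bc by blast
qed

end
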